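(* Let $\mathcal{H}$ be an infinite dimensional separable complex Hilbert space and let $\mathcal{F}=\{f_i\}_{i\ge1}$ be a frame in a closed subspace $\mathcal{K}\subseteq\mathcal{H}$. Let $F$ be its synthesis operator, $F=U|F|$ the polar decomposition and $\{u_i\}=\{Ue_i\}$ the canonical Parseval frame. Assume that there exists a Parseval frame quadratically close to $\{f_i\}$, and denote by $\{s_i\}_{i=1}^{\alpha}$ ($1\le\alpha\le\infty$) the nonzero singular values of $F$. Then for any integer $k$ with $1\le k\le\alpha$ the following statements hold: (i) There exists a symmetric approximation of the frame $\{f_i\}$ in $\mathcal{Q}_{\mathcal{F}}^k$ if and only if there are $k$ nonzero singular values $\{s_{n_i}\}_{i=1}^k$ (with distinct indices $n_1,\dots,n_k$) satisfying $s_{n_1}\le\dots\le s_{n_k}\le s_j$ for all $j\ne n_1,\dots,n_k$. (ii) Assume that the condition for existence in (i) holds, and define $$\mathbb{A}:=\{j: 0<s_j<s_{n_k}\},\qquad \mathbb{B}:=\{j: s_j=s_{n_k}\}.$$ Then all the symmetric approximations of $\{f_i\}$ in $\mathcal{Q}_{\mathcal{F}}^k$ are given by $$\{u_i-U(E_0+E_1)e_i\},$$ where $E_0$ is the orthogonal projection onto $\bigoplus_{j\in\mathbb{A}}\ker(|F|-s_jI)$ and $E_1$ is any orthogonal projection such that $\operatorname{ran}(E_1)\subseteq\ker(|F|-s_{n_k}I)$ and $\operatorname{rank}(E_1)=k-\#\mathbb{A}$. In particular, there is a unique symmetric approximation if and only if $\#\mathbb{A}+\#\mathbb{B}=k$.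 Otherwise, there are infinitely many symmetric approximations.
   Context: A frame in a closed subspace $\mathcal{K}\subseteq\mathcal{H}$ is a sequence $\{f_i\}_{i\ge1}$ in $\mathcal{K}$ for which there are $A,B>0$ with $A\|f\|^2\le\sum_{i=1}^\infty|\langle f,f_i\rangle|^2\le B\|f\|^2$ for all $f\in\mathcal{K}$; it is a Parseval frame if one can take $A=B=1$. The zero subspace is allowed (the zero sequence is a Parseval frame in $\{0\}$). Two frames $\{f_i\}$, $\{g_i\}$ in subspaces of $\mathcal{H}$ are quadratically close if $\sum_{i=1}^\infty\|f_i-g_i\|^2<\infty$. The synthesis operator of $\{f_i\}$ is the bounded operator $F:\ell^2\to\mathcal{H}$, $F(e_i)=f_i$, with $\{e_i\}$ the standard basis of $\ell^2$; it has closed range $\mathcal{K}$, and for a Parseval frame it is a partial isometry. In the polar decomposition $F=U|F|$, $U$ is the unique partial isometry with $F=U|F|$ and $\ker(U)=\ker(F)$. Singular values: when a quadratically close Parseval frame exists, $\ker(F)^\perp$ has an orthonormal basis $\{g_i\}_{i=1}^\alpha$ of eigenvectors of $|F|$, $|F|g_i=s_ig_i$ with $s_i>0$; the nonzero singular values $\{s_i\}_{i=1}^\alpha$ of $F$ are these eigenvalues of $|F|$, repeated according to multiplicity (in no particular order), with $\alpha=\dim\ker(F)^\perp$. In the direct sum defining $E_0$, each eigenspace is taken once. $\mathcal{Q}_{\mathcal{F}}$ is the set of all Parseval frames in closed subspaces of $\mathcal{H}$ that are quadratically close to $\{f_i\}$. For orthogonal projections $P,Q$ on a Hilbert space such that $QP|_{\operatorname{ran}(P)}:\operatorname{ran}(P)\to\operatorname{ran}(Q)$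 is Fredholm, $j(P,Q)$ denotes the index of this operator, i.e. $j(P,Q)=\dim(\ker(Q)\cap\operatorname{ran}(P))-\dim(\operatorname{ran}(Q)\cap\ker(P))$. For $\{x_i\}\in\mathcal{Q}_{\mathcal{F}}$ with synthesis operator $X$, the index $j(U^*U,X^*X)$ is well defined. For an integer $k$, $\mathcal{Q}_{\mathcal{F}}^k=\{\{x_i\}\in\mathcal{Q}_{\mathcal{F}}: j(U^*U,X^*X)=k\}$. Given a nonempty family $\mathcal{Q}$ of Parseval frames in subspaces of $\mathcal{H}$, $\{y_i\}\in\mathcal{Q}$ is a symmetric approximation of $\{f_i\}$ in $\mathcal{Q}$ if $\sum_i\|f_i-y_i\|^2<\infty$ and $\sum_i\|f_i-y_i\|^2\le\sum_i\|f_i-x_i\|^2$ for all $\{x_i\}\in\mathcal{Q}$. *)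

theory Defs
  imports "HOL-Analysis.Analysis" "HOL-Library.Extended_Nat"
begin

section \<open>Complex Hilbert spaces\<close>

text \<open>Complex Hilbert spaces extend real ones, so that norm, topology and convergence are those of
  the library. The inner product \<^term>\<open>cinner\<close> is linear in the first argument and conjugate linear
  in the second.\<close>

class complex_vector = real_vector +
  fixes scaleC :: "complex \<Rightarrow> 'a \<Rightarrow> 'a" (infixr \<open>*\<^sub>C\<close> 75)
  assumes scaleR_scaleC: "scaleR r x = scaleC (complex_of_real r) x"
    and scaleC_add_right: "scaleC a (x + y) = scaleC a x + scaleC a y"
    and scaleC_add_left: "scaleC (a + b) x = scaleC a x + scaleC b x"
    and scaleC_scaleC: "scaleC a (scaleC b x) = scaleC (a * b) x"
    and scaleC_one: "scaleC 1 x = x"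

class complex_hilbert = complex_vector + real_inner + banach +
  fixes cinner :: "'a \<Rightarrow> 'a \<Rightarrow> complex"
  assumes cinner_commute: "cinner x y = cnj (cinner y x)"
    and cinner_add_left: "cinner (x + y) z = cinner x z + cinner y z"
    and cinner_scaleC_left: "cinner (scaleC a x) y = a * cinner x y"
    and inner_eq_Re_cinner: "inner x y = Re (cinner x y)"

global_interpretation complex_vector:
  vector_space "scaleC :: complex \<Rightarrow> 'a \<Rightarrow> 'a::complex_vector"
  defines csubspace = complex_vector.subspace
    and cspan = complex_vector.span
    and cdim = complex_vector.dim
  by unfold_locales (simp_all add: scaleC_add_right scaleC_add_left scaleC_scaleC scaleC_one)

text \<open>The library dimension \<^term>\<open>cdim\<close> is \<open>0\<close> for infinite-dimensional subspaces, hence the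
  separate predicate.\<close>

definition finite_cdim :: "'a::complex_vector set \<Rightarrow> bool" where
  "finite_cdim V \<longleftrightarrow> (\<exists>B. finite B \<and> V \<subseteq> cspan B)"

definition ortho_compl :: "'a::complex_hilbert set \<Rightarrow> 'a set" where
  "ortho_compl S = {x. \<forall>y\<in>S. cinner x y = 0}"


section \<open>The sequence space\<close>

typedef ell2 = "{x :: nat \<Rightarrow> complex. summable (\<lambda>i. (cmod (x i))\<^sup>2)}"
  morphisms coord Abs_ell2
  by (rule exI[of _ "\<lambda>_. 0"]) simp

lemma coord_summable: "summable (\<lambda>i. (cmod (coord x i))\<^sup>2)"
  using coord[of x] by simp

lemma coord_Abs: "summable (\<lambda>i. (cmod (x i))\<^sup>2) \<Longrightarrow> coord (Abs_ell2 x) = x"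
  by (simp add: Abs_ell2_inverse)

lemma ell2_eqI: "(\<And>i. coord x i = coord y i) \<Longrightarrow> x = y"
  by (metis coord_inject ext)

lemma square_summable_add:
  fixes x y :: "nat \<Rightarrow> complex"
  assumes "summable (\<lambda>i. (cmod (x i))\<^sup>2)" "summable (\<lambda>i. (cmod (y i))\<^sup>2)"
  shows "summable (\<lambda>i. (cmod (x i + y i))\<^sup>2)"
proof (rule summable_comparison_test')
  show "summable (\<lambda>i. 2 * (cmod (x i))\<^sup>2 + 2 * (cmod (y i))\<^sup>2)"
    using assms by (intro summable_add summable_mult)
  fix i :: nat
  have "(cmod (x i + y i))\<^sup>2 \<le> (cmod (x i) + cmod (y i))\<^sup>2"
    by (simp add: norm_triangle_ineq power_mono)
  also have "\<dots> \<le> 2 * (cmod (x i))\<^sup>2 + 2 * (cmod (y i))\<^sup>2"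
    using sum_squares_bound[of "cmod (x i)" "cmod (y i)"] by (simp add: power2_sum)
  finally show "norm ((cmod (x i + y i))\<^sup>2) \<le> 2 * (cmod (x i))\<^sup>2 + 2 * (cmod (y i))\<^sup>2"
    by simp
qed

lemma square_summable_scale:
  fixes x :: "nat \<Rightarrow> complex"
  assumes "summable (\<lambda>i. (cmod (x i))\<^sup>2)"
  shows "summable (\<lambda>i. (cmod (a * x i))\<^sup>2)"
  using summable_mult[OF assms, of "(cmod a)\<^sup>2"] by (simp add: norm_mult power_mult_distrib)

lemma summable_coord_prod: "summable (\<lambda>i. coord x i * cnj (coord y i))"
proof (rule summable_comparison_test')
  show "summable (\<lambda>i. (cmod (coord x i))\<^sup>2 + (cmod (coord y i))\<^sup>2)"
    by (intro summable_add coord_summable)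
  fix i :: nat
  show "norm (coord x i * cnj (coord y i)) \<le> (cmod (coord x i))\<^sup>2 + (cmod (coord y i))\<^sup>2"
    using sum_squares_bound[of "cmod (coord x i)" "cmod (coord y i)"]
      mult_nonneg_nonneg[OF norm_ge_zero[of "coord x i"] norm_ge_zero[of "coord y i"]]
    by (simp only: norm_mult complex_mod_cnj mult.assoc)
qed

instantiation ell2 :: complex_vector
begin

definition "0 = Abs_ell2 (\<lambda>_. 0)"
definition "x + y = Abs_ell2 (\<lambda>i. coord x i + coord y i)"
definition "scaleC a x = Abs_ell2 (\<lambda>i. a * coord x i)"
definition "- x = Abs_ell2 (\<lambda>i. - coord x i)"
definition "x - y = Abs_ell2 (\<lambda>i. coord x i - coord y i)"
definition "scaleR r x = Abs_ell2 (\<lambda>i. complex_of_real r * coord x i)"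

lemma coord_zero [simp]: "coord 0 i = 0"
  by (simp add: zero_ell2_def coord_Abs)

lemma coord_add [simp]: "coord (x + y) i = coord x i + coord y i"
  by (simp add: plus_ell2_def coord_Abs square_summable_add coord_summable)

lemma coord_scaleC [simp]: "coord (scaleC a x) i = a * coord x i"
  by (simp only: scaleC_ell2_def coord_Abs square_summable_scale coord_summable)

lemma coord_uminus [simp]: "coord (- x) i = - coord x i"
  by (simp add: uminus_ell2_def coord_Abs coord_summable)

lemma coord_diff [simp]: "coord (x - y) i = coord x i - coord y i"
  using square_summable_add[OF coord_summable[of x] coord_summable[of "- y"]]
  by (simp add: minus_ell2_def coord_Abs)

lemma coord_scaleR [simp]: "coord (scaleR r x) i = complex_of_real r * coord x i"
  by (simp only: scaleR_ell2_def coord_Abs square_summable_scale coord_summable)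

instance
  by intro_classes (auto intro!: ell2_eqI simp: algebra_simps)

end

instantiation ell2 :: real_inner
begin

definition inner_ell2 :: "ell2 \<Rightarrow> ell2 \<Rightarrow> real" where
  "inner_ell2 x y = Re (\<Sum>i. coord x i * cnj (coord y i))"
definition norm_ell2 :: "ell2 \<Rightarrow> real" where
  "norm_ell2 x = sqrt (\<Sum>i. (cmod (coord x i))\<^sup>2)"
definition dist_ell2 :: "ell2 \<Rightarrow> ell2 \<Rightarrow> real" where
  "dist_ell2 x y = norm (x - y)"
definition sgn_ell2 :: "ell2 \<Rightarrow> ell2" where
  "sgn_ell2 x = x /\<^sub>R norm x"
definition uniformity_ell2 :: "(ell2 \<times> ell2) filter" where
  "uniformity_ell2 = (INF e\<in>{0<..}. principal {(x, y). dist x y < e})"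
definition open_ell2 :: "ell2 set \<Rightarrow> bool" where
  "open_ell2 U = (\<forall>x\<in>U. eventually (\<lambda>(x', y). x' = x \<longrightarrow> y \<in> U) uniformity)"

lemma inner_ell2_sums: "(\<lambda>i. Re (coord x i * cnj (coord y i))) sums inner x y"
  unfolding inner_ell2_def by (intro sums_Re summable_sums summable_coord_prod)

lemma inner_ell2_self: "inner x x = (\<Sum>i. (cmod (coord x i))\<^sup>2)" for x :: ell2
  using inner_ell2_sums[of x x] by (simp add: sums_iff flip: complex_norm_square)

instance
proof
  fix x y z :: ell2 and r :: real
  show "dist x y = norm (x - y)" by (rule dist_ell2_def)
  show "sgn x = x /\<^sub>R norm x" by (rule sgn_ell2_def)
  show "uniformity = (INF e\<in>{0<..}. principal {(x::ell2, y). dist x y < e})"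
    by (rule uniformity_ell2_def)
  show "open U = (\<forall>x\<in>U. eventually (\<lambda>(x', y). x' = x \<longrightarrow> y \<in> U) uniformity)"
    for U :: "ell2 set" by (rule open_ell2_def)
  show "inner x y = inner y x"
    using inner_ell2_sums[of x y] inner_ell2_sums[of y x]
    by (simp add: mult.commute sums_iff)
  show "inner (x + y) z = inner x z + inner y z"
    using sums_add[OF inner_ell2_sums[of x z] inner_ell2_sums[of y z]]
      inner_ell2_sums[of "x + y" z]
    by (simp add: algebra_simps sums_iff)
  show "inner (r *\<^sub>R x) y = r * inner x y"
    using sums_mult[OF inner_ell2_sums[of x y], of r] inner_ell2_sums[of "r *\<^sub>R x" y]
    by (simp add: algebra_simps sums_iff)
  show "0 \<le> inner x x"
    by (simp add: inner_ell2_self suminf_nonneg coord_summable)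
  show "inner x x = 0 \<longleftrightarrow> x = 0"
    using suminf_eq_zero_iff[OF coord_summable[of x]]
    by (auto simp: inner_ell2_self intro: ell2_eqI)
  show "norm x = sqrt (inner x x)"
    by (simp add: norm_ell2_def inner_ell2_self)
qed

end

lemma norm_ell2_power2: "(norm x)\<^sup>2 = (\<Sum>i. (cmod (coord x i))\<^sup>2)" for x :: ell2
  by (simp add: norm_ell2_def suminf_nonneg coord_summable)

lemma sum_coord_le_norm: "(\<Sum>i<n. (cmod (coord x i))\<^sup>2) \<le> (norm x)\<^sup>2"
  unfolding norm_ell2_power2 by (intro sum_le_suminf coord_summable) auto

lemma cmod_coord_le_norm: "cmod (coord x i) \<le> norm x"
proof -
  have "(cmod (coord x i))\<^sup>2 \<le> (\<Sum>j<Suc i. (cmod (coord x j))\<^sup>2)"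
    by (simp add: sum_nonneg)
  also have "\<dots> \<le> (norm x)\<^sup>2" by (rule sum_coord_le_norm)
  finally show ?thesis by (simp add: power2_le_iff_abs_le)
qed

instance ell2 :: banach
proof
  fix X :: "nat \<Rightarrow> ell2"
  assume X: "Cauchy X"
  have "Cauchy (\<lambda>n. coord (X n) i)" for i
    unfolding Cauchy_def
  proof (intro allI impI)
    fix e :: real assume "e > 0"
    then obtain M where M: "\<And>m n. m \<ge> M \<Longrightarrow> n \<ge> M \<Longrightarrow> dist (X m) (X n) < e"
      using X unfolding Cauchy_def by blast
    have "dist (coord (X m) i) (coord (X n) i) \<le> dist (X m) (X n)" for m n
      using cmod_coord_le_norm[of "X m - X n" i] by (simp add: dist_norm)
    then show "\<exists>M. \<forall>m\<ge>M. \<forall>n\<ge>M. dist (coord (X m) i) (coord (X n) i) < e"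
      using M by (meson order_le_less_trans)
  qed
  then have "\<forall>i. \<exists>l. (\<lambda>n. coord (X n) i) \<longlonglongrightarrow> l"
    using Cauchy_convergent_iff convergent_def by blast
  then obtain l where l: "\<And>i. (\<lambda>n. coord (X n) i) \<longlonglongrightarrow> l i" by metis
  have tail: "\<exists>M. \<forall>m\<ge>M. \<forall>N. (\<Sum>i<N. (cmod (coord (X m) i - l i))\<^sup>2) \<le> e\<^sup>2" if "e > 0" for e
  proof -
    obtain M where M: "\<And>m n. m \<ge> M \<Longrightarrow> n \<ge> M \<Longrightarrow> dist (X m) (X n) < e"
      using X \<open>e > 0\<close> unfolding Cauchy_def by blast
    have "(\<Sum>i<N. (cmod (coord (X m) i - l i))\<^sup>2) \<le> e\<^sup>2" if "m \<ge> M" for m N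
    proof (rule LIMSEQ_le_const2)
      show "(\<lambda>n. \<Sum>i<N. (cmod (coord (X m) i - coord (X n) i))\<^sup>2)
          \<longlonglongrightarrow> (\<Sum>i<N. (cmod (coord (X m) i - l i))\<^sup>2)"
        by (intro tendsto_intros l)
      have "(\<Sum>i<N. (cmod (coord (X m) i - coord (X n) i))\<^sup>2) \<le> e\<^sup>2" if "n \<ge> M" for n
      proof -
        have "(\<Sum>i<N. (cmod (coord (X m) i - coord (X n) i))\<^sup>2) \<le> (norm (X m - X n))\<^sup>2"
          using sum_coord_le_norm[of "X m - X n" N] by simp
        also have "\<dots> \<le> e\<^sup>2"
          using M[OF \<open>m \<ge> M\<close> that] by (intro power_mono) (auto simp: dist_norm)
        finally show ?thesis .
      qed
      then show "\<exists>K. \<forall>n\<ge>K. (\<Sum>i<N. (cmod (coord (X m) i - coord (X n) i))\<^sup>2) \<le> e\<^sup>2" by blast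
    qed
    then show ?thesis by blast
  qed
  have diff: "summable (\<lambda>i. (cmod (coord (X m) i - l i))\<^sup>2)"
    if "\<forall>N. (\<Sum>i<N. (cmod (coord (X m) i - l i))\<^sup>2) \<le> e" for m e
    by (rule summableI_nonneg_bounded[where x = e]) (use that in auto)
  have "summable (\<lambda>i. (cmod (l i))\<^sup>2)"
  proof -
    obtain m where "\<forall>N. (\<Sum>i<N. (cmod (coord (X m) i - l i))\<^sup>2) \<le> 1\<^sup>2"
      using tail[of 1] by auto
    from square_summable_add[OF diff[OF this] coord_summable[of "- X m"]]
    show ?thesis by simp
  qed
  then have L: "coord (Abs_ell2 l) = l" by (rule coord_Abs)
  have "X \<longlonglongrightarrow> Abs_ell2 l"
    unfolding LIMSEQ_def
  proof (intro allI impI)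
    fix e :: real assume "e > 0"
    then obtain M where M: "\<And>m N. m \<ge> M \<Longrightarrow> (\<Sum>i<N. (cmod (coord (X m) i - l i))\<^sup>2) \<le> (e/2)\<^sup>2"
      using tail[of "e/2"] by auto
    have "dist (X m) (Abs_ell2 l) < e" if "m \<ge> M" for m
    proof -
      have "(norm (X m - Abs_ell2 l))\<^sup>2 \<le> (e/2)\<^sup>2"
        unfolding norm_ell2_power2 coord_diff L
        using M[OF that] by (intro suminf_le_const diff[where e = "(e/2)\<^sup>2"]) auto
      then have "norm (X m - Abs_ell2 l) \<le> e/2"
        using \<open>e > 0\<close> power2_le_imp_le by fastforce
      then show ?thesis using \<open>e > 0\<close> by (simp add: dist_norm)
    qed
    then show "\<exists>M. \<forall>m\<ge>M. dist (X m) (Abs_ell2 l) < e" by blast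
  qed
  then show "convergent X" by (auto simp: convergent_def)
qed

instantiation ell2 :: complex_hilbert
begin

definition cinner_ell2 :: "ell2 \<Rightarrow> ell2 \<Rightarrow> complex" where
  "cinner_ell2 x y = (\<Sum>i. coord x i * cnj (coord y i))"

instance
proof
  fix x y z :: ell2 and a :: complex
  note s = summable_sums[OF summable_coord_prod, folded cinner_ell2_def]
  show "cinner x y = cnj (cinner y x)"
    using s[of x y] sums_cnj[THEN iffD2, OF s[of y x]] by (simp add: mult.commute sums_iff)
  show "cinner (x + y) z = cinner x z + cinner y z"
    using sums_add[OF s[of x z] s[of y z]] s[of "x + y" z] by (simp add: algebra_simps sums_iff)
  show "cinner (a *\<^sub>C x) y = a * cinner x y"
    using sums_mult[OF s[of x y], of a] s[of "a *\<^sub>C x" y] by (simp add: algebra_simps sums_iff)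
  show "inner x y = Re (cinner x y)"
    by (simp add: inner_ell2_def cinner_ell2_def)
qed

end

definition std_basis :: "nat \<Rightarrow> ell2" where
  "std_basis i = Abs_ell2 (\<lambda>j. if j = i then 1 else 0)"

lemma coord_std_basis: "coord (std_basis i) j = (if j = i then 1 else 0)"
proof -
  have "summable (\<lambda>j. (cmod (if j = i then 1 else 0))\<^sup>2)"
    by (rule summable_finite[of "{i}"]) auto
  then show ?thesis by (simp add: std_basis_def coord_Abs)
qed


section \<open>Operators\<close>

definition bounded_clinear :: "('a::complex_hilbert \<Rightarrow> 'b::complex_hilbert) \<Rightarrow> bool" where
  "bounded_clinear T \<longleftrightarrow> bounded_linear T \<and> (\<forall>a x. T (a *\<^sub>C x) = a *\<^sub>C T x)"

definition kernel :: "('a \<Rightarrow> 'b::zero) \<Rightarrow> 'a set" where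
  "kernel T = {x. T x = 0}"

definition adj :: "('a::complex_hilbert \<Rightarrow> 'b::complex_hilbert) \<Rightarrow> 'b \<Rightarrow> 'a" where
  "adj T = (THE S. bounded_clinear S \<and> (\<forall>x y. cinner (T x) y = cinner x (S y)))"

definition positive_op :: "('a::complex_hilbert \<Rightarrow> 'a) \<Rightarrow> bool" where
  "positive_op T \<longleftrightarrow> bounded_clinear T \<and> (\<forall>x. cinner (T x) x \<in> \<real> \<and> 0 \<le> Re (cinner (T x) x))"

definition abs_op :: "('a::complex_hilbert \<Rightarrow> 'b::complex_hilbert) \<Rightarrow> 'a \<Rightarrow> 'a" where
  "abs_op T = (THE S. positive_op S \<and> S \<circ> S = adj T \<circ> T)"

definition partial_isometry :: "('a::complex_hilbert \<Rightarrow> 'b::complex_hilbert) \<Rightarrow> bool" where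
  "partial_isometry U \<longleftrightarrow> bounded_clinear U \<and> (\<forall>x\<in>ortho_compl (kernel U). norm (U x) = norm x)"

definition polar_part :: "('a::complex_hilbert \<Rightarrow> 'b::complex_hilbert) \<Rightarrow> 'a \<Rightarrow> 'b" where
  "polar_part T = (THE U. partial_isometry U \<and> T = U \<circ> abs_op T \<and> kernel U = kernel T)"

definition orth_projection :: "('a::complex_hilbert \<Rightarrow> 'a) \<Rightarrow> bool" where
  "orth_projection E \<longleftrightarrow>
     bounded_clinear E \<and> E \<circ> E = E \<and> (\<forall>x y. cinner (E x) y = cinner x (E y))"

definition projection_onto :: "'a::complex_hilbert set \<Rightarrow> 'a \<Rightarrow> 'a" where
  "projection_onto M = (THE E. orth_projection E \<and> range E = M)"

definition has_rank :: "('a::complex_hilbert \<Rightarrow> 'b::complex_hilbert) \<Rightarrow> nat \<Rightarrow> bool" where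
  "has_rank T r \<longleftrightarrow> finite_cdim (range T) \<and> cdim (range T) = r"

definition eigenspace :: "('a::complex_hilbert \<Rightarrow> 'a) \<Rightarrow> real \<Rightarrow> 'a set" where
  "eigenspace T t = kernel (\<lambda>x. T x - t *\<^sub>R x)"

text \<open>\<open>T\<close> restricted to an operator from \<open>V\<close> to \<open>W\<close> is Fredholm: finite-dimensional kernel, closed
  range, and range of finite codimension in \<open>W\<close>.\<close>

definition fredholm_on ::
  "'a::complex_hilbert set \<Rightarrow> 'b::complex_hilbert set \<Rightarrow> ('a \<Rightarrow> 'b) \<Rightarrow> bool" where
  "fredholm_on V W T \<longleftrightarrow>
     finite_cdim (V \<inter> kernel T) \<and> closed (T ` V) \<and> (\<exists>B. finite B \<and> W = cspan (T ` V \<union> B))"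

definition fredholm_pair :: "('a::complex_hilbert \<Rightarrow> 'a) \<Rightarrow> ('a \<Rightarrow> 'a) \<Rightarrow> bool" where
  "fredholm_pair P Q \<longleftrightarrow> fredholm_on (range P) (range Q) (Q \<circ> P)"

definition pair_index :: "('a::complex_hilbert \<Rightarrow> 'a) \<Rightarrow> ('a \<Rightarrow> 'a) \<Rightarrow> int" where
  "pair_index P Q = int (cdim (kernel Q \<inter> range P)) - int (cdim (range Q \<inter> kernel P))"


section \<open>Frames\<close>

definition frame_in :: "'h::complex_hilbert set \<Rightarrow> (nat \<Rightarrow> 'h) \<Rightarrow> bool" where
  "frame_in K f \<longleftrightarrow>
     csubspace K \<and> closed K \<and> (\<forall>i. f i \<in> K) \<and>
     (\<exists>A>0. \<exists>B>0. \<forall>x\<in>K. summable (\<lambda>i. (cmod (cinner x (f i)))\<^sup>2) \<and>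
        A * (norm x)\<^sup>2 \<le> (\<Sum>i. (cmod (cinner x (f i)))\<^sup>2) \<and>
        (\<Sum>i. (cmod (cinner x (f i)))\<^sup>2) \<le> B * (norm x)\<^sup>2)"

definition parseval_frame_in :: "'h::complex_hilbert set \<Rightarrow> (nat \<Rightarrow> 'h) \<Rightarrow> bool" where
  "parseval_frame_in K f \<longleftrightarrow>
     csubspace K \<and> closed K \<and> (\<forall>i. f i \<in> K) \<and>
     (\<forall>x\<in>K. (\<lambda>i. (cmod (cinner x (f i)))\<^sup>2) sums (norm x)\<^sup>2)"

definition quadratically_close :: "(nat \<Rightarrow> 'h::complex_hilbert) \<Rightarrow> (nat \<Rightarrow> 'h) \<Rightarrow> bool" where
  "quadratically_close f g \<longleftrightarrow> summable (\<lambda>i. (norm (f i - g i))\<^sup>2)"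

definition synthesis :: "(nat \<Rightarrow> 'h::complex_hilbert) \<Rightarrow> ell2 \<Rightarrow> 'h" where
  "synthesis f = (THE F. bounded_clinear F \<and> (\<forall>i. F (std_basis i) = f i))"

definition close_parseval_frames :: "(nat \<Rightarrow> 'h::complex_hilbert) \<Rightarrow> (nat \<Rightarrow> 'h) set" where
  "close_parseval_frames f = {x. (\<exists>M. parseval_frame_in M x) \<and> quadratically_close f x}"

text \<open>The index of a pair of projections is only defined for Fredholm pairs, so having index \<open>k\<close>
  includes being Fredholm.\<close>

definition close_parseval_frames_index ::
  "(nat \<Rightarrow> 'h::complex_hilbert) \<Rightarrow> int \<Rightarrow> (nat \<Rightarrow> 'h) set" where
  "close_parseval_frames_index f k =
     {x \<in> close_parseval_frames f.
        let U = polar_part (synthesis f); X = synthesis x in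
          fredholm_pair (adj U \<circ> U) (adj X \<circ> X) \<and>
          pair_index (adj U \<circ> U) (adj X \<circ> X) = k}"

text \<open>The premise in the last line treats divergent sums as infinite.\<close>

definition symmetric_approximation ::
  "(nat \<Rightarrow> 'h::complex_hilbert) \<Rightarrow> (nat \<Rightarrow> 'h) set \<Rightarrow> (nat \<Rightarrow> 'h) \<Rightarrow> bool" where
  "symmetric_approximation f Q y \<longleftrightarrow>
     y \<in> Q \<and> summable (\<lambda>i. (norm (f i - y i))\<^sup>2) \<and>
     (\<forall>x\<in>Q. summable (\<lambda>i. (norm (f i - x i))\<^sup>2) \<longrightarrow>
        (\<Sum>i. (norm (f i - y i))\<^sup>2) \<le> (\<Sum>i. (norm (f i - x i))\<^sup>2))"

text \<open>The indices \<open>1, \<dots>, \<alpha>\<close>, where \<open>\<alpha>\<close> may be infinite.\<close>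

definition index_set :: "enat \<Rightarrow> nat set" where
  "index_set \<alpha> = {i. 1 \<le> i \<and> enat i \<le> \<alpha>}"

text \<open>\<open>s\<close> enumerates the nonzero singular values of \<open>T\<close>, in some order and with multiplicity, along
  an orthonormal basis \<open>g\<close> of the orthogonal complement of the kernel.\<close>

definition nonzero_singular_values ::
  "('a::complex_hilbert \<Rightarrow> 'b::complex_hilbert) \<Rightarrow> enat \<Rightarrow> (nat \<Rightarrow> real) \<Rightarrow> bool" where
  "nonzero_singular_values T \<alpha> s \<longleftrightarrow>
     (\<exists>g. (\<forall>i\<in>index_set \<alpha>. \<forall>j\<in>index_set \<alpha>. cinner (g i) (g j) = (if i = j then 1 else 0)) \<and>
          closure (cspan (g ` index_set \<alpha>)) = ortho_compl (kernel T) \<and>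
          (\<forall>i\<in>index_set \<alpha>. 0 < s i \<and> abs_op T (g i) = s i *\<^sub>R g i))"

text \<open>\<open>s (n 1) \<le> \<dots> \<le> s (n k)\<close> are \<open>k\<close> smallest terms of the family \<open>s\<close>.\<close>

definition smallest_terms :: "enat \<Rightarrow> (nat \<Rightarrow> real) \<Rightarrow> nat \<Rightarrow> (nat \<Rightarrow> nat) \<Rightarrow> bool" where
  "smallest_terms \<alpha> s k n \<longleftrightarrow>
     n ` {1..k} \<subseteq> index_set \<alpha> \<and> inj_on n {1..k} \<and>
     (\<forall>i\<in>{1..k}. \<forall>j\<in>{1..k}. i \<le> j \<longrightarrow> s (n i) \<le> s (n j)) \<and>
     (\<forall>j\<in>index_set \<alpha> - n ` {1..k}. s (n k) \<le> s j)"

end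

theory Submission
  imports Defs
begin

text \<open>Parseval frames in closed subspaces correspond to partial isometries \<open>X\<close> on \<open>\<ell>\<^sup>2\<close> via
  \<open>x\<^sub>i = X e\<^sub>i\<close>, and \<open>\<Sum>\<^sub>i \<parallel>f\<^sub>i - x\<^sub>i\<parallel>\<^sup>2\<close> is the squared Hilbert--Schmidt norm of \<open>F - X\<close>, which may be
  computed in any orthonormal basis. Let \<open>N = (ker F)\<^sup>\<bottom>\<close>, with the basis \<open>g\<^sub>i\<close> of eigenvectors of
  \<open>|F|\<close>, let \<open>U\<close> be the polar part of \<open>F\<close>, and put \<open>w\<^sub>i = 1 - Re \<langle>U g\<^sub>i, X g\<^sub>i\<rangle> \<ge> 0\<close>. A basis of \<open>ker F\<close>
  completes \<open>(g\<^sub>i)\<close> to a basis of \<open>\<ell>\<^sup>2\<close>, and the identity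
  \<open>\<parallel>F g\<^sub>i - X g\<^sub>i\<parallel>\<^sup>2 + \<parallel>(1 - X\<^sup>* X) g\<^sub>i\<parallel>\<^sup>2 = (s\<^sub>i - 1)\<^sup>2 + 2 s\<^sub>i w\<^sub>i\<close> can be summed over it. The index enters
  through \<open>projection_pair_index_identity\<close>: for \<open>P = U\<^sup>* U\<close> and \<open>Q = X\<^sup>* X\<close> the squared
  Hilbert--Schmidt norms of \<open>(1 - Q) P\<close> and \<open>Q (1 - P)\<close> differ exactly by the index \<open>k\<close>. As a result
  (lemma \<open>cost\<close>)

  \<open>\<parallel>F - X\<parallel>\<^sup>2 + k = \<Sum>\<^sub>i (s\<^sub>i - 1)\<^sup>2 + 2 \<Sum>\<^sub>i s\<^sub>i w\<^sub>i\<close>,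

  and only the last sum depends on \<open>X\<close>. The sum of the \<open>(s\<^sub>i - 1)\<^sup>2\<close> is finite because some Parseval
  frame is quadratically close to \<open>f\<close>; so \<open>s\<^sub>i \<rightarrow> 1\<close> if there are infinitely many singular values.

  Since the index is \<open>k\<close>, the space \<open>ker X \<inter> N\<close> has dimension at least \<open>k\<close>. On it, \<open>U - X\<close> and
  \<open>1 - X\<^sup>* X\<close> are isometric, while \<open>2 w\<^sub>i\<close> is the sum of \<open>\<parallel>(U - X) g\<^sub>i\<parallel>\<^sup>2\<close> and \<open>\<parallel>(1 - X\<^sup>* X) g\<^sub>i\<parallel>\<^sup>2\<close>. Hence
  \<open>\<Sum>\<^sub>i w\<^sub>i \<ge> k\<close>, and discarding the indices in a finite set \<open>J\<close> costs at most \<open>card J\<close> dimensions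
  (\<open>mass_bound\<close>). A layer-cake argument (\<open>sum_smallest_le_weighted_sum\<close>) turns these bounds
  into \<open>\<Sum>\<^sub>i s\<^sub>i w\<^sub>i \<ge> \<Sum>\<^sub>i\<^sub>\<in>\<^sub>S s\<^sub>i\<close> whenever \<open>S\<close> consists of \<open>k\<close> smallest singular values; equality holds for
  \<open>X = U (1 - E)\<close>, with \<open>E\<close> the projection onto the span of the \<open>g\<^sub>i\<close>, \<open>i \<in> S\<close>. If there are no \<open>k\<close>
  smallest singular values, the infimum is not attained, as in \<open>minimizer_imp_lowest\<close>.

  In the case of equality all estimates are sharp, and \<open>X = U (1 - E)\<close> with \<open>E\<close> the projection
  onto the \<open>k\<close>-dimensional space \<open>ker X \<inter> N\<close> (\<open>minimal_is_truncation\<close>). Then \<open>w\<^sub>i = \<parallel>E g\<^sub>i\<parallel>\<^sup>2 \<in> [0, 1]\<close>,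
  and minimality forces \<open>w\<^sub>i = 1\<close> below the \<open>k\<close>-th smallest singular value \<open>t\<close> and \<open>w\<^sub>i = 0\<close> above it
  (\<open>optimal_cut_iff\<close>). So \<open>E\<close> is the sum of the projection \<open>E\<^sub>0\<close> onto the eigenspaces below \<open>t\<close> and
  some projection \<open>E\<^sub>1\<close> of the complementary rank inside the eigenspace of \<open>t\<close>
  (\<open>optimal_cut_decomposition\<close>). The latter is unique if it has to fill the whole eigenspace, and
  otherwise its range can be rotated.\<close>


section \<open>Inner product calculus\<close>

lemma cinner_add_right: "cinner x (y + z) = cinner x y + cinner x z"
  by (metis cinner_commute cinner_add_left complex_cnj_add)

lemma cinner_scaleC_right: "cinner x (a *\<^sub>C y) = cnj a * cinner x y"
  by (metis cinner_commute cinner_scaleC_left complex_cnj_mult)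

lemma cinner_scaleR_left: "cinner (r *\<^sub>R x) y = complex_of_real r * cinner x y"
  for x :: "'a::complex_hilbert"
  by (simp add: scaleR_scaleC cinner_scaleC_left)

lemma cinner_scaleR_right: "cinner x (r *\<^sub>R y) = complex_of_real r * cinner x y"
  for x :: "'a::complex_hilbert"
  by (simp add: scaleR_scaleC cinner_scaleC_right)

lemma cinner_zero [simp]: "cinner 0 x = 0" "cinner x 0 = 0"
  using cinner_scaleR_left[of 0 x x] cinner_scaleR_right[of x 0 x] by simp_all

lemma cinner_minus_left: "cinner (- x) y = - cinner x y"
  using cinner_add_left[of x "- x" y] by (simp add: eq_neg_iff_add_eq_0 add.commute)

lemma cinner_minus_right: "cinner x (- y) = - cinner x y"
  using cinner_add_right[of x y "- y"] by (simp add: eq_neg_iff_add_eq_0 add.commute)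

lemma cinner_diff_left: "cinner (x - y) z = cinner x z - cinner y z"
  using cinner_add_left[of x "- y" z] by (simp add: cinner_minus_left)

lemma cinner_diff_right: "cinner x (y - z) = cinner x y - cinner x z"
  using cinner_add_right[of x y "- z"] by (simp add: cinner_minus_right)

lemmas cinner_algebra = cinner_add_left cinner_add_right cinner_diff_left cinner_diff_right
  cinner_minus_left cinner_minus_right cinner_scaleC_left cinner_scaleC_right
  cinner_scaleR_left cinner_scaleR_right

lemma cinner_self: "cinner x x = complex_of_real ((norm x)\<^sup>2)"
proof (rule complex_eqI)
  show "Re (cinner x x) = Re (complex_of_real ((norm x)\<^sup>2))"
    by (simp add: power2_norm_eq_inner inner_eq_Re_cinner)
  have "cinner x x = cnj (cinner x x)" by (rule cinner_commute)
  then have "Im (cinner x x) = - Im (cinner x x)" by (metis cnj.simps(2))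
  then show "Im (cinner x x) = Im (complex_of_real ((norm x)\<^sup>2))" by simp
qed

lemma cinner_self_eq_0 [simp]: "cinner x x = 0 \<longleftrightarrow> x = 0"
  by (simp add: cinner_self)

lemma cinner_zero_commute: "cinner x y = 0 \<longleftrightarrow> cinner y x = 0"
  by (metis cinner_commute complex_cnj_zero)

lemma cmod_cinner_commute: "cmod (cinner x y) = cmod (cinner y x)"
  by (metis cinner_commute complex_mod_cnj)

lemma norm_scaleC: "norm (a *\<^sub>C x) = cmod a * norm x" for x :: "'a::complex_hilbert"
proof -
  have "complex_of_real ((norm (a *\<^sub>C x))\<^sup>2) = complex_of_real ((cmod a * norm x)\<^sup>2)"
    unfolding cinner_self[symmetric] cinner_scaleC_left cinner_scaleC_right
    by (simp add: cinner_self power_mult_distrib complex_norm_square mult.assoc[symmetric] mult.commute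
        del: of_real_power)
  then have "(norm (a *\<^sub>C x))\<^sup>2 = (cmod a * norm x)\<^sup>2" using of_real_eq_iff by blast
  then show ?thesis by simp
qed

lemma cauchy_schwarz: "cmod (cinner x y) \<le> norm x * norm y"
proof (cases "cinner x y = 0")
  case False
  define a where "a = cnj (cinner x y) / cmod (cinner x y)"
  have a1: "cmod a = 1" using False by (simp add: a_def norm_divide)
  have "a * cinner x y = complex_of_real (cmod (cinner x y))"
    using False unfolding a_def times_divide_eq_left
    by (simp add: mult.commute[of "cnj _"] power2_eq_square flip: complex_norm_square)
  then have "cmod (cinner x y) = inner (a *\<^sub>C x) y"
    by (simp add: inner_eq_Re_cinner cinner_scaleC_left)
  also have "\<dots> \<le> norm (a *\<^sub>C x) * norm y" by (rule norm_cauchy_schwarz)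
  finally show ?thesis by (simp add: norm_scaleC a1)
qed simp

lemma norm_add_square:
  "(norm (x + y))\<^sup>2 = (norm x)\<^sup>2 + (norm y)\<^sup>2 + 2 * Re (cinner x y)" for x :: "'a::complex_hilbert"
  by (simp add: power2_norm_eq_inner inner_add_left inner_add_right inner_commute
      flip: inner_eq_Re_cinner)

lemma norm_diff_square:
  "(norm (x - y))\<^sup>2 = (norm x)\<^sup>2 + (norm y)\<^sup>2 - 2 * Re (cinner x y)" for x :: "'a::complex_hilbert"
  by (simp add: power2_norm_eq_inner inner_diff_left inner_diff_right inner_commute
      flip: inner_eq_Re_cinner)

lemma bounded_bilinear_cinner: "bounded_bilinear cinner"
proof
  show "\<exists>K. \<forall>a b. norm (cinner a b) \<le> norm a * norm b * K"
    by (rule exI[of _ 1]) (simp add: cauchy_schwarz)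
qed (simp_all add: cinner_algebra scaleR_conv_of_real)

lemmas tendsto_cinner [tendsto_intros] = bounded_bilinear.tendsto[OF bounded_bilinear_cinner]
lemmas continuous_on_cinner [continuous_intros] =
  bounded_bilinear.continuous_on[OF bounded_bilinear_cinner]
lemmas cinner_sum_left = bounded_bilinear.sum_left[OF bounded_bilinear_cinner]
lemmas cinner_sum_right = bounded_bilinear.sum_right[OF bounded_bilinear_cinner]


section \<open>Closed subspaces and orthogonal decomposition\<close>

lemma csubspace_scaleR: "csubspace M \<Longrightarrow> x \<in> M \<Longrightarrow> r *\<^sub>R x \<in> M"
  by (simp add: scaleR_scaleC complex_vector.subspace_scale)

lemmas csubspaceD = complex_vector.subspace_0 complex_vector.subspace_add
  complex_vector.subspace_diff complex_vector.subspace_scale complex_vector.subspace_neg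
  csubspace_scaleR

lemma csubspace_ortho_compl: "csubspace (ortho_compl S)"
  by (rule complex_vector.subspaceI) (auto simp: ortho_compl_def cinner_algebra)

lemma closed_ortho_compl: "closed (ortho_compl S)"
proof -
  have "ortho_compl S = (\<Inter>y\<in>S. {x. cinner x y = 0})" by (auto simp: ortho_compl_def)
  then show ?thesis
    by (auto intro!: closed_INT closed_Collect_eq continuous_intros)
qed

lemma scaleC_bounded_linear: "bounded_linear (\<lambda>x::'a::complex_hilbert. a *\<^sub>C x)"
  by (rule bounded_linear_intro[where K="cmod a"])
    (simp_all add: scaleC_add_right scaleR_scaleC scaleC_scaleC norm_scaleC mult.commute)

lemma csubspace_closure: "csubspace M \<Longrightarrow> csubspace (closure M)"
  for M :: "'a::complex_hilbert set"
proof (rule complex_vector.subspaceI)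
  assume M: "csubspace M"
  show "0 \<in> closure M" using M closure_subset csubspaceD(1) by blast
  fix x y :: 'a assume x: "x \<in> closure M"
  show "c *\<^sub>C x \<in> closure M" for c
    using x M unfolding closure_sequential
    by (metis (no_types, lifting) bounded_linear.tendsto[OF scaleC_bounded_linear] csubspaceD(4))
  assume y: "y \<in> closure M"
  obtain a b where "\<And>n::nat. a n \<in> M" "a \<longlonglongrightarrow> x" "\<And>n::nat. b n \<in> M" "b \<longlonglongrightarrow> y"
    using x y unfolding closure_sequential by blast
  then show "x + y \<in> closure M"
    unfolding closure_sequential
    by (intro exI[of _ "\<lambda>n. a n + b n"]) (auto intro: csubspaceD(2)[OF M] tendsto_add)
qed

text \<open>Distances to a subspace are almost attained by points that, by the parallelogram law, are
  close to each other. In a closed subspace they converge to a nearest point, and the variation of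
  the distance in any direction of the subspace shows that the difference is orthogonal to it.\<close>

lemma orthogonal_decomposition:
  fixes M :: "'a::complex_hilbert set"
  assumes M: "csubspace M" "closed M"
  obtains p where "p \<in> M" "x - p \<in> ortho_compl M"
proof -
  define d where "d = infdist x M"
  have ne: "M \<noteq> {}" using csubspaceD(1)[OF M(1)] by blast
  have d: "d \<le> norm (x - y)" if "y \<in> M" for y
    using infdist_le[OF that, of x] by (simp add: d_def dist_norm)
  have d0: "d \<ge> 0" by (simp add: d_def infdist_nonneg)
  have "\<exists>y\<in>M. (norm (x - y))\<^sup>2 < d\<^sup>2 + e" if "e > 0" for e
  proof -
    have "sqrt (d\<^sup>2 + e) > d" using d0 that by (intro real_less_rsqrt) auto
    then obtain y where "y \<in> M" "dist x y < sqrt (d\<^sup>2 + e)"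
      using ne infdist_notempty[OF ne, of x] cINF_less_iff[OF ne, of "dist x"]
      by (metis bdd_below_image_dist d_def)
    then have "(dist x y)\<^sup>2 < (sqrt (d\<^sup>2 + e))\<^sup>2" by (intro power_strict_mono) auto
    then show ?thesis using \<open>y \<in> M\<close> that by (auto simp: dist_norm)
  qed
  then have "\<forall>n. \<exists>y\<in>M. (norm (x - y))\<^sup>2 < d\<^sup>2 + inverse (Suc n)" by simp
  then obtain y where y: "\<And>n. y n \<in> M" "\<And>n. (norm (x - y n))\<^sup>2 < d\<^sup>2 + inverse (Suc n)"
    by metis
  have close: "(norm (y m - y n))\<^sup>2 \<le> 2 * inverse (Suc m) + 2 * inverse (Suc n)" for m n
  proof -
    define z where "z = (1/2) *\<^sub>R (y m + y n)"
    have "z \<in> M" unfolding z_def using y(1) by (intro csubspaceD M)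
    then have "d\<^sup>2 \<le> (norm (x - z))\<^sup>2" using d d0 by (intro power_mono) auto
    moreover have "(norm (y m - y n))\<^sup>2 =
        2 * (norm (x - y m))\<^sup>2 + 2 * (norm (x - y n))\<^sup>2 - 4 * (norm (x - z))\<^sup>2"
      unfolding z_def power2_norm_eq_inner
      by (simp add: inner_diff_left inner_diff_right inner_add_left inner_add_right
          inner_commute algebra_simps)
    ultimately show ?thesis using y(2)[of m] y(2)[of n] by linarith
  qed
  have "Cauchy y"
  proof (rule metric_CauchyI)
    fix e :: real assume "e > 0"
    then obtain N where N: "inverse (Suc N) < e\<^sup>2 / 4"
      using reals_Archimedean[of "e\<^sup>2 / 4"] by auto
    have "dist (y m) (y n) < e" if "m \<ge> N" "n \<ge> N" for m n
    proof -
      have "inverse (Suc m) \<le> inverse (real (Suc N))" "inverse (Suc n) \<le> inverse (real (Suc N))"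
        using that by (auto intro!: le_imp_inverse_le)
      then have "(norm (y m - y n))\<^sup>2 < e\<^sup>2" using close[of m n] N by linarith
      then show ?thesis using \<open>e > 0\<close> by (simp add: dist_norm power_less_imp_less_base)
    qed
    then show "\<exists>N. \<forall>m\<ge>N. \<forall>n\<ge>N. dist (y m) (y n) < e" by blast
  qed
  then obtain p where p: "y \<longlonglongrightarrow> p" using Cauchy_convergent convergent_def by blast
  have pM: "p \<in> M" using M(2) y(1) p closed_sequentially by blast
  have "(norm (x - p))\<^sup>2 \<le> d\<^sup>2"
  proof (rule tendsto_le)
    show "(\<lambda>n. (norm (x - y n))\<^sup>2) \<longlonglongrightarrow> (norm (x - p))\<^sup>2" by (intro tendsto_intros p)
    show "(\<lambda>n. d\<^sup>2 + inverse (real (Suc n))) \<longlonglongrightarrow> d\<^sup>2"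
      using tendsto_add[OF tendsto_const LIMSEQ_inverse_real_of_nat, of "d\<^sup>2"] by simp
    show "\<forall>\<^sub>F n in sequentially. (norm (x - y n))\<^sup>2 \<le> d\<^sup>2 + inverse (real (Suc n))"
      using y(2) less_imp_le by (intro always_eventually) blast
  qed simp
  then have min: "(norm (x - p))\<^sup>2 \<le> (norm (x - z))\<^sup>2" if "z \<in> M" for z
    using power_mono[OF d[OF that] d0, of 2] by linarith
  have re: "Re (cinner (x - p) z) = 0" if "z \<in> M" for z
  proof (cases "z = 0")
    case False
    define r where "r = Re (cinner (x - p) z)"
    define t where "t = r / (norm z)\<^sup>2"
    have t: "t * (norm z)\<^sup>2 = r" using False by (simp add: t_def)
    have "(norm (x - p))\<^sup>2 \<le> (norm ((x - p) - t *\<^sub>R z))\<^sup>2"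
      using min[of "p + t *\<^sub>R z"] csubspaceD[OF M(1)] pM that by (simp add: algebra_simps)
    also have "\<dots> = (norm (x - p))\<^sup>2 + t * (t * (norm z)\<^sup>2) - 2 * t * r"
      unfolding norm_diff_square[of "x - p"]
      by (simp add: cinner_scaleR_right r_def power_mult_distrib power2_eq_square)
    finally have "t * r \<le> 0" unfolding t by (simp add: mult.commute)
    moreover have "r\<^sup>2 = t * r * (norm z)\<^sup>2" using t by (metis mult.assoc mult.commute power2_eq_square)
    ultimately have "r\<^sup>2 \<le> 0" by (simp add: mult_le_0_iff)
    then show ?thesis by (simp add: r_def)
  qed simp
  have "cinner (x - p) z = 0" if "z \<in> M" for z
    using re[OF that] re[of "\<i> *\<^sub>C z"] csubspaceD[OF M(1)] that
    by (simp add: cinner_scaleC_right complex_eq_iff)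
  then show ?thesis using that pM by (simp add: ortho_compl_def)
qed


section \<open>Bounded operators and adjoints\<close>

lemma bounded_clinearD:
  assumes "bounded_clinear T"
  shows "T (x + y) = T x + T y" "T (x - y) = T x - T y" "T (a *\<^sub>C x) = a *\<^sub>C T x" "T 0 = 0"
    "T (- x) = - T x" "T (r *\<^sub>R x) = r *\<^sub>R T x" "T (sum h A) = (\<Sum>i\<in>A. T (h i))"
  using assms by (auto simp: bounded_clinear_def linear_simps linear_sum bounded_linear.linear)

lemma bounded_clinear_tendsto:
  "bounded_clinear T \<Longrightarrow> (h \<longlongrightarrow> l) G \<Longrightarrow> ((\<lambda>x. T (h x)) \<longlongrightarrow> T l) G"
  unfolding bounded_clinear_def using bounded_linear.tendsto by blast

lemma bounded_clinear_bound:
  assumes "bounded_clinear T"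
  obtains K where "K > 0" "\<And>x. norm (T x) \<le> K * norm x"
  using bounded_linear.pos_bounded[of T] assms unfolding bounded_clinear_def
  by (metis mult.commute)

lemma bounded_clinearI:
  fixes T :: "'a::complex_hilbert \<Rightarrow> 'b::complex_hilbert"
  assumes "\<And>x y. T (x + y) = T x + T y" "\<And>a x. T (a *\<^sub>C x) = a *\<^sub>C T x"
    "\<And>x. norm (T x) \<le> K * norm x"
  shows "bounded_clinear T"
  unfolding bounded_clinear_def using assms
  by (auto intro!: bounded_linear_intro[where K=K] simp: scaleR_scaleC mult.commute)

lemma bounded_clinear_compose:
  "bounded_clinear S \<Longrightarrow> bounded_clinear T \<Longrightarrow> bounded_clinear (S \<circ> T)"
  by (simp add: bounded_clinear_def bounded_linear_compose o_def)

lemma bounded_clinear_diff: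
  "bounded_clinear S \<Longrightarrow> bounded_clinear T \<Longrightarrow> bounded_clinear (\<lambda>x. S x - T x)"
  by (simp add: bounded_clinear_def bounded_linear_sub complex_vector.scale_right_diff_distrib)

lemma bounded_clinear_add:
  "bounded_clinear S \<Longrightarrow> bounded_clinear T \<Longrightarrow> bounded_clinear (\<lambda>x. S x + T x)"
  by (simp add: bounded_clinear_def bounded_linear_add complex_vector.scale_right_distrib)

lemma bounded_clinear_ident: "bounded_clinear (\<lambda>x. x)"
  by (simp add: bounded_clinear_def bounded_linear_ident)

lemma csubspace_kernel: "bounded_clinear T \<Longrightarrow> csubspace (kernel T)"
  by (rule complex_vector.subspaceI) (auto simp: kernel_def bounded_clinearD)

lemma csubspace_range:
  assumes T: "bounded_clinear T" shows "csubspace (range T)"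
proof (rule complex_vector.subspaceI)
  note lin = bounded_clinearD[OF T, symmetric]
  show "0 \<in> range T" using lin(4) by (rule range_eqI)
  fix x y assume "x \<in> range T"
  then obtain a where x: "x = T a" by blast
  show "c *\<^sub>C x \<in> range T" for c unfolding x lin by (rule rangeI)
  assume "y \<in> range T"
  then obtain b where y: "y = T b" by blast
  show "x + y \<in> range T" unfolding x y lin by (rule rangeI)
qed

lemma closed_kernel: "bounded_clinear T \<Longrightarrow> closed (kernel T)"
  unfolding kernel_def bounded_clinear_def
  by (intro closed_Collect_eq linear_continuous_on continuous_on_const) auto

lemma cinner_right_unique: "(\<And>x. cinner x y = cinner x z) \<Longrightarrow> y = z"
  using cinner_self_eq_0[of "y - z"] by (simp add: cinner_diff_right)

lemma cinner_left_unique: "(\<And>x. cinner y x = cinner z x) \<Longrightarrow> y = z"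
  using cinner_self_eq_0[of "y - z"] by (simp add: cinner_diff_left)

text \<open>The kernel of a nonzero functional is a closed hyperplane, and the representing vector is a
  multiple of any nonzero vector orthogonal to it.\<close>

lemma riesz_representation:
  fixes \<phi> :: "'a::complex_hilbert \<Rightarrow> complex"
  assumes add: "\<And>x y. \<phi> (x + y) = \<phi> x + \<phi> y" and scale: "\<And>a x. \<phi> (a *\<^sub>C x) = a * \<phi> x"
    and bound: "\<And>x. cmod (\<phi> x) \<le> K * norm x"
  obtains y where "\<And>x. \<phi> x = cinner x y"
proof -
  have bl: "bounded_linear \<phi>"
    by (rule bounded_linear_intro[where K=K])
      (use assms in \<open>auto simp: scaleR_scaleC scaleR_conv_of_real mult.commute\<close>)
  define M where "M = {x. \<phi> x = 0}"
  have diff: "\<phi> (x - y) = \<phi> x - \<phi> y" for x y using bl by (simp add: linear_simps)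
  have M: "csubspace M" "closed M"
    using bl by (auto simp: M_def complex_vector.subspace_def add scale linear_simps
        intro!: closed_Collect_eq linear_continuous_on)
  show thesis
  proof (cases "M = UNIV")
    case True
    then show thesis using that[of 0] by (auto simp: M_def)
  next
    case False
    then obtain x0 where x0: "\<phi> x0 \<noteq> 0" by (auto simp: M_def)
    obtain p where p: "p \<in> M" "x0 - p \<in> ortho_compl M"
      using orthogonal_decomposition[OF M] by metis
    define z where "z = x0 - p"
    have z: "\<phi> z \<noteq> 0" "z \<noteq> 0" using x0 p(1) bl by (auto simp: z_def diff M_def linear_simps)
    show thesis
    proof (rule that[of "(cnj (\<phi> z) / complex_of_real ((norm z)\<^sup>2)) *\<^sub>C z"])
      fix x
      have "x - (\<phi> x / \<phi> z) *\<^sub>C z \<in> M" using z by (simp add: M_def diff scale)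
      then have "cinner (x - (\<phi> x / \<phi> z) *\<^sub>C z) z = 0"
        using p(2) by (subst cinner_zero_commute) (auto simp: ortho_compl_def z_def)
      then have "cinner x z = \<phi> x / \<phi> z * complex_of_real ((norm z)\<^sup>2)"
        by (simp add: cinner_algebra cinner_self del: of_real_power)
      then show "\<phi> x = cinner x ((cnj (\<phi> z) / complex_of_real ((norm z)\<^sup>2)) *\<^sub>C z)"
        using z by (simp add: cinner_scaleC_right)
    qed
  qed
qed

lemma adj_exists:
  assumes T: "bounded_clinear T"
  obtains S where "bounded_clinear S" "\<And>x y. cinner (T x) y = cinner x (S y)"
proof -
  obtain K where K: "K > 0" "\<And>x. norm (T x) \<le> K * norm x"
    using bounded_clinear_bound[OF T] by metis
  have "\<exists>z. \<forall>x. cinner (T x) y = cinner x z" for y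
  proof (rule riesz_representation[of "\<lambda>x. cinner (T x) y" "K * norm y"])
    fix x
    have "cmod (cinner (T x) y) \<le> norm (T x) * norm y" by (rule cauchy_schwarz)
    also have "\<dots> \<le> K * norm y * norm x"
      using mult_right_mono[OF K(2)[of x], of "norm y"] by (simp add: mult_ac)
    finally show "cmod (cinner (T x) y) \<le> K * norm y * norm x" .
  qed (auto simp: bounded_clinearD[OF T] cinner_algebra)
  then obtain S where S: "\<And>x y. cinner (T x) y = cinner x (S y)" by metis
  have "bounded_clinear S"
  proof (rule bounded_clinearI)
    show "S (x + y) = S x + S y" for x y
      by (rule cinner_right_unique) (simp add: cinner_add_right flip: S)
    show "S (a *\<^sub>C x) = a *\<^sub>C S x" for a x
      by (rule cinner_right_unique) (simp add: cinner_scaleC_right flip: S)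
    fix y
    have "(norm (S y))\<^sup>2 = cmod (cinner (T (S y)) y)"
      by (simp add: S cinner_self norm_power)
    also have "\<dots> \<le> norm (T (S y)) * norm y" by (rule cauchy_schwarz)
    also have "\<dots> \<le> K * norm (S y) * norm y" by (intro mult_right_mono K) simp
    finally have "norm (S y) * norm (S y) \<le> (K * norm y) * norm (S y)"
      by (simp add: power2_eq_square mult_ac)
    then show "norm (S y) \<le> K * norm y"
      using K(1) by (cases "norm (S y) = 0") (auto simp: mult_le_cancel_right)
  qed
  then show thesis using that S by blast
qed

lemma adj_eqI:
  assumes "bounded_clinear T" "\<And>x y. cinner (T x) y = cinner x (S y)"
  shows "adj T = S"
proof -
  obtain S' where S': "bounded_clinear S'" "\<And>x y. cinner (T x) y = cinner x (S' y)"
    using adj_exists[OF assms(1)] by metis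
  have eq: "S'' = S'" if "\<And>x y. cinner (T x) y = cinner x (S'' y)" for S''
    by (rule ext, rule cinner_right_unique) (simp add: that[symmetric] S'(2)[symmetric])
  show ?thesis unfolding adj_def eq[OF assms(2)]
    by (rule the_equality) (use S' eq in blast)+
qed

lemma bounded_clinear_adj: "bounded_clinear T \<Longrightarrow> bounded_clinear (adj T)"
  by (metis adj_exists adj_eqI)

lemma cinner_adj_right: "bounded_clinear T \<Longrightarrow> cinner x (adj T y) = cinner (T x) y"
  by (metis adj_exists adj_eqI)

lemma cinner_adj_left: "bounded_clinear T \<Longrightarrow> cinner (adj T x) y = cinner x (T y)"
  by (metis cinner_adj_right cinner_commute)

lemma adj_adj: "bounded_clinear T \<Longrightarrow> adj (adj T) = T"
  by (intro adj_eqI bounded_clinear_adj) (simp_all add: cinner_adj_left)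

lemma adj_compose:
  "bounded_clinear S \<Longrightarrow> bounded_clinear T \<Longrightarrow> adj (S \<circ> T) = adj T \<circ> adj S"
  by (intro adj_eqI bounded_clinear_compose) (simp_all add: cinner_adj_right)

lemma adj_diff:
  "bounded_clinear S \<Longrightarrow> bounded_clinear T \<Longrightarrow> adj (\<lambda>x. S x - T x) = (\<lambda>x. adj S x - adj T x)"
  by (intro adj_eqI bounded_clinear_diff) (simp_all add: cinner_algebra cinner_adj_right)

lemma cinner_adj_self: "bounded_clinear T \<Longrightarrow> cinner (adj T (T x)) x = complex_of_real ((norm (T x))\<^sup>2)"
  by (simp add: cinner_adj_left cinner_self)

text \<open>Over the complex numbers polarization recovers a sesquilinear form from its quadratic form.\<close>

lemma clinear_eq_0_if_quadratic_form_0: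
  assumes T: "bounded_clinear T" and 0: "\<And>x. cinner (T x) x = 0"
  shows "T x = 0"
proof -
  have sum: "cinner (T x) y + cinner (T y) x = 0" for x y
    using 0[of "x + y"] by (simp add: bounded_clinearD[OF T] cinner_algebra 0 add.commute)
  have "cinner (T x) y = 0" for y
    using sum[of x y] sum[of x "\<i> *\<^sub>C y"]
    by (simp add: bounded_clinearD[OF T] cinner_algebra add_eq_0_iff)
  then show ?thesis using cinner_self_eq_0 by blast
qed

lemma clinear_eqI_quadratic_form:
  assumes "bounded_clinear S" "bounded_clinear T" "\<And>x. cinner (S x) x = cinner (T x) x"
  shows "S = T"
  using clinear_eq_0_if_quadratic_form_0[OF bounded_clinear_diff[OF assms(1,2)]] assms(3)
  by (auto simp: cinner_diff_left)


section \<open>Orthogonal projections\<close>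

lemma orth_projectionD:
  assumes "orth_projection E"
  shows "bounded_clinear E" "E (E x) = E x" "cinner (E x) y = cinner x (E y)"
    "cinner (E x) x = complex_of_real ((norm (E x))\<^sup>2)"
    "(norm (x - E x))\<^sup>2 = (norm x)\<^sup>2 - (norm (E x))\<^sup>2" "norm (E x) \<le> norm x"
    "adj E = E" "E (x - E x) = 0"
proof -
  show E: "bounded_clinear E" using assms by (simp add: orth_projection_def)
  show EE: "E (E x) = E x" for x using assms by (auto simp: orth_projection_def fun_eq_iff)
  show sym: "cinner (E x) y = cinner x (E y)" for x y
    using assms by (auto simp: orth_projection_def)
  show q: "cinner (E x) x = complex_of_real ((norm (E x))\<^sup>2)" for x
    by (metis EE sym cinner_self)
  show n: "(norm (x - E x))\<^sup>2 = (norm x)\<^sup>2 - (norm (E x))\<^sup>2"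
    using q[of x] by (simp add: norm_diff_square flip: sym)
  show "norm (E x) \<le> norm x"
    using n by (metis diff_ge_0_iff_ge norm_ge_zero power2_le_imp_le zero_le_power2)
  show "adj E = E" using E sym by (rule adj_eqI)
  show "E (x - E x) = 0" by (simp add: bounded_clinearD[OF E] EE)
qed

lemma range_orth_projection:
  assumes "orth_projection E" shows "range E = {x. E x = x}"
proof (intro equalityI subsetI)
  fix x assume "x \<in> {x. E x = x}"
  then have "x = E x" by simp
  then show "x \<in> range E" by (rule range_eqI)
qed (auto simp: orth_projectionD(2)[OF assms])

lemma orth_projection_complement:
  assumes "orth_projection E" shows "orth_projection (\<lambda>x. x - E x)"
  unfolding orth_projection_def
  using orth_projectionD(1,3,8)[OF assms]
  by (auto simp: bounded_clinear_diff bounded_clinear_ident cinner_diff_left cinner_diff_right)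

lemma kernel_complement: "kernel (\<lambda>x. x - E x) = {x. E x = x}"
  for E :: "'a::complex_hilbert \<Rightarrow> 'a"
  by (auto simp: kernel_def)

lemma range_orth_projection_kernel: "orth_projection E \<Longrightarrow> range E = kernel (\<lambda>x. x - E x)"
  by (simp add: kernel_complement range_orth_projection)

lemma kernel_orth_projection:
  assumes "orth_projection E" shows "kernel E = range (\<lambda>x. x - E x)"
  using range_orth_projection_kernel[OF orth_projection_complement[OF assms]] by simp

lemma csubspace_range_projection: "orth_projection E \<Longrightarrow> csubspace (range E)"
  by (simp add: csubspace_range orth_projectionD)

lemma closed_range_projection:
  assumes "orth_projection E" shows "closed (range E)"
  unfolding range_orth_projection_kernel[OF assms]
  by (intro closed_kernel orth_projectionD(1) orth_projection_complement assms)

lemma ortho_compl_kernel_projection: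
  assumes "orth_projection E" shows "ortho_compl (kernel E) = range E"
proof (intro equalityI subsetI)
  fix x assume "x \<in> ortho_compl (kernel E)"
  then have "cinner x (x - E x) = 0"
    using orth_projectionD(8)[OF assms] by (auto simp: ortho_compl_def kernel_def)
  then have "cinner (x - E x) (x - E x) = 0"
    by (simp add: cinner_diff_left[of x] orth_projectionD(3,8)[OF assms])
  then have "x = E x" unfolding cinner_self_eq_0 by simp
  then show "x \<in> range E" by (rule range_eqI)
qed (auto simp: ortho_compl_def kernel_def orth_projectionD[OF assms])

lemma orth_projection_eqI:
  assumes E: "orth_projection E" and E': "orth_projection E'" and r: "range E = range E'"
  shows "E = E'"
proof
  fix x
  have "E' x \<in> {y. E y = y}"
    unfolding range_orth_projection[OF E, symmetric] r by (rule rangeI)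
  then have 1: "E (E' x) = E' x" by simp
  have 2: "E' (E y) = E y" for y
    using rangeI[of E y] unfolding r range_orth_projection[OF E'] by simp
  have "cinner (E x) y = cinner (E' x) y" for y
  proof -
    have "cinner (E x) y = cinner x (E' (E y))" by (simp only: 2 orth_projectionD(3)[OF E])
    also have "\<dots> = cinner (E (E' x)) y"
      by (simp only: orth_projectionD(3)[OF E] orth_projectionD(3)[OF E'])
    finally show ?thesis by (simp only: 1)
  qed
  then show "E x = E' x" by (rule cinner_left_unique)
qed

lemma projection_onto:
  assumes M: "csubspace M" "closed M"
  shows "orth_projection (projection_onto M)" "range (projection_onto M) = M"
proof -
  have "\<exists>p. p \<in> M \<and> x - p \<in> ortho_compl M" for x
    using orthogonal_decomposition[OF M] by metis
  then obtain E where E: "\<And>x. E x \<in> M" "\<And>x. x - E x \<in> ortho_compl M" by metis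
  have uniq: "E x = p" if "p \<in> M" "x - p \<in> ortho_compl M" for x p
  proof -
    have "(x - p) - (x - E x) \<in> ortho_compl M"
      using csubspaceD(3)[OF csubspace_ortho_compl that(2) E(2)] .
    moreover have "E x - p \<in> M" using csubspaceD(3)[OF M(1) E(1) that(1)] .
    ultimately have "cinner (E x - p) (E x - p) = 0" by (simp add: ortho_compl_def)
    then show ?thesis by simp
  qed
  have orth: "cinner (x - E x) (E y) = 0" for x y using E by (auto simp: ortho_compl_def)
  have sym: "cinner (E x) y = cinner x (E y)" for x y
    using orth[of x y] orth[of y x] by (simp add: cinner_diff_left)
      (metis cinner_commute)
  have "bounded_clinear E"
  proof (rule bounded_clinearI)
    show "E (x + y) = E x + E y" for x y
      using csubspaceD(2)[OF csubspace_ortho_compl E(2)[of x] E(2)[of y]]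
      by (intro uniq csubspaceD(2)[OF M(1)] E) (simp add: algebra_simps)
    show "E (a *\<^sub>C x) = a *\<^sub>C E x" for a x
      using csubspaceD(4)[OF csubspace_ortho_compl E(2)[of x], of a]
      by (intro uniq csubspaceD(4)[OF M(1)] E)
        (simp add: complex_vector.scale_right_diff_distrib)
    fix x
    have "(norm x)\<^sup>2 = (norm (x - E x))\<^sup>2 + (norm (E x))\<^sup>2"
      using norm_add_square[of "x - E x" "E x"] orth[of x x] by simp
    then show "norm (E x) \<le> 1 * norm x" by (simp add: power2_le_imp_le)
  qed
  moreover have EE: "E x = x" if "x \<in> M" for x
    by (rule uniq) (use that csubspaceD(1)[OF csubspace_ortho_compl] in auto)
  ultimately have "orth_projection E"
    using sym E(1) by (auto simp: orth_projection_def fun_eq_iff)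
  moreover have "range E = M"
  proof (intro equalityI subsetI)
    fix x assume "x \<in> M"
    then show "x \<in> range E" by (intro range_eqI[of _ _ x] EE[symmetric])
  qed (use E(1) in auto)
  ultimately have *: "orth_projection E \<and> range E = M" by blast
  have "orth_projection (projection_onto M) \<and> range (projection_onto M) = M"
    unfolding projection_onto_def
    by (rule theI[of _ E]) (use * orth_projection_eqI in \<open>blast+\<close>)
  then show "orth_projection (projection_onto M)" "range (projection_onto M) = M" by auto
qed

lemma projection_onto_eqI: "orth_projection E \<Longrightarrow> range E = M \<Longrightarrow> projection_onto M = E"
  unfolding projection_onto_def using orth_projection_eqI by (intro the_equality) auto

lemma kernel_projection_onto:
  assumes "csubspace M" "closed M" shows "kernel (projection_onto M) = ortho_compl M"
proof -
  note E = projection_onto[OF assms]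
  have "x \<in> ortho_compl M \<longleftrightarrow> (\<forall>y. cinner x (projection_onto M y) = 0)" for x
    by (subst E(2)[symmetric]) (auto simp: ortho_compl_def)
  then have "x \<in> ortho_compl M \<longleftrightarrow> projection_onto M x = 0" for x
    using cinner_left_unique[of "projection_onto M x" 0]
    by (auto simp flip: orth_projectionD(3)[OF E(1)])
  then show ?thesis by (auto simp: kernel_def)
qed

lemma double_ortho_compl:
  assumes "csubspace M" "closed M" shows "ortho_compl (ortho_compl M) = M"
  using ortho_compl_kernel_projection[OF projection_onto(1)[OF assms]]
  by (simp add: kernel_projection_onto assms projection_onto)


section \<open>Square roots and polar decomposition\<close>

text \<open>The fixed point iteration for \<open>Y = (B + Y\<^sup>2) / 2\<close>, that is, for \<open>(1 - Y)\<^sup>2 = 1 - B\<close>. Its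
  increments are dominated in norm by those of the scalar iteration \<open>r \<mapsto> (1 + r\<^sup>2) / 2\<close>, which is
  increasing and bounded by \<open>1\<close>.\<close>

lemma sqrt_iteration:
  fixes B :: "'a::banach \<Rightarrow>\<^sub>L 'a"
  assumes B: "norm B \<le> 1"
  obtains Z Y where "Z 0 = 0" "\<And>n. Z (Suc n) = (1/2) *\<^sub>R (B + (Z n o\<^sub>L Z n))"
    "Z \<longlonglongrightarrow> Y" "norm Y \<le> 1" "Y = (1/2) *\<^sub>R (B + (Y o\<^sub>L Y))"
proof -
  define Z where "Z = rec_nat 0 (\<lambda>n z. (1/2) *\<^sub>R (B + (z o\<^sub>L z)))"
  define r where "r = rec_nat 0 (\<lambda>n r. (1 + r * r) / 2 :: real)"
  have Z: "Z 0 = 0" "\<And>n. Z (Suc n) = (1/2) *\<^sub>R (B + (Z n o\<^sub>L Z n))"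
    by (simp_all add: Z_def)
  have r: "r 0 = 0" "\<And>n. r (Suc n) = (1 + r n * r n) / 2" by (simp_all add: r_def)
  have r01: "0 \<le> r n \<and> r n \<le> 1" for n
    by (induction n) (auto simp: r mult_le_one)
  have Zr: "norm (Z n) \<le> r n" for n
  proof (induction n)
    case (Suc n)
    have "norm (Z n o\<^sub>L Z n) \<le> r n * r n"
      by (rule order_trans[OF norm_blinfun_compose mult_mono[OF Suc Suc]]) (use r01 in auto)
    then have "norm (B + (Z n o\<^sub>L Z n)) \<le> 1 + r n * r n"
      by (intro order_trans[OF norm_triangle_ineq] add_mono B)
    then show ?case by (simp add: Z r)
  qed (simp add: Z r)
  have step: "norm (Z (Suc n) - Z n) \<le> r (Suc n) - r n" for n
  proof (induction n)
    case 0
    then show ?case using B by (simp add: Z r)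
  next
    case (Suc n)
    have inc: "r n \<le> r (Suc n)" using Suc norm_ge_zero[of "Z (Suc n) - Z n"] by linarith
    have "Z (Suc (Suc n)) - Z (Suc n) = (1/2) *\<^sub>R
       ((Z (Suc n) o\<^sub>L (Z (Suc n) - Z n)) + ((Z (Suc n) - Z n) o\<^sub>L Z n))"
      unfolding Z(2)[of "Suc n"] unfolding Z(2)[of n, symmetric]
      by (subst (2) Z(2)) (simp add: algebra_simps
          bounded_bilinear.diff_left[OF bounded_bilinear_blinfun_compose]
          bounded_bilinear.diff_right[OF bounded_bilinear_blinfun_compose])
    also have "norm \<dots> \<le> (1/2) *
       (r (Suc n) * (r (Suc n) - r n) + (r (Suc n) - r n) * r n)"
      unfolding norm_scaleR
      by (intro mult_mono order_trans[OF norm_triangle_ineq] add_mono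
          order_trans[OF norm_blinfun_compose] Zr Suc)
        (use r01 inc in \<open>auto intro!: add_nonneg_nonneg mult_nonneg_nonneg\<close>)
    also have "\<dots> = r (Suc (Suc n)) - r (Suc n)"
      by (subst (5) r(2), subst r(2)[of "Suc n"]) (simp add: algebra_simps)
    finally show ?case .
  qed
  have "r n \<le> r (Suc n)" for n using step[of n] norm_ge_zero[of "Z (Suc n) - Z n"] by linarith
  then have "incseq r" by (intro incseq_SucI)
  then have "convergent r" using r01 by (intro Bseq_monoseq_convergent BseqI'[of _ 1])
      (auto simp: incseq_imp_monoseq)
  then have "summable (\<lambda>n. r (Suc n) - r n)" using telescope_summable convergent_def by blast
  then have "summable (\<lambda>n. Z (Suc n) - Z n)"
    by (rule summable_comparison_test'[OF _ step])
  then have "convergent (\<lambda>n. \<Sum>i<n. Z (Suc i) - Z i)" by (simp add: summable_iff_convergent)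
  then obtain Y where Y: "Z \<longlonglongrightarrow> Y"
    by (auto simp: sum_lessThan_telescope Z(1) convergent_def)
  have "norm Y \<le> 1"
    using Zr r01 by (intro LIMSEQ_le_const2[OF tendsto_norm[OF Y]]) (meson order_trans)
  moreover have "Y = (1/2) *\<^sub>R (B + (Y o\<^sub>L Y))"
  proof (rule LIMSEQ_unique)
    show "(\<lambda>n. Z (Suc n)) \<longlonglongrightarrow> Y" using Y by (simp add: LIMSEQ_Suc)
    show "(\<lambda>n. Z (Suc n)) \<longlonglongrightarrow> (1/2) *\<^sub>R (B + (Y o\<^sub>L Y))"
      unfolding Z by (intro tendsto_intros Y
          bounded_bilinear.tendsto[OF bounded_bilinear_blinfun_compose])
  qed
  ultimately show thesis using that Z Y by blast
qed

lemma positive_op_symmetric: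
  assumes "positive_op T" shows "cinner (T x) y = cinner x (T y)"
proof -
  have T: "bounded_clinear T" and real: "cinner (T x) x \<in> \<real>" for x
    using assms by (auto simp: positive_op_def)
  have "cinner (adj T x) x = cinner (T x) x" for x
    using real[of x] cinner_commute[of x "T x"]
    by (simp add: cinner_adj_left[OF T] Reals_cnj_iff)
  then have "adj T = T" by (intro clinear_eqI_quadratic_form bounded_clinear_adj T)
  then show ?thesis by (metis T cinner_adj_left)
qed

text \<open>The quadratic form at \<open>x + t T x\<close> is a nonnegative quadratic polynomial in \<open>t\<close> without constant
  term, so its linear coefficient \<open>2 \<parallel>T x\<parallel>\<^sup>2\<close> vanishes.\<close>

lemma positive_op_eq_0:
  assumes T: "positive_op T" and 0: "Re (cinner (T x) x) = 0" shows "T x = 0"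
proof -
  have lin: "bounded_clinear T" using T by (simp add: positive_op_def)
  define c where "c = Re (cinner (T (T x)) (T x))"
  define q where "q = (norm (T x))\<^sup>2"
  have pos: "0 \<le> c" using T by (simp add: positive_op_def c_def)
  have quad: "0 \<le> 2 * t * q + t\<^sup>2 * c" for t
  proof -
    have "0 \<le> Re (cinner (T (x + t *\<^sub>R T x)) (x + t *\<^sub>R T x))"
      using T by (simp add: positive_op_def)
    also have "\<dots> = 2 * t * q + t\<^sup>2 * c"
      by (simp add: bounded_clinearD[OF lin] cinner_algebra 0 positive_op_symmetric[OF T, of "T x" x]
          cinner_self q_def c_def power2_eq_square distrib_left)
    finally show ?thesis .
  qed
  have "q = 0"
  proof (cases "c = 0")
    case True
    then show ?thesis using quad[of "-1"] by (simp add: q_def)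
  next
    case False
    have "0 \<le> - (q\<^sup>2 / c)" using quad[of "- q / c"] False by (simp add: power2_eq_square field_simps)
    then show ?thesis using pos False by (simp add: divide_le_0_iff)
  qed
  then show ?thesis by (simp add: q_def)
qed

text \<open>The iteration is applied to \<open>B = 1 - T\<^sup>* T / c\<^sup>2\<close>, a contraction for large \<open>c\<close>, and the root is
  \<open>c (1 - Y)\<close>. All iterates are polynomials in \<open>T\<^sup>* T\<close>, so complex linearity, symmetry and commutation
  properties pass to the limit; the last one serves to prove the uniqueness of the root.\<close>

lemma positive_sqrt_exists:
  fixes T :: "'a::complex_hilbert \<Rightarrow> 'b::complex_hilbert"
  assumes T: "bounded_clinear T"
  obtains S where "positive_op S" "S \<circ> S = adj T \<circ> T"
    "\<And>R. bounded_clinear R \<Longrightarrow> R \<circ> (adj T \<circ> T) = (adj T \<circ> T) \<circ> R \<Longrightarrow> R \<circ> S = S \<circ> R"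
proof -
  obtain c where c: "c > 0" "\<And>x. norm (T x) \<le> c * norm x"
    using bounded_clinear_bound[OF T] by metis
  define A where "A = adj T \<circ> T"
  have A: "bounded_clinear A"
    unfolding A_def by (intro bounded_clinear_compose bounded_clinear_adj T)
  have A_sym: "cinner (A x) y = cinner x (A y)" for x y
    by (simp add: A_def cinner_adj_left[OF T] cinner_adj_right[OF T])
  define b where "b x = x - (1 / c\<^sup>2) *\<^sub>R A x" for x
  have b_norm: "norm (b x) \<le> 1 * norm x" for x
  proof -
    have "(norm (A x))\<^sup>2 = cmod (cinner (T (A x)) (T x))"
      unfolding cinner_adj_right[OF T, symmetric] A_def by (simp add: cinner_self norm_power)
    also have "\<dots> \<le> c * norm (A x) * norm (T x)"
      by (intro order_trans[OF cauchy_schwarz] mult_right_mono c) simp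
    finally have "norm (A x) \<le> c * norm (T x)"
      using c(1) by (cases "norm (A x) = 0")
        (auto simp: power2_eq_square mult_ac mult_le_cancel_left)
    then have "(norm (A x))\<^sup>2 \<le> (c * norm (T x))\<^sup>2" by (intro power_mono) auto
    then have "(norm (A x))\<^sup>2 / (c\<^sup>2 * c\<^sup>2) \<le> (norm (T x))\<^sup>2 / c\<^sup>2"
      using c(1) by (simp add: field_simps power2_eq_square)
    moreover have "(norm (b x))\<^sup>2
        = (norm x)\<^sup>2 + (norm (A x))\<^sup>2 / (c\<^sup>2 * c\<^sup>2) - 2 * ((norm (T x))\<^sup>2 / c\<^sup>2)"
      unfolding b_def norm_diff_square
      by (simp add: cinner_scaleR_right A_def cinner_adj_right[OF T] cinner_self power2_eq_square)
    moreover have "0 \<le> (norm (T x))\<^sup>2 / c\<^sup>2" by simp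
    ultimately have "(norm (b x))\<^sup>2 \<le> (norm x)\<^sup>2" by linarith
    from power2_le_imp_le[OF this norm_ge_zero] show ?thesis by simp
  qed
  have b: "bounded_clinear b"
    by (rule bounded_clinearI[OF _ _ b_norm])
      (simp_all add: b_def bounded_clinearD[OF A] algebra_simps
        complex_vector.scale_right_diff_distrib scaleR_scaleC scaleC_scaleC mult.commute)
  have b_sym: "cinner (b x) y = cinner x (b y)" for x y
    by (simp add: b_def cinner_algebra A_sym)
  define B where "B = Blinfun b"
  have B: "blinfun_apply B = b"
    using b by (simp add: B_def bounded_clinear_def bounded_linear_Blinfun_apply)
  have "norm B \<le> 1" by (rule norm_blinfun_bound) (use b_norm in \<open>auto simp: B\<close>)
  then obtain Z Y where Z: "Z 0 = 0" "\<And>n. Z (Suc n) = (1/2) *\<^sub>R (B + (Z n o\<^sub>L Z n))"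
    and lim: "Z \<longlonglongrightarrow> Y" and Y: "norm Y \<le> 1" "Y = (1/2) *\<^sub>R (B + (Y o\<^sub>L Y))"
    using sqrt_iteration by metis
  have lim': "(\<lambda>n. Z n x) \<longlonglongrightarrow> Y x" for x by (intro blinfun.tendsto lim tendsto_const)
  have Zapp: "Z (Suc n) x = (1/2) *\<^sub>R (b x + Z n (Z n x))" for n x
    by (simp add: Z blinfun.add_left blinfun.scaleR_left B)
  have Yapp: "Y (Y x) = 2 *\<^sub>R Y x - b x" for x
    using arg_cong[OF Y(2), of "\<lambda>f. 2 *\<^sub>R f x"]
    by (simp add: blinfun.add_left blinfun.scaleR_left B algebra_simps)
  have Z_scale: "Z n (a *\<^sub>C x) = a *\<^sub>C Z n x" for n a x
    by (induction n arbitrary: x)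
      (simp_all add: Z(1) Zapp bounded_clinearD[OF b] scaleR_scaleC scaleC_scaleC scaleC_add_right
        mult.commute)
  have Y_scale: "Y (a *\<^sub>C x) = a *\<^sub>C Y x" for a x
    by (rule LIMSEQ_unique[OF lim']) (unfold Z_scale,
        intro bounded_linear.tendsto[OF scaleC_bounded_linear] lim')
  have Z_sym: "cinner (Z n x) y = cinner x (Z n y)" for n x y
    by (induction n arbitrary: x y) (simp_all add: Z(1) Zapp cinner_algebra b_sym)
  have Y_sym: "cinner (Y x) y = cinner x (Y y)" for x y
    by (rule LIMSEQ_unique[OF tendsto_cinner[OF lim' tendsto_const]])
      (unfold Z_sym, intro tendsto_intros lim')
  define S where "S x = c *\<^sub>R (x - Y x)" for x
  have S: "bounded_clinear S"
  proof (rule bounded_clinearI)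
    show "norm (S x) \<le> (c * 2) * norm x" for x
    proof -
      have "norm (Y x) \<le> norm x"
        using norm_blinfun[of Y x] mult_right_mono[OF Y(1), of "norm x"] by simp
      then have "norm (x - Y x) \<le> 2 * norm x" using norm_triangle_ineq4[of x "Y x"] by linarith
      then show ?thesis using c(1) by (simp add: S_def)
    qed
  qed (simp_all add: S_def blinfun.add_right Y_scale algebra_simps scaleR_scaleC scaleC_scaleC
      complex_vector.scale_right_diff_distrib mult.commute)
  have S_sym: "cinner (S x) y = cinner x (S y)" for x y
    by (simp add: S_def cinner_algebra Y_sym)
  have "positive_op S"
    unfolding positive_op_def
  proof (intro conjI allI S)
    fix x
    show "cinner (S x) x \<in> \<real>"
      using S_sym[of x x] cinner_commute[of x "S x"] by (simp add: Reals_cnj_iff)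
    have "Re (cinner (Y x) x) \<le> norm (Y x) * norm x"
      using cauchy_schwarz[of "Y x" x] complex_Re_le_cmod order_trans by blast
    also have "\<dots> \<le> 1 * norm x * norm x"
      by (intro mult_right_mono order_trans[OF norm_blinfun] Y) auto
    finally show "0 \<le> Re (cinner (S x) x)"
      using c(1) by (simp add: S_def cinner_algebra cinner_self power2_eq_square)
  qed
  moreover have "S \<circ> S = A"
  proof
    fix x
    have "(S \<circ> S) x = (c * c) *\<^sub>R (x - Y x - (Y x - Y (Y x)))"
      by (simp add: S_def blinfun.scaleR_right blinfun.diff_right scaleR_diff_right)
    also have "x - Y x - (Y x - Y (Y x)) = x - b x" by (simp add: Yapp scaleR_2)
    finally show "(S \<circ> S) x = A x" using c(1) by (simp add: b_def power2_eq_square)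
  qed
  moreover have "R \<circ> S = S \<circ> R" if R: "bounded_clinear R" and comm: "R \<circ> A = A \<circ> R" for R
  proof -
    have "R (b x) = b (R x)" for x
      using fun_cong[OF comm, of x] by (simp add: b_def bounded_clinearD[OF R])
    then have "R (Z n x) = Z n (R x)" for n x
      by (induction n arbitrary: x) (simp_all add: Z(1) Zapp bounded_clinearD[OF R])
    then have "R (Y x) = Y (R x)" for x
      using LIMSEQ_unique[OF bounded_clinear_tendsto[OF R lim'[of x]]] lim'[of "R x"] by simp
    then show ?thesis by (simp add: fun_eq_iff S_def bounded_clinearD[OF R])
  qed
  ultimately show thesis using that unfolding A_def by blast
qed

text \<open>The root constructed above commutes with every other root \<open>R\<close>. Their difference \<open>D\<close>
  therefore satisfies \<open>(S + R) D = 0\<close>, and positivity forces \<open>S D = R D = 0\<close>.\<close>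

lemma abs_op:
  fixes T :: "'a::complex_hilbert \<Rightarrow> 'b::complex_hilbert"
  assumes T: "bounded_clinear T"
  shows "positive_op (abs_op T)" "abs_op T \<circ> abs_op T = adj T \<circ> T"
proof -
  obtain S where S: "positive_op S" "S \<circ> S = adj T \<circ> T"
    "\<And>R. bounded_clinear R \<Longrightarrow> R \<circ> (adj T \<circ> T) = (adj T \<circ> T) \<circ> R \<Longrightarrow> R \<circ> S = S \<circ> R"
    using positive_sqrt_exists[OF T] by metis
  have uniq: "R = S" if R: "positive_op R" "R \<circ> R = adj T \<circ> T" for R
  proof
    fix x
    have linR: "bounded_clinear R" and linS: "bounded_clinear S"
      using R S by (auto simp: positive_op_def)
    have comm: "R (S x) = S (R x)" for x
      using fun_cong[OF S(3)[OF linR]] R(2)[symmetric] by (simp add: o_assoc)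
    have sq: "R (R x) = S (S x)" for x using R(2) S(2) by (metis comp_apply)
    define D where "D = (\<lambda>x. S x - R x)"
    have linD: "bounded_clinear D" unfolding D_def by (intro bounded_clinear_diff linS linR)
    have symD: "cinner (D x) y = cinner x (D y)" for x y
      by (simp add: D_def cinner_algebra positive_op_symmetric R S)
    have "S (D (D x)) + R (D (D x)) = 0"
      by (simp add: D_def bounded_clinearD[OF linS] bounded_clinearD[OF linR] comm sq)
    have "S (D y) + R (D y) = 0" for y
      by (simp add: D_def bounded_clinearD[OF linS] bounded_clinearD[OF linR] comm sq)
    then have "Re (cinner (S (D x)) (D x)) + Re (cinner (R (D x)) (D x)) = 0"
      by (metis cinner_add_left cinner_zero(1) plus_complex.sel(1) zero_complex.sel(1))
    moreover have "0 \<le> Re (cinner (S (D x)) (D x))" "0 \<le> Re (cinner (R (D x)) (D x))"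
      using R S by (auto simp: positive_op_def)
    ultimately have "S (D x) = 0" "R (D x) = 0"
      by (auto intro!: positive_op_eq_0[OF R(1)] positive_op_eq_0[OF S(1)])
    then have "D (D x) = 0" by (simp add: D_def)
    then have "cinner (D x) (D x) = 0" by (simp add: symD)
    then show "R x = S x" by (simp add: D_def)
  qed
  have "\<exists>!R. positive_op R \<and> R \<circ> R = adj T \<circ> T"
  proof (rule ex1I[of _ S])
    show "positive_op S \<and> S \<circ> S = adj T \<circ> T" by (intro conjI S(1,2))
    show "R = S" if "positive_op R \<and> R \<circ> R = adj T \<circ> T" for R
      using that by (elim conjE) (rule uniq)
  qed
  from theI'[OF this] have "positive_op (abs_op T) \<and> abs_op T \<circ> abs_op T = adj T \<circ> T"
    unfolding abs_op_def .
  then show "positive_op (abs_op T)" "abs_op T \<circ> abs_op T = adj T \<circ> T" by auto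
qed

lemma abs_op_facts:
  assumes T: "bounded_clinear T"
  shows "bounded_clinear (abs_op T)" "cinner (abs_op T x) y = cinner x (abs_op T y)"
    "abs_op T (abs_op T x) = adj T (T x)" "norm (abs_op T x) = norm (T x)"
    "kernel (abs_op T) = kernel T" "adj (abs_op T) = abs_op T"
proof -
  note A = abs_op[OF T]
  show lin: "bounded_clinear (abs_op T)" using A by (simp add: positive_op_def)
  show sym: "cinner (abs_op T x) y = cinner x (abs_op T y)" for x y
    by (rule positive_op_symmetric[OF A(1)])
  show sq: "abs_op T (abs_op T x) = adj T (T x)" for x using A(2) by (metis comp_apply)
  have "complex_of_real ((norm (abs_op T x))\<^sup>2) = complex_of_real ((norm (T x))\<^sup>2)" for x
    unfolding cinner_self[symmetric] sym sq cinner_adj_right[OF T] ..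
  then have "(norm (abs_op T x))\<^sup>2 = (norm (T x))\<^sup>2" for x using of_real_eq_iff by blast
  then show n: "norm (abs_op T x) = norm (T x)" for x by simp
  show "kernel (abs_op T) = kernel T"
    using n by (auto simp: kernel_def) (metis norm_eq_zero)+
  show "adj (abs_op T) = abs_op T" using lin sym by (rule adj_eqI)
qed


text \<open>A vector orthogonal to the range of the symmetric operator \<open>|T|\<close> lies in its kernel.\<close>

lemma closure_range_abs_op:
  assumes T: "bounded_clinear T"
  shows "closure (range (abs_op T)) = ortho_compl (kernel T)"
proof
  note A = abs_op_facts[OF T]
  have "range (abs_op T) \<subseteq> ortho_compl (kernel T)"
    unfolding A(5)[symmetric] by (auto simp: ortho_compl_def kernel_def A(2))
  then show "closure (range (abs_op T)) \<subseteq> ortho_compl (kernel T)"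
    by (rule closure_minimal[OF _ closed_ortho_compl])
  have M: "csubspace (closure (range (abs_op T)))" "closed (closure (range (abs_op T)))"
    by (intro csubspace_closure csubspace_range A) simp
  show "ortho_compl (kernel T) \<subseteq> closure (range (abs_op T))"
  proof
    fix x assume x: "x \<in> ortho_compl (kernel T)"
    have "y \<in> kernel T" if y: "y \<in> ortho_compl (closure (range (abs_op T)))" for y
    proof -
      have "abs_op T z \<in> closure (range (abs_op T))" for z
        by (rule subsetD[OF closure_subset rangeI])
      then have "cinner (abs_op T y) z = cinner 0 z" for z
        using y by (simp add: A(2) ortho_compl_def)
      then have "abs_op T y = 0" by (rule cinner_left_unique)
      then show ?thesis using A(5) by (auto simp: kernel_def)
    qed
    then have "x \<in> ortho_compl (ortho_compl (closure (range (abs_op T))))"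
      using x by (auto simp: ortho_compl_def)
    then show "x \<in> closure (range (abs_op T))" by (simp add: double_ortho_compl M)
  qed
qed

lemma kernel_decomposition:
  assumes T: "bounded_clinear T"
  defines "E \<equiv> projection_onto (ortho_compl (kernel T))"
  shows "orth_projection E" "range E = ortho_compl (kernel T)" "kernel E = kernel T"
    "x - E x \<in> kernel T" "T (E x) = T x"
proof -
  note N = csubspace_ortho_compl[of "kernel T"] closed_ortho_compl[of "kernel T"]
  show E: "orth_projection E" and r: "range E = ortho_compl (kernel T)"
    using projection_onto[OF N] by (auto simp: E_def)
  show k: "kernel E = kernel T"
    unfolding E_def kernel_projection_onto[OF N]
    by (simp add: double_ortho_compl csubspace_kernel closed_kernel T)
  show mem: "x - E x \<in> kernel T"
    unfolding k[symmetric] using orth_projectionD(8)[OF E] by (simp add: kernel_def)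
  then show "T (E x) = T x" by (simp add: kernel_def bounded_clinearD[OF T])
qed

text \<open>The map \<open>|T| z \<mapsto> T z\<close> is isometric, so the closure of its graph is the graph of an isometry
  on the closure of the range of \<open>|T|\<close>.\<close>

lemma polar_decomposition_exists:
  fixes T :: "'a::complex_hilbert \<Rightarrow> 'b::complex_hilbert"
  assumes T: "bounded_clinear T"
  obtains U where "partial_isometry U" "T = U \<circ> abs_op T" "kernel U = kernel T"
proof -
  note A = abs_op_facts[OF T]
  define G where "G x y \<longleftrightarrow> (\<exists>z. (\<lambda>n::nat. abs_op T (z n)) \<longlonglongrightarrow> x \<and> (\<lambda>n. T (z n)) \<longlonglongrightarrow> y)" for x y
  have G_norm: "norm y = norm x" if G: "G x y" for x y
  proof -
    obtain z where z: "(\<lambda>n::nat. abs_op T (z n)) \<longlonglongrightarrow> x" "(\<lambda>n. T (z n)) \<longlonglongrightarrow> y"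
      using G unfolding G_def by blast
    show ?thesis
      using LIMSEQ_unique[OF tendsto_norm[OF z(1)]] tendsto_norm[OF z(2)] by (simp add: A(4))
  qed
  have G_add: "G (x + x') (y + y')" if G: "G x y" "G x' y'" for x y x' y'
  proof -
    obtain z z' where "(\<lambda>n::nat. abs_op T (z n)) \<longlonglongrightarrow> x" "(\<lambda>n. T (z n)) \<longlonglongrightarrow> y"
      "(\<lambda>n::nat. abs_op T (z' n)) \<longlonglongrightarrow> x'" "(\<lambda>n. T (z' n)) \<longlonglongrightarrow> y'"
      using G unfolding G_def by blast
    then show ?thesis unfolding G_def
      by (intro exI[of _ "\<lambda>n. z n + z' n"])
        (simp add: bounded_clinearD[OF T] bounded_clinearD[OF A(1)] tendsto_add)
  qed
  have G_scale: "G (a *\<^sub>C x) (a *\<^sub>C y)" if G: "G x y" for a x y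
  proof -
    obtain z where "(\<lambda>n::nat. abs_op T (z n)) \<longlonglongrightarrow> x" "(\<lambda>n. T (z n)) \<longlonglongrightarrow> y"
      using G unfolding G_def by blast
    then show ?thesis unfolding G_def
      by (intro exI[of _ "\<lambda>n. a *\<^sub>C z n"])
        (simp add: bounded_clinearD[OF T] bounded_clinearD[OF A(1)]
          bounded_linear.tendsto[OF scaleC_bounded_linear])
  qed
  have G_total: "\<exists>y. G x y" if x: "x \<in> ortho_compl (kernel T)" for x
  proof -
    obtain w where w: "\<And>n::nat. w n \<in> range (abs_op T)" "w \<longlonglongrightarrow> x"
      using x unfolding closure_range_abs_op[OF T, symmetric] closure_sequential by blast
    then have "\<forall>n. \<exists>z. w n = abs_op T z" by blast
    then obtain z where z: "\<And>n. w n = abs_op T (z n)" by metis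
    have lim: "(\<lambda>n. abs_op T (z n)) \<longlonglongrightarrow> x" using w(2) by (simp add: z[symmetric])
    have dist: "dist (T (z m)) (T (z n)) = dist (abs_op T (z m)) (abs_op T (z n))" for m n
      using A(4)[of "z m - z n"]
      by (simp add: dist_norm bounded_clinearD[OF T] bounded_clinearD[OF A(1)])
    have "Cauchy (\<lambda>n. T (z n))"
      using LIMSEQ_imp_Cauchy[OF lim] unfolding Cauchy_def dist .
    then obtain y where "(\<lambda>n. T (z n)) \<longlonglongrightarrow> y" using Cauchy_convergent convergent_def by blast
    then show ?thesis using lim unfolding G_def by blast
  qed
  have G_uniq: "y = y'" if "G x y" "G x y'" for x y y'
    using G_norm[OF G_add[OF that(1) G_scale[OF that(2), of "-1"]]] by simp
  define E where "E = projection_onto (ortho_compl (kernel T))"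
  note E = kernel_decomposition[OF T, folded E_def]
  have linE: "bounded_clinear E" using E(1) by (rule orth_projectionD)
  have "\<exists>y. G (E x) y" for x using G_total E(2) by (metis rangeI)
  then obtain U where U: "\<And>x. G (E x) (U x)" by metis
  have U_norm: "norm (U x) = norm (E x)" for x by (rule G_norm[OF U])
  have U_eq: "U x = y" if "G (E x) y" for x y by (rule G_uniq[OF U that])
  have "bounded_clinear U"
  proof (rule bounded_clinearI)
    show "U (x + y) = U x + U y" for x y
      by (rule U_eq) (simp add: bounded_clinearD[OF linE] G_add U)
    show "U (a *\<^sub>C x) = a *\<^sub>C U x" for a x
      by (rule U_eq) (simp add: bounded_clinearD[OF linE] G_scale U)
    show "norm (U x) \<le> 1 * norm x" for x by (simp add: U_norm orth_projectionD(6)[OF E(1)])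
  qed
  moreover have kerU: "kernel U = kernel T"
    unfolding E(3)[symmetric] using U_norm by (auto simp: kernel_def) (metis norm_eq_zero)+
  moreover have "norm (U x) = norm x" if "x \<in> ortho_compl (kernel U)" for x
  proof -
    have "x \<in> {x. E x = x}"
      using that unfolding kerU E(2)[symmetric] range_orth_projection[OF E(1)] .
    then show ?thesis by (simp add: U_norm)
  qed
  moreover have "T = U \<circ> abs_op T"
  proof
    fix z
    have "abs_op T z \<in> {x. E x = x}"
      unfolding range_orth_projection[OF E(1), symmetric] E(2) closure_range_abs_op[OF T, symmetric]
      by (rule subsetD[OF closure_subset rangeI])
    moreover have "G (abs_op T z) (T z)" unfolding G_def by (intro exI[of _ "\<lambda>_. z"]) simp
    ultimately show "T z = (U \<circ> abs_op T) z" using U_eq by simp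
  qed
  ultimately show thesis using that unfolding partial_isometry_def by blast
qed

text \<open>The conditions determine \<open>U\<close> on the range of \<open>|T|\<close>, hence on its closure \<open>(ker T)\<^sup>\<bottom>\<close>, and on
  \<open>ker T\<close>.\<close>

lemma polar_part:
  fixes T :: "'a::complex_hilbert \<Rightarrow> 'b::complex_hilbert"
  assumes T: "bounded_clinear T"
  shows "partial_isometry (polar_part T)" "T x = polar_part T (abs_op T x)"
    "kernel (polar_part T) = kernel T"
proof -
  note A = abs_op_facts[OF T]
  let ?P = "\<lambda>U. partial_isometry U \<and> T = U \<circ> abs_op T \<and> kernel U = kernel T"
  obtain U where U: "partial_isometry U" "T = U \<circ> abs_op T" "kernel U = kernel T"
    using polar_decomposition_exists[OF T] by metis
  have uniq: "W = U" if W: "?P W" for W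
  proof
    fix x
    have linW: "bounded_clinear W" and bounded_clinear_U: "bounded_clinear U"
      using W U(1) by (auto simp: partial_isometry_def)
    have lin: "bounded_clinear (\<lambda>x. W x - U x)" by (intro bounded_clinear_diff linW bounded_clinear_U)
    define E where "E = projection_onto (ortho_compl (kernel T))"
    note E = kernel_decomposition[OF T, folded E_def]
    have "W (abs_op T z) = U (abs_op T z)" for z
      using W U(2) by (metis comp_apply)
    then have "range (abs_op T) \<subseteq> kernel (\<lambda>x. W x - U x)" by (auto simp: kernel_def)
    then have "closure (range (abs_op T)) \<subseteq> kernel (\<lambda>x. W x - U x)"
      by (rule closure_minimal[OF _ closed_kernel[OF lin]])
    then have "E x \<in> kernel (\<lambda>x. W x - U x)"
      unfolding closure_range_abs_op[OF T] E(2)[symmetric] by blast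
    moreover have "W (x - E x) = 0" "U (x - E x) = 0"
      using E(4)[of x] W U(3) by (auto simp: kernel_def)
    ultimately show "W x = U x"
      by (simp add: kernel_def bounded_clinearD(2)[OF linW] bounded_clinearD(2)[OF bounded_clinear_U])
  qed
  have "\<exists>!W. ?P W"
    by (rule ex1I[of _ U]) (use U uniq in \<open>blast+\<close>)
  from theI'[OF this] have P: "?P (polar_part T)" unfolding polar_part_def .
  then show "partial_isometry (polar_part T)" "kernel (polar_part T) = kernel T" by auto
  show "T x = polar_part T (abs_op T x)" using P by (metis comp_apply)
qed


section \<open>Partial isometries\<close>

lemma partial_isometry_linear: "partial_isometry X \<Longrightarrow> bounded_clinear X"
  by (simp add: partial_isometry_def)

lemma partial_isometry_initial:
  assumes X: "partial_isometry X"
  shows "orth_projection (adj X \<circ> X)" "range (adj X \<circ> X) = ortho_compl (kernel X)"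
    "kernel (adj X \<circ> X) = kernel X" "X (adj X (X x)) = X x"
    "norm (X x) = norm (adj X (X x))" "norm (X x) \<le> norm x"
proof -
  have lin: "bounded_clinear X" using X by (simp add: partial_isometry_def)
  define E where "E = projection_onto (ortho_compl (kernel X))"
  note E = kernel_decomposition[OF lin, folded E_def]
  have n: "norm (X x) = norm (E x)" for x
  proof -
    have "E x \<in> ortho_compl (kernel X)" using rangeI[of E x] unfolding E(2) .
    then have "norm (X (E x)) = norm (E x)" using X by (simp add: partial_isometry_def)
    then show ?thesis by (simp only: E(5))
  qed
  have eq: "adj X \<circ> X = E"
    by (rule clinear_eqI_quadratic_form)
      (simp_all add: lin bounded_clinear_compose bounded_clinear_adj cinner_adj_self n
        orth_projectionD(1,4)[OF E(1)])
  show "orth_projection (adj X \<circ> X)" "range (adj X \<circ> X) = ortho_compl (kernel X)"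
    "kernel (adj X \<circ> X) = kernel X"
    using E(1-3) by (simp_all add: eq)
  have eq': "adj X (X x) = E x" for x using eq by (metis comp_apply)
  show "X (adj X (X x)) = X x" "norm (X x) = norm (adj X (X x))" "norm (X x) \<le> norm x"
    by (simp_all add: eq' E(5) n orth_projectionD(6)[OF E(1)])
qed

lemma partial_isometryI:
  assumes lin: "bounded_clinear X" and P: "orth_projection (adj X \<circ> X)"
  shows "partial_isometry X"
  unfolding partial_isometry_def
proof (intro conjI ballI lin)
  fix x assume x: "x \<in> ortho_compl (kernel X)"
  have n: "norm (X x) = norm (adj X (X x))" for x
  proof -
    have "complex_of_real ((norm (X x))\<^sup>2) = complex_of_real ((norm (adj X (X x)))\<^sup>2)"
      using orth_projectionD(4)[OF P, of x] cinner_adj_self[OF lin, of x] by simp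
    then have "(norm (X x))\<^sup>2 = (norm (adj X (X x)))\<^sup>2" using of_real_eq_iff by blast
    then show ?thesis by simp
  qed
  have "kernel X = kernel (adj X \<circ> X)"
    using n by (auto simp: kernel_def bounded_clinearD(4)[OF bounded_clinear_adj[OF lin]])
      (metis norm_eq_zero)
  then have "x \<in> {x. (adj X \<circ> X) x = x}"
    using x ortho_compl_kernel_projection[OF P] range_orth_projection[OF P] by simp
  then show "norm (X x) = norm x" by (simp add: n)
qed

text \<open>The range projection of a partial isometry; by it the adjoint is a partial isometry as well.\<close>

lemma orth_projection_final:
  assumes X: "partial_isometry X" shows "orth_projection (X \<circ> adj X)"
proof -
  note lin = partial_isometry_linear[OF X]
  have "cinner (X (adj X x)) y = cinner x (X (adj X y))" for x y
    by (simp only: cinner_adj_right[OF lin, symmetric] cinner_adj_left[OF lin, symmetric])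
  then show ?thesis
    unfolding orth_projection_def
    by (auto simp: fun_eq_iff partial_isometry_initial(4)[OF X]
        intro!: bounded_clinear_compose bounded_clinear_adj lin)
qed

lemma adj_partial_isometry:
  assumes X: "partial_isometry X" shows "partial_isometry (adj X)"
proof (rule partial_isometryI)
  note lin = partial_isometry_linear[OF X]
  show "bounded_clinear (adj X)" by (rule bounded_clinear_adj[OF lin])
  show "orth_projection (adj (adj X) \<circ> adj X)"
    unfolding adj_adj[OF lin] by (rule orth_projection_final[OF X])
qed

lemma partial_isometry_cinner:
  assumes X: "partial_isometry X" and x: "x \<in> ortho_compl (kernel X)"
  shows "adj X (X x) = x" "cinner (X x) (X y) = cinner x y" "norm (X x) = norm x"
proof -
  note I = partial_isometry_initial[OF X]
  show *: "adj X (X x) = x"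
    using x unfolding I(2)[symmetric] range_orth_projection[OF I(1)] by simp
  then show "cinner (X x) (X y) = cinner x y"
    using cinner_adj_left[OF partial_isometry_linear[OF X], of "X x" y] by simp
  show "norm (X x) = norm x" using X x by (simp add: partial_isometry_def)
qed


section \<open>Orthonormal bases\<close>

definition orthonormal :: "'a::complex_hilbert set \<Rightarrow> bool" where
  "orthonormal B \<longleftrightarrow> (\<forall>b\<in>B. \<forall>c\<in>B. cinner b c = (if b = c then 1 else 0))"

text \<open>Bases are sets, so that they can be extended, and split along orthogonal subspaces, by set
  operations. Together with closedness of \<open>M\<close>, maximality in the last conjunct is completeness
  (\<open>parseval_identity\<close>).\<close>

definition onb :: "'a::complex_hilbert set \<Rightarrow> 'a set \<Rightarrow> bool" where
  "onb B M \<longleftrightarrow> csubspace M \<and> closed M \<and> orthonormal B \<and> B \<subseteq> M \<and>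
     (\<forall>x\<in>M. (\<forall>b\<in>B. cinner x b = 0) \<longrightarrow> x = 0)"

lemma orthonormalD:
  assumes "orthonormal B" "b \<in> B"
  shows "cinner b b = 1" "norm b = 1" "c \<in> B \<Longrightarrow> c \<noteq> b \<Longrightarrow> cinner c b = 0"
proof -
  show 1: "cinner b b = 1" and "c \<in> B \<Longrightarrow> c \<noteq> b \<Longrightarrow> cinner c b = 0"
    using assms by (auto simp: orthonormal_def)
  have "complex_of_real ((norm b)\<^sup>2) = complex_of_real 1" using 1 cinner_self[of b] by simp
  then have "(norm b)\<^sup>2 = 1\<^sup>2" using of_real_eq_iff by (metis one_power2)
  then show "norm b = 1" by (simp only: power2_eq_iff_nonneg norm_ge_zero zero_le_one)
qed

lemma orthonormal_subset: "orthonormal B \<Longrightarrow> A \<subseteq> B \<Longrightarrow> orthonormal A"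
  unfolding orthonormal_def by (intro ballI) (simp add: subset_iff)

lemma orthonormal_Un:
  assumes "orthonormal A" "orthonormal B" "\<And>a b. a \<in> A \<Longrightarrow> b \<in> B \<Longrightarrow> cinner a b = 0"
  shows "orthonormal (A \<union> B)" "A \<inter> B = {}"
proof -
  show disj: "A \<inter> B = {}" using assms(3) orthonormalD(1)[OF assms(1)] by fastforce
  have "cinner b a = 0" if "a \<in> A" "b \<in> B" for a b
    using assms(3)[OF that] by (simp add: cinner_zero_commute)
  then show "orthonormal (A \<union> B)"
    using assms disj unfolding orthonormal_def by (metis Un_iff disjoint_iff)
qed

lemma onbD:
  assumes "onb B M"
  shows "csubspace M" "closed M" "orthonormal B" "B \<subseteq> M"
    "x \<in> M \<Longrightarrow> (\<And>b. b \<in> B \<Longrightarrow> cinner x b = 0) \<Longrightarrow> x = 0"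
  using assms by (auto simp: onb_def)

lemma extend_to_onb:
  fixes M :: "'a::complex_hilbert set"
  assumes M: "csubspace M" "closed M" and A: "orthonormal A" "A \<subseteq> M"
  obtains B where "A \<subseteq> B" "onb B M"
proof -
  define F where "F = {B. A \<subseteq> B \<and> B \<subseteq> M \<and> orthonormal B}"
  have chain: "\<Union>C \<in> F" if C: "C \<noteq> {}" "subset.chain F C" for C
  proof -
    have "orthonormal (\<Union>C)"
      unfolding orthonormal_def
    proof (intro ballI)
      fix b c assume "b \<in> \<Union>C" "c \<in> \<Union>C"
      then obtain X Y where XY: "b \<in> X" "X \<in> C" "c \<in> Y" "Y \<in> C" by blast
      then have "X \<subseteq> Y \<or> Y \<subseteq> X" using C(2) by (auto simp: subset_chain_def)
      moreover have "orthonormal X" "orthonormal Y"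
        using XY C(2) by (auto simp: F_def subset_chain_def)
      ultimately show "cinner b c = (if b = c then 1 else 0)"
        using XY unfolding orthonormal_def by blast
    qed
    then show ?thesis using C by (auto simp: F_def subset_chain_def)
  qed
  have "F \<noteq> {}" using A by (auto simp: F_def)
  from subset_Zorn_nonempty[OF this chain]
  obtain B where B: "B \<in> F" "\<And>X. X \<in> F \<Longrightarrow> B \<subseteq> X \<Longrightarrow> X = B" by blast
  have "x = 0" if x: "x \<in> M" "\<And>b. b \<in> B \<Longrightarrow> cinner x b = 0" for x
  proof (rule ccontr)
    assume "x \<noteq> 0"
    define e where "e = inverse (norm x) *\<^sub>R x"
    have e: "cinner e e = 1"
      using \<open>x \<noteq> 0\<close> by (simp add: e_def cinner_algebra cinner_self power2_eq_square)
    have "cinner e b = 0" if "b \<in> B" for b using x(2)[OF that] by (simp add: e_def cinner_algebra)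
    then have "orthonormal ({e} \<union> B)"
      using e B(1) by (intro orthonormal_Un) (auto simp: F_def orthonormal_def)
    then have "{e} \<union> B \<in> F" using B(1) x(1) M(1) by (auto simp: F_def e_def csubspaceD)
    then have "e \<in> B" using B(2) by blast
    then show False using e \<open>\<And>b. b \<in> B \<Longrightarrow> cinner e b = 0\<close> by fastforce
  qed
  then have "onb B M" using B(1) M by (auto simp: onb_def F_def)
  then show thesis using that B(1) by (auto simp: F_def)
qed

lemma onb_exists:
  assumes "csubspace M" "closed M" obtains B where "onb B M"
  using extend_to_onb[OF assms, of "{}"] by (auto simp: orthonormal_def)

lemma onb_UNIV_exists: obtains B where "onb B (UNIV :: 'a::complex_hilbert set)"
  using onb_exists[of UNIV] complex_vector.subspace_UNIV by auto

lemma ortho_compl_iff_right: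
  "x \<in> ortho_compl M \<longleftrightarrow> (\<forall>y\<in>M. cinner y x = 0)"
  by (auto simp: ortho_compl_def) (metis cinner_zero_commute)+

lemma onb_Un:
  assumes B: "onb B M" and C: "onb C (ortho_compl M)"
  shows "onb (B \<union> C) UNIV" "B \<inter> C = {}"
proof -
  have orth: "cinner b c = 0" if "b \<in> B" "c \<in> C" for b c
    using onbD(4)[OF B] onbD(4)[OF C] that ortho_compl_iff_right by blast
  show "B \<inter> C = {}"
    by (rule orthonormal_Un[OF onbD(3)[OF B] onbD(3)[OF C] orth])
  show "onb (B \<union> C) UNIV"
    unfolding onb_def
  proof (intro conjI ballI impI)
    show "orthonormal (B \<union> C)" by (rule orthonormal_Un[OF onbD(3)[OF B] onbD(3)[OF C] orth])
    fix x assume x: "\<forall>b\<in>B \<union> C. cinner x b = 0"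
    obtain p where p: "p \<in> M" "x - p \<in> ortho_compl M"
      using orthogonal_decomposition[OF onbD(1,2)[OF B]] by metis
    have "p = 0"
    proof (rule onbD(5)[OF B p(1)])
      fix b assume "b \<in> B"
      then have "cinner (x - p) b = 0" using p(2) onbD(4)[OF B] by (auto simp: ortho_compl_def)
      then show "cinner p b = 0" using x \<open>b \<in> B\<close> by (simp add: cinner_diff_left)
    qed
    then have "x \<in> ortho_compl M" using p(2) by simp
    then show "x = 0" using onbD(5)[OF C] x by blast
  qed (simp_all add: complex_vector.subspace_UNIV)
qed

lemma finite_orthonormal_projection:
  fixes B :: "'a::complex_hilbert set"
  assumes fin: "finite B" and B: "orthonormal B"
  defines "E \<equiv> \<lambda>x. \<Sum>b\<in>B. cinner x b *\<^sub>C b"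
  shows "orth_projection E" "range E = cspan B" "(norm (E x))\<^sup>2 = (\<Sum>b\<in>B. (cmod (cinner x b))\<^sup>2)"
    "b \<in> B \<Longrightarrow> E b = b" "b \<in> B \<Longrightarrow> cinner (E x) b = cinner x b"
proof -
  have Eb: "E b = b" if "b \<in> B" for b
  proof -
    have "E b = (\<Sum>c\<in>B. if c = b then b else 0)"
      unfolding E_def using B that by (intro sum.cong) (auto simp: orthonormal_def)
    then show ?thesis using fin that by (simp add: sum.delta)
  qed
  have sym: "cinner (E x) y = cinner x (E y)" for x y
  proof -
    have "cinner b y = cnj (cinner y b)" for b by (rule cinner_commute)
    then show ?thesis
      by (simp add: E_def cinner_sum_left cinner_sum_right cinner_algebra mult.commute)
  qed
  have lin: "bounded_clinear E"
  proof (rule bounded_clinearI)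
    show "E (x + y) = E x + E y" for x y
      by (simp add: E_def cinner_add_left scaleC_add_left sum.distrib)
    show "E (a *\<^sub>C x) = a *\<^sub>C E x" for a x
      by (simp add: E_def cinner_scaleC_left complex_vector.scale_sum_right scaleC_scaleC)
    fix x
    have "norm (E x) \<le> (\<Sum>b\<in>B. norm x)"
      unfolding E_def
    proof (rule sum_norm_le)
      fix b assume "b \<in> B"
      then show "norm (cinner x b *\<^sub>C b) \<le> norm x"
        using cauchy_schwarz[of x b] by (simp add: norm_scaleC orthonormalD[OF B])
    qed
    then show "norm (E x) \<le> real (card B) * norm x" by simp
  qed
  have EE: "E (E x) = E x" for x
  proof -
    have "E (E x) = (\<Sum>b\<in>B. cinner x b *\<^sub>C E b)"
      by (subst (2) E_def) (simp add: bounded_clinearD[OF lin])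
    also have "\<dots> = E x" by (subst (2) E_def) (intro sum.cong, simp_all add: Eb)
    finally show ?thesis .
  qed
  show E: "orth_projection E" using lin EE sym by (auto simp: orth_projection_def)
  show "range E = cspan B"
  proof
    show "range E \<subseteq> cspan B"
      unfolding E_def
      by (intro image_subsetI complex_vector.span_sum complex_vector.span_scale
          complex_vector.span_base)
    show "cspan B \<subseteq> range E"
      by (rule complex_vector.span_minimal[OF _ csubspace_range[OF lin]])
        (metis Eb rangeI subsetI)
  qed
  show eb: "b \<in> B \<Longrightarrow> E b = b" for b by (rule Eb)
  show cb: "cinner (E x) b = cinner x b" if "b \<in> B" for x b by (simp add: sym Eb that)
  have "complex_of_real ((norm (E x))\<^sup>2) = cinner x (E x)"
    using orth_projectionD(4)[OF E, of x] sym[of x x] by simp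
  also have "\<dots> = (\<Sum>b\<in>B. complex_of_real ((cmod (cinner x b))\<^sup>2))"
    unfolding E_def cinner_sum_right cinner_scaleC_right complex_norm_square
    by (simp add: mult.commute)
  finally show "(norm (E x))\<^sup>2 = (\<Sum>b\<in>B. (cmod (cinner x b))\<^sup>2)"
    unfolding of_real_sum[symmetric] of_real_eq_iff .
qed

lemma orthonormal_independent:
  assumes B: "orthonormal B" shows "complex_vector.independent B"
proof
  assume "complex_vector.dependent B"
  then obtain b where b: "b \<in> B" "b \<in> cspan (B - {b})"
    by (auto simp: complex_vector.dependent_def)
  have "cspan (B - {b}) \<subseteq> ortho_compl {b}"
    by (rule complex_vector.span_minimal[OF _ csubspace_ortho_compl])
      (use b(1) in \<open>auto simp: ortho_compl_def orthonormalD(3)[OF B]\<close>)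
  then show False using b orthonormalD(1)[OF B b(1)] by (auto simp: ortho_compl_def)
qed

lemma finite_onb_span: "onb B V \<Longrightarrow> finite B \<Longrightarrow> cspan B = V"
proof
  assume B: "onb B V" and fin: "finite B"
  define E where "E x = (\<Sum>b\<in>B. cinner x b *\<^sub>C b)" for x
  note E = finite_orthonormal_projection[OF fin onbD(3)[OF B], folded E_def]
  show sub: "cspan B \<subseteq> V"
    by (rule complex_vector.span_minimal[OF onbD(4)[OF B] onbD(1)[OF B]])
  show "V \<subseteq> cspan B"
  proof
    fix x assume "x \<in> V"
    moreover have Ex: "E x \<in> cspan B" using E(2) by blast
    ultimately have "x - E x \<in> V" using sub csubspaceD(3)[OF onbD(1)[OF B]] by blast
    then have "x - E x = 0" by (rule onbD(5)[OF B]) (simp add: cinner_diff_left E(5))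
    then show "x \<in> cspan B" using Ex by simp
  qed
qed

lemma onb_cspan: "finite B \<Longrightarrow> orthonormal B \<Longrightarrow> onb B (cspan B)"
proof -
  assume fin: "finite B" and B: "orthonormal B"
  note E = finite_orthonormal_projection[OF fin B]
  have "x = 0" if x: "x \<in> cspan B" "\<And>b. b \<in> B \<Longrightarrow> cinner x b = 0" for x
  proof -
    have "(\<Sum>b\<in>B. cinner x b *\<^sub>C b) = x"
      using x(1) unfolding E(2)[symmetric] range_orth_projection[OF E(1)] by simp
    moreover have "(\<Sum>b\<in>B. cinner x b *\<^sub>C b) = 0" by (intro sum.neutral) (simp add: x(2))
    ultimately show ?thesis by simp
  qed
  moreover have "closed (cspan B)" using closed_range_projection[OF E(1)] unfolding E(2) .
  ultimately show ?thesis
    using B by (auto simp: onb_def complex_vector.span_base)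
qed

lemma finite_onb_dim:
  assumes B: "onb B V" and fin: "finite B"
  shows "finite_cdim V" "cdim V = card B"
proof -
  note span = finite_onb_span[OF assms]
  show "finite_cdim V" unfolding finite_cdim_def using fin span by blast
  show "cdim V = card B"
    unfolding span[symmetric] complex_vector.dim_span
    by (rule complex_vector.dim_eq_card_independent[OF orthonormal_independent[OF onbD(3)[OF B]]])
qed

lemma finite_onb_iff:
  assumes B: "onb B V" shows "finite B \<longleftrightarrow> finite_cdim V"
proof
  assume "finite_cdim V"
  then obtain S where S: "finite S" "V \<subseteq> cspan S" by (auto simp: finite_cdim_def)
  then show "finite B"
    using complex_vector.independent_span_bound[OF S(1)
        orthonormal_independent[OF onbD(3)[OF B]]] onbD(4)[OF B] by blast
qed (rule finite_onb_dim[OF B])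


section \<open>Hilbert--Schmidt sums\<close>

text \<open>A simple function below \<open>f\<close> with infinite support takes some positive value infinitely often, so
  that the finite sums of \<open>f\<close> are unbounded.\<close>

lemma nn_integral_count_space_le:
  fixes c :: ennreal
  assumes le: "\<And>A. finite A \<Longrightarrow> A \<subseteq> B \<Longrightarrow> sum f A \<le> c"
  shows "(\<integral>\<^sup>+b. f b \<partial>count_space B) \<le> c"
proof (cases "c = top")
  case False
  show ?thesis
    unfolding nn_integral_def_finite
  proof (rule SUP_least, elim CollectE conjE)
    fix g assume g: "simple_function (count_space B) g" "g \<le> f" "\<forall>x. g x < top"
    define S where "S = {b \<in> B. 0 < g b}"
    have "finite S"
    proof (rule ccontr)
      assume inf: "infinite S"
      have "finite (g ` S)"
        using g(1) by (auto simp: S_def intro: finite_subset[of _ "g ` B"])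
      then obtain v where v: "v \<in> g ` S" "infinite (g -` {v} \<inter> S)"
        using inf_img_fin_domE'[OF _ inf] by metis
      have "0 < v" "v < top" using v(1) g(3) by (auto simp: S_def)
      then obtain r where r: "v = ennreal r" "r > 0"
        by (cases v) (auto simp: ennreal_less_zero_iff)
      obtain q where q: "c = ennreal q" "q \<ge> 0" using False by (cases c) auto
      obtain n where n: "q < real n * r" using reals_Archimedean3[OF r(2)] by blast
      obtain A where A: "finite A" "card A = n" "A \<subseteq> g -` {v} \<inter> S"
        using infinite_arbitrarily_large[OF v(2)] by blast
      have "ennreal (real n * r) = (\<Sum>a\<in>A. v)"
        using A(2) r by (simp add: ennreal_mult ennreal_of_nat_eq_real_of_nat)
      also have "\<dots> = (\<Sum>a\<in>A. g a)" using A(3) by (intro sum.cong) auto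
      also have "\<dots> \<le> (\<Sum>a\<in>A. f a)" using g(2) by (intro sum_mono) (auto simp: le_fun_def)
      also have "\<dots> \<le> c" using A by (intro le) (auto simp: S_def)
      finally show False using n q by (simp add: ennreal_le_iff)
    qed
    have "integral\<^sup>S (count_space B) g = (\<integral>\<^sup>+b. g b \<partial>count_space B)"
      by (rule nn_integral_eq_simple_integral[OF g(1), symmetric])
    also have "\<dots> = (\<Sum>b\<in>S. g b)"
      using \<open>finite S\<close> unfolding S_def by (rule nn_integral_count_space)
    also have "\<dots> \<le> (\<Sum>b\<in>S. f b)" using g(2) by (intro sum_mono) (auto simp: le_fun_def)
    also have "\<dots> \<le> c" using \<open>finite S\<close> by (intro le) (auto simp: S_def)
    finally show "integral\<^sup>S (count_space B) g \<le> c" .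
  qed
qed simp

lemma nn_integral_count_space_restrict:
  fixes f :: "'a \<Rightarrow> ennreal"
  shows "(\<integral>\<^sup>+b. f b \<partial>count_space B) = (\<integral>\<^sup>+b. f b * indicator B b \<partial>count_space UNIV)"
  by (cases "B = UNIV") (auto simp: nn_integral_count_space_indicator)

lemma nn_integral_count_space_mono_set:
  fixes f :: "'a \<Rightarrow> ennreal"
  assumes "A \<subseteq> B"
  shows "(\<integral>\<^sup>+b. f b \<partial>count_space A) \<le> (\<integral>\<^sup>+b. f b \<partial>count_space B)"
  unfolding nn_integral_count_space_restrict[of A] nn_integral_count_space_restrict[of B]
  using assms by (intro nn_integral_mono) (auto split: split_indicator)

lemma sum_le_nn_integral_count_space:
  "finite A \<Longrightarrow> A \<subseteq> B \<Longrightarrow> sum f A \<le> (\<integral>\<^sup>+b. f b \<partial>count_space B)" for f :: "'a \<Rightarrow> ennreal"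
  using nn_integral_count_space_mono_set[of A B f] by (simp add: nn_integral_count_space_finite)

lemma nn_integral_count_space_Un:
  fixes f :: "'a \<Rightarrow> ennreal"
  assumes "A \<inter> B = {}"
  shows "(\<integral>\<^sup>+b. f b \<partial>count_space (A \<union> B)) =
    (\<integral>\<^sup>+b. f b \<partial>count_space A) + (\<integral>\<^sup>+b. f b \<partial>count_space B)"
proof -
  have "(\<integral>\<^sup>+b. f b \<partial>count_space (A \<union> B)) =
      (\<integral>\<^sup>+b. f b * indicator A b + f b * indicator B b \<partial>count_space UNIV)"
    unfolding nn_integral_count_space_restrict[of "A \<union> B"]
    using assms by (intro nn_integral_cong) (auto split: split_indicator)
  also have "\<dots> = (\<integral>\<^sup>+b. f b * indicator A b \<partial>count_space UNIV) +
      (\<integral>\<^sup>+b. f b * indicator B b \<partial>count_space UNIV)"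
    by (intro nn_integral_add) auto
  finally show ?thesis unfolding nn_integral_count_space_restrict[symmetric] .
qed

lemma nn_integral_count_space_swap:
  fixes f :: "'a \<Rightarrow> 'b \<Rightarrow> ennreal"
  shows "(\<integral>\<^sup>+b. \<integral>\<^sup>+c. f b c \<partial>count_space C \<partial>count_space B) =
    (\<integral>\<^sup>+c. \<integral>\<^sup>+b. f b c \<partial>count_space B \<partial>count_space C)"
proof -
  let ?g = "\<lambda>(b, c). f b c * indicator C c * indicator B b"
  have "(\<integral>\<^sup>+b. \<integral>\<^sup>+c. f b c \<partial>count_space C \<partial>count_space B) =
      (\<integral>\<^sup>+b. \<integral>\<^sup>+c. ?g (b, c) \<partial>count_space UNIV \<partial>count_space UNIV)"
    unfolding nn_integral_count_space_restrict[of C] nn_integral_count_space_restrict[of B]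
    by (simp add: nn_integral_multc)
  also have "\<dots> = (\<integral>\<^sup>+c. \<integral>\<^sup>+b. ?g (b, c) \<partial>count_space UNIV \<partial>count_space UNIV)"
    unfolding nn_integral_fst_count_space nn_integral_snd_count_space ..
  also have "\<dots> = (\<integral>\<^sup>+c. \<integral>\<^sup>+b. f b c \<partial>count_space B \<partial>count_space C)"
    unfolding nn_integral_count_space_restrict[of C] nn_integral_count_space_restrict[of B]
    by (intro nn_integral_cong)
      (subst nn_integral_multc[symmetric], auto simp: mult_ac intro!: nn_integral_cong)
  finally show ?thesis .
qed

text \<open>The squared Hilbert--Schmidt norm of \<open>T\<close> if \<open>B\<close> is an orthonormal basis of the whole space. With
  values in the extended nonnegative reals, identities between such sums carry no summability
  conditions.\<close>

definition hs :: "('a \<Rightarrow> 'b::real_normed_vector) \<Rightarrow> 'a set \<Rightarrow> ennreal" where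
  "hs T B = (\<integral>\<^sup>+b. ennreal ((norm (T b))\<^sup>2) \<partial>count_space B)"

lemma hs_Un: "A \<inter> B = {} \<Longrightarrow> hs T (A \<union> B) = hs T A + hs T B"
  unfolding hs_def by (rule nn_integral_count_space_Un)

lemma hs_mono_set: "A \<subseteq> B \<Longrightarrow> hs T A \<le> hs T B"
  unfolding hs_def by (rule nn_integral_count_space_mono_set)

lemma hs_mono: "(\<And>b. b \<in> B \<Longrightarrow> norm (S b) \<le> norm (T b)) \<Longrightarrow> hs S B \<le> hs T B"
  unfolding hs_def by (intro nn_integral_mono ennreal_leI power_mono) auto

lemma hs_cong: "(\<And>b. b \<in> B \<Longrightarrow> norm (S b) = norm (T b)) \<Longrightarrow> hs S B = hs T B"
  unfolding hs_def by (intro nn_integral_cong) auto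

lemma hs_image: "inj_on W B \<Longrightarrow> hs T (W ` B) = hs (\<lambda>b. T (W b)) B"
  unfolding hs_def
  by (rule nn_integral_bij_count_space[symmetric, OF inj_on_imp_bij_betw])

lemma hs_eq_0: "(\<And>b. b \<in> B \<Longrightarrow> T b = 0) \<Longrightarrow> hs T B = 0"
  unfolding hs_def by (subst nn_integral_0_iff_AE) (auto simp: AE_count_space)

lemma hs_eq_0D: "hs T B = 0 \<Longrightarrow> b \<in> B \<Longrightarrow> T b = 0"
  unfolding hs_def by (subst (asm) nn_integral_0_iff_AE) (auto simp: AE_count_space)

lemma hs_unit:
  assumes "\<And>b. b \<in> B \<Longrightarrow> norm (T b) = 1"
  shows "hs T B < top \<longleftrightarrow> finite B" "finite B \<Longrightarrow> hs T B = of_nat (card B)"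
proof -
  have "hs T B = (\<integral>\<^sup>+b. 1 \<partial>count_space B)"
    unfolding hs_def using assms by (intro nn_integral_cong) auto
  then have "hs T B = emeasure (count_space B) B" by simp
  then show "hs T B < top \<longleftrightarrow> finite B" "finite B \<Longrightarrow> hs T B = of_nat (card B)"
    by (auto simp: emeasure_count_space ennreal_of_nat_eq_real_of_nat)
qed

lemma hs_add_finite:
  assumes "hs S B < top" "hs T B < top"
  shows "hs (\<lambda>b. S b + T b) B < top"
proof -
  have "ennreal ((norm (S b + T b))\<^sup>2) \<le>
      2 * ennreal ((norm (S b))\<^sup>2) + 2 * ennreal ((norm (T b))\<^sup>2)" for b
  proof -
    have "(norm (S b + T b))\<^sup>2 \<le> (norm (S b) + norm (T b))\<^sup>2"
      by (simp add: norm_triangle_ineq power_mono)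
    also have "\<dots> \<le> 2 * (norm (S b))\<^sup>2 + 2 * (norm (T b))\<^sup>2"
      using sum_squares_bound[of "norm (S b)" "norm (T b)"] by (simp add: power2_sum)
    finally show ?thesis
      by (simp add: ennreal_mult'[symmetric] flip: ennreal_numeral ennreal_plus)
  qed
  then have "hs (\<lambda>b. S b + T b) B \<le>
      (\<integral>\<^sup>+b. 2 * ennreal ((norm (S b))\<^sup>2) + 2 * ennreal ((norm (T b))\<^sup>2) \<partial>count_space B)"
    unfolding hs_def by (intro nn_integral_mono)
  also have "\<dots> = 2 * hs S B + 2 * hs T B"
    unfolding hs_def by (simp add: nn_integral_add nn_integral_cmult)
  also have "\<dots> < top" using assms by (simp add: ennreal_mult_less_top)
  finally show ?thesis .
qed

lemma hs_diff_finite: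
  "hs S B < top \<Longrightarrow> hs T B < top \<Longrightarrow> hs (\<lambda>b. S b - T b) B < top"
  using hs_add_finite[of S B "\<lambda>b. - T b"] by (simp add: hs_def)

lemma bessel_inequality:
  assumes "finite A" "orthonormal A"
  shows "(\<Sum>b\<in>A. (cmod (cinner y b))\<^sup>2) \<le> (norm y)\<^sup>2"
  unfolding finite_orthonormal_projection(3)[OF assms, symmetric]
  by (intro power_mono orth_projectionD(6) finite_orthonormal_projection(1)[OF assms]) simp

text \<open>A vector of a closed subspace is a limit of combinations of the basis vectors, and the
  finite partial sum of its expansion is at least as good an approximation as any of these.\<close>

lemma parseval_identity:
  fixes B :: "'a::complex_hilbert set"
  assumes B: "onb B M" and y: "y \<in> M"
  shows "(\<integral>\<^sup>+b. ennreal ((cmod (cinner y b))\<^sup>2) \<partial>count_space B) = ennreal ((norm y)\<^sup>2)"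
proof (rule antisym)
  note on = onbD(3)[OF B]
  show "(\<integral>\<^sup>+b. ennreal ((cmod (cinner y b))\<^sup>2) \<partial>count_space B) \<le> ennreal ((norm y)\<^sup>2)"
    by (intro nn_integral_count_space_le)
      (auto simp: sum_ennreal intro!: ennreal_leI bessel_inequality orthonormal_subset[OF on])
  have M': "csubspace (closure (cspan B))" "closed (closure (cspan B))"
    by (intro csubspace_closure complex_vector.subspace_span) simp
  obtain p where p: "p \<in> closure (cspan B)" "y - p \<in> ortho_compl (closure (cspan B))"
    using orthogonal_decomposition[OF M'] by metis
  have "closure (cspan B) \<subseteq> M"
    by (intro closure_minimal complex_vector.span_minimal onbD[OF B])
  then have "y - p \<in> M" using p(1) y csubspaceD(3)[OF onbD(1)[OF B]] by blast
  moreover have "cinner (y - p) b = 0" if "b \<in> B" for b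
    using p(2) complex_vector.span_base[OF that] closure_subset[of "cspan B"]
    by (auto simp: ortho_compl_def)
  ultimately have "y - p = 0" by (rule onbD(5)[OF B])
  then have ycl: "y \<in> closure (cspan B)" using p(1) by simp
  show "ennreal ((norm y)\<^sup>2) \<le> (\<integral>\<^sup>+b. ennreal ((cmod (cinner y b))\<^sup>2) \<partial>count_space B)"
  proof (rule ennreal_le_epsilon)
    fix e :: real assume "e > 0"
    then obtain z where z: "z \<in> cspan B" "dist z y < sqrt e"
      using ycl unfolding closure_approachable by (metis real_sqrt_gt_zero)
    obtain A where A: "finite A" "A \<subseteq> B" "z \<in> cspan A"
      using z(1) complex_vector.span_explicit[of B]
      by (smt (verit, best) complex_vector.span_base complex_vector.span_scale
          complex_vector.span_sum mem_Collect_eq)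
    have onA: "orthonormal A" using orthonormal_subset[OF on A(2)] .
    define E where "E x = (\<Sum>b\<in>A. cinner x b *\<^sub>C b)" for x
    note E = finite_orthonormal_projection[OF A(1) onA, folded E_def]
    have Ez: "E z = z" using A(3) range_orth_projection[OF E(1)] E(2) by auto
    have eq: "y - E y = (y - z) - E (y - z)"
      by (simp add: bounded_clinearD(2)[OF orth_projectionD(1)[OF E(1)]] Ez)
    have "(norm (y - E y))\<^sup>2 \<le> (norm (y - z))\<^sup>2"
      unfolding eq orth_projectionD(5)[OF E(1), of "y - z"] by simp
    also have "\<dots> \<le> (sqrt e)\<^sup>2" using z(2) by (intro power_mono) (auto simp: dist_norm norm_minus_commute)
    finally have "(norm y)\<^sup>2 \<le> (\<Sum>b\<in>A. (cmod (cinner y b))\<^sup>2) + e"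
      using \<open>e > 0\<close> orth_projectionD(5)[OF E(1), of y] by (simp add: E(3))
    then have "ennreal ((norm y)\<^sup>2) \<le> ennreal (\<Sum>b\<in>A. (cmod (cinner y b))\<^sup>2) + ennreal e"
      using \<open>e > 0\<close> by (subst ennreal_plus[symmetric]) (auto intro!: ennreal_leI sum_nonneg)
    also have "ennreal (\<Sum>b\<in>A. (cmod (cinner y b))\<^sup>2) \<le>
        (\<integral>\<^sup>+b. ennreal ((cmod (cinner y b))\<^sup>2) \<partial>count_space B)"
      using sum_le_nn_integral_count_space[OF A(1,2), of "\<lambda>b. ennreal ((cmod (cinner y b))\<^sup>2)"]
      by (simp add: sum_ennreal)
    finally show "ennreal ((norm y)\<^sup>2) \<le>
        (\<integral>\<^sup>+b. ennreal ((cmod (cinner y b))\<^sup>2) \<partial>count_space B) + ennreal e"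
      by (simp add: add_right_mono)
  qed
qed

lemma parseval_projection:
  assumes E: "orth_projection E" and B: "onb B (range E)"
  shows "(\<integral>\<^sup>+b. ennreal ((cmod (cinner y b))\<^sup>2) \<partial>count_space B) = ennreal ((norm (E y))\<^sup>2)"
proof -
  have "cinner y b = cinner (E y) b" if "b \<in> B" for b
    using onbD(4)[OF B] that range_orth_projection[OF E] orth_projectionD(3)[OF E, of y b] by auto
  then have "(\<integral>\<^sup>+b. ennreal ((cmod (cinner y b))\<^sup>2) \<partial>count_space B) =
      (\<integral>\<^sup>+b. ennreal ((cmod (cinner (E y) b))\<^sup>2) \<partial>count_space B)"
    by (intro nn_integral_cong) auto
  then show ?thesis using parseval_identity[OF B, of "E y"] by simp
qed

text \<open>Both sides are the double sum of \<open>|\<langle>T b, c\<rangle>|\<^sup>2\<close>, by Parseval's identity in the two bases. That the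
  right-hand side does not involve the choice of \<open>B\<close> gives independence of the basis.\<close>

lemma hs_adj:
  assumes T: "bounded_clinear T" and E: "orth_projection E" "onb B (range E)"
    and E': "orth_projection E'" "onb C (range E')"
  shows "hs (\<lambda>x. E' (T x)) B = hs (\<lambda>y. E (adj T y)) C"
proof -
  have "hs (\<lambda>x. E' (T x)) B =
      (\<integral>\<^sup>+b. \<integral>\<^sup>+c. ennreal ((cmod (cinner (T b) c))\<^sup>2) \<partial>count_space C \<partial>count_space B)"
    unfolding hs_def parseval_projection[OF E'] ..
  also have "\<dots> = (\<integral>\<^sup>+c. \<integral>\<^sup>+b. ennreal ((cmod (cinner (T b) c))\<^sup>2) \<partial>count_space B \<partial>count_space C)"
    by (rule nn_integral_count_space_swap)
  also have "\<dots> = (\<integral>\<^sup>+c. \<integral>\<^sup>+b. ennreal ((cmod (cinner (adj T c) b))\<^sup>2) \<partial>count_space B \<partial>count_space C)"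
    by (simp add: cinner_adj_left[OF T] cmod_cinner_commute[of "T _"])
  also have "\<dots> = hs (\<lambda>y. E (adj T y)) C"
    unfolding hs_def parseval_projection[OF E] ..
  finally show ?thesis .
qed

lemma orth_projection_ident: "orth_projection (\<lambda>x. x)"
  by (simp add: orth_projection_def bounded_clinear_ident o_def)

lemma hs_adj_UNIV:
  assumes "bounded_clinear T" "onb B UNIV" "onb C UNIV"
  shows "hs T B = hs (adj T) C"
  using hs_adj[OF assms(1) orth_projection_ident _ orth_projection_ident] assms by simp

lemma hs_independent_of_basis:
  fixes T :: "'a::complex_hilbert \<Rightarrow> 'b::complex_hilbert"
  assumes T: "bounded_clinear T" and B: "onb B M" and B': "onb B' M"
  shows "hs T B = hs T B'"
proof -
  obtain C where C: "onb C (UNIV :: 'b set)" using onb_UNIV_exists by blast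
  note E = projection_onto[OF onbD(1,2)[OF B]]
  show ?thesis
    using hs_adj[OF T E(1) _ orth_projection_ident, of B C]
      hs_adj[OF T E(1) _ orth_projection_ident, of B' C] B B' C by (simp add: E(2))
qed

lemma hs_orthonormal_le:
  assumes T: "bounded_clinear T" and B: "onb B M" and A: "orthonormal A" "A \<subseteq> M"
  shows "hs T A \<le> hs T B"
proof -
  obtain B' where "A \<subseteq> B'" "onb B' M" using extend_to_onb[OF onbD(1,2)[OF B] A] by blast
  then show ?thesis using hs_mono_set[of A B' T] hs_independent_of_basis[OF T B] by simp
qed


section \<open>The index of a pair of projections\<close>

lemma onb_orthogonal:
  assumes B: "onb B M" and x: "\<And>b. b \<in> B \<Longrightarrow> cinner x b = 0"
  shows "x \<in> ortho_compl M"
proof -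
  define E where "E = projection_onto M"
  note E = projection_onto[OF onbD(1,2)[OF B], folded E_def]
  have "E x = 0"
  proof (rule onbD(5)[OF B])
    show "E x \<in> M" using rangeI[of E x] unfolding E(2) .
    fix b assume b: "b \<in> B"
    then have "E b = b" using onbD(4)[OF B] range_orth_projection[OF E(1)] E(2) by auto
    then show "cinner (E x) b = 0" using x[OF b] by (simp add: orth_projectionD(3)[OF E(1)])
  qed
  then show ?thesis
    using kernel_projection_onto[OF onbD(1,2)[OF B]] by (auto simp: kernel_def E_def)
qed

lemma adj_mem_ortho_compl_kernel:
  assumes T: "bounded_clinear T" shows "adj T y \<in> ortho_compl (kernel T)"
  by (auto simp: ortho_compl_def kernel_def cinner_adj_left[OF T])

lemma kernel_ortho_compl_range:
  assumes "orth_projection E" shows "kernel E = ortho_compl (range E)"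
  using ortho_compl_kernel_projection[OF orth_projection_complement[OF assms]]
  unfolding kernel_complement range_orth_projection[OF assms, symmetric]
    kernel_orth_projection[OF assms] ..

text \<open>In the polar decomposition \<open>Q P = W |Q P|\<close> the isometry \<open>W\<close> carries the orthogonal
  complement of \<open>ker Q \<inter> ran P\<close> in \<open>ran P\<close> onto that of \<open>ran Q \<inter> ker P\<close> in \<open>ran Q\<close>, and
  \<open>\<parallel>(1 - P) W b\<parallel> = \<parallel>(1 - Q) b\<parallel>\<close>. Hence the Hilbert--Schmidt sums of \<open>1 - Q\<close> on \<open>ran P\<close> and of
  \<open>1 - P\<close> on \<open>ran Q\<close> share the contribution \<open>c\<close> of these complements; the remaining contributions
  are the two dimensions in the definition of the index.\<close>

lemma projection_pair_index_identity:
  fixes P Q :: "'a::complex_hilbert \<Rightarrow> 'a"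
  assumes P: "orth_projection P" and Q: "orth_projection Q"
    and B: "onb B (range P)" and H: "onb H (kernel P)"
    and V: "onb V (kernel Q \<inter> range P)" and V': "onb V' (range Q \<inter> kernel P)"
  obtains c where "hs (\<lambda>x. x - Q x) B = hs (\<lambda>x. x) V + c" "hs Q H = hs (\<lambda>x. x) V' + c"
proof -
  note linP = orth_projectionD(1)[OF P] and linQ = orth_projectionD(1)[OF Q]
  have Pid: "P x = x" if "x \<in> range P" for x using that range_orth_projection[OF P] by simp
  have Qid: "Q x = x" if "x \<in> range Q" for x using that range_orth_projection[OF Q] by simp
  define T where "T = Q \<circ> P"
  have T: "bounded_clinear T" unfolding T_def by (intro bounded_clinear_compose linP linQ)
  have adjT: "adj T = P \<circ> Q"
    unfolding T_def adj_compose[OF linQ linP] orth_projectionD(7)[OF P] orth_projectionD(7)[OF Q] ..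
  note A = abs_op_facts[OF T]
  define W where "W = polar_part T"
  note W = polar_part[OF T, folded W_def]
  have linW: "bounded_clinear W" by (rule partial_isometry_linear[OF W(1)])
  have adjT_W: "adj T y = abs_op T (adj W y)" for y
  proof (rule cinner_right_unique)
    fix x
    show "cinner x (adj T y) = cinner x (abs_op T (adj W y))"
      by (simp add: cinner_adj_right[OF T] A(2)[symmetric] cinner_adj_right[OF linW] W(2)[of x])
  qed
  have adjW_0: "adj W y = 0" if "adj T y = 0" for y
  proof -
    have "adj W y \<in> kernel W"
      using that unfolding W(3) A(5)[symmetric] by (simp add: kernel_def adjT_W)
    then have "cinner (adj W y) (adj W y) = 0"
      using adj_mem_ortho_compl_kernel[OF linW, of y] by (simp add: ortho_compl_def)
    then show ?thesis by simp
  qed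
  have W_range: "W x \<in> range Q" for x
  proof -
    have "adj W (W x - Q (W x)) = 0"
      by (rule adjW_0) (simp add: adjT orth_projectionD(8)[OF Q] bounded_clinearD(4)[OF linP])
    then have "cinner (W x) (W x - Q (W x)) = 0"
      by (metis cinner_adj_right[OF linW] cinner_zero(2))
    moreover have "cinner (Q (W x)) (W x - Q (W x)) = 0"
      by (simp add: orth_projectionD(3,8)[OF Q])
    ultimately have "cinner (W x - Q (W x)) (W x - Q (W x)) = 0"
      by (simp only: cinner_diff_left[of "W x"] diff_zero)
    then have "W x = Q (W x)" unfolding cinner_self_eq_0 by simp
    then show ?thesis by (rule range_eqI)
  qed
  obtain B' where B': "V \<subseteq> B'" "onb B' (range P)"
    using extend_to_onb[OF onbD(1,2)[OF B] onbD(3)[OF V]] onbD(4)[OF V] by blast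
  define B2 where "B2 = B' - V"
  have B'_eq: "B' = V \<union> B2" "V \<inter> B2 = {}" using B'(1) by (auto simp: B2_def)
  have B2_P: "P b = b" if "b \<in> B2" for b
    using that onbD(4)[OF B'(2)] by (intro Pid) (auto simp: B2_def)
  have onB2: "orthonormal B2"
    by (rule orthonormal_subset[OF onbD(3)[OF B'(2)]]) (auto simp: B2_def)
  have B2_initial: "b \<in> ortho_compl (kernel W)" if b: "b \<in> B2" for b
  proof -
    have bV: "b \<in> ortho_compl (kernel Q \<inter> range P)"
      by (rule onb_orthogonal[OF V])
        (use b B'(1) orthonormalD(3)[OF onbD(3)[OF B'(2)]] in \<open>auto simp: B2_def\<close>)
    have "cinner b x = 0" if "x \<in> kernel T" for x
    proof -
      have "P x \<in> kernel Q \<inter> range P" using that by (auto simp: kernel_def T_def)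
      then have "cinner b (P x) = 0" using bV by (simp add: ortho_compl_def)
      then show ?thesis using B2_P[OF b] orth_projectionD(3)[OF P, of b x] by simp
    qed
    then show ?thesis unfolding W(3) by (simp add: ortho_compl_def)
  qed
  note Wb = partial_isometry_cinner[OF W(1) B2_initial]
  have inj: "inj_on W B2" by (intro inj_onI) (metis Wb(1))
  have onW: "orthonormal (W ` B2)"
    unfolding orthonormal_def using onB2 inj
    by (auto simp: Wb(2) orthonormal_def inj_on_eq_iff)
  have WV': "cinner w v = 0" if "w \<in> W ` B2" "v \<in> V'" for w v
  proof -
    have "v \<in> range Q \<inter> kernel P" by (rule subsetD[OF onbD(4)[OF V'] that(2)])
    then have "adj T v = 0" using Qid[of v] by (simp add: adjT kernel_def)
    then have "adj W v = 0" by (rule adjW_0)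
    then show ?thesis using that(1) by (auto simp flip: cinner_adj_right[OF linW])
  qed
  have C: "onb (W ` B2 \<union> V') (range Q)"
    unfolding onb_def
  proof (intro conjI ballI impI csubspace_range_projection closed_range_projection Q)
    show "orthonormal (W ` B2 \<union> V')" by (rule orthonormal_Un[OF onW onbD(3)[OF V'] WV'])
    show "W ` B2 \<union> V' \<subseteq> range Q" using W_range onbD(4)[OF V'] by blast
    fix y assume y: "y \<in> range Q" and orth: "\<forall>c\<in>W ` B2 \<union> V'. cinner y c = 0"
    have init: "cinner (adj W y) x = 0" if "x \<in> kernel T" for x
      using adj_mem_ortho_compl_kernel[OF linW, of y] that W(3) by (simp add: ortho_compl_def)
    have "adj W y = 0"
    proof (rule onbD(5)[OF B'(2)])
      have "adj W y \<in> ortho_compl (kernel P)"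
        unfolding ortho_compl_def
        by (auto intro!: init simp: kernel_def T_def bounded_clinearD(4)[OF linQ])
      then show "adj W y \<in> range P" by (simp add: ortho_compl_kernel_projection[OF P])
      fix b assume "b \<in> B'"
      then consider "b \<in> V" | "b \<in> B2" using B'_eq by blast
      then show "cinner (adj W y) b = 0"
      proof cases
        case 1
        then have "b \<in> kernel Q \<inter> range P" by (rule subsetD[OF onbD(4)[OF V]])
        then show ?thesis using Pid[of b] by (intro init) (simp add: kernel_def T_def)
      next
        case 2
        then show ?thesis using orth by (simp add: cinner_adj_left[OF linW])
      qed
    qed
    then have "adj T y = 0" using adjT_W[of y] bounded_clinearD(4)[OF A(1)] by simp
    then have "P y = 0" using Qid[OF y] by (simp add: adjT)
    with y have "y \<in> range Q \<inter> kernel P" by (intro IntI) (simp_all add: kernel_def)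
    then show "y = 0" by (rule onbD(5)[OF V']) (use orth in auto)
  qed
  define c where "c = hs (\<lambda>x. x - Q x) B2"
  have norms: "norm (W b - P (W b)) = norm (b - Q b)" if b: "b \<in> B2" for b
  proof -
    have "P (W b) = adj T (W b)" by (simp only: adjT comp_apply Qid[OF W_range])
    also have "\<dots> = abs_op T b" by (simp add: adjT_W Wb(1)[OF b])
    also have "norm \<dots> = norm (T b)" by (rule A(4))
    also have "T b = Q b" by (simp add: T_def B2_P[OF b])
    finally have "norm (P (W b)) = norm (Q b)" .
    then have "(norm (W b - P (W b)))\<^sup>2 = (norm (b - Q b))\<^sup>2"
      by (simp add: orth_projectionD(5)[OF P] orth_projectionD(5)[OF Q] Wb(3)[OF b])
    then show ?thesis by simp
  qed
  show thesis
  proof (rule that[of c])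
    have "hs (\<lambda>x. x - Q x) B = hs (\<lambda>x. x - Q x) (V \<union> B2)"
      unfolding B'_eq(1)[symmetric]
      by (intro hs_independent_of_basis[OF _ B B'(2)] bounded_clinear_diff bounded_clinear_ident linQ)
    also have "\<dots> = hs (\<lambda>x. x - Q x) V + c" unfolding c_def by (rule hs_Un[OF B'_eq(2)])
    also have "hs (\<lambda>x. x - Q x) V = hs (\<lambda>x. x) V"
      using onbD(4)[OF V] by (intro hs_cong) (auto simp: kernel_def)
    finally show "hs (\<lambda>x. x - Q x) B = hs (\<lambda>x. x) V + c" .
    have adj_id: "adj (\<lambda>x::'a. x) = (\<lambda>x. x)" by (rule adj_eqI[OF bounded_clinear_ident]) simp
    have "hs Q H = hs (\<lambda>y. y - P y) (W ` B2 \<union> V')"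
      using hs_adj[OF bounded_clinear_ident orth_projection_complement[OF P] _ Q C, of H] H
      unfolding adj_id kernel_orth_projection[OF P, symmetric] by simp
    also have "\<dots> = hs (\<lambda>y. y - P y) (W ` B2) + hs (\<lambda>y. y - P y) V'"
      by (rule hs_Un[OF orthonormal_Un(2)[OF onW onbD(3)[OF V'] WV']])
    also have "hs (\<lambda>y. y - P y) (W ` B2) = c"
      unfolding hs_image[OF inj] c_def by (rule hs_cong[OF norms])
    also have "hs (\<lambda>y. y - P y) V' = hs (\<lambda>x. x) V'"
      using onbD(4)[OF V'] by (intro hs_cong) (auto simp: kernel_def)
    finally show "hs Q H = hs (\<lambda>x. x) V' + c" by (simp add: add.commute)
  qed
qed

text \<open>The finite sums make the two spaces finite-dimensional, which is needed to compute with
  \<^const>\<open>cdim\<close>, as this is \<open>0\<close> on infinite-dimensional spaces.\<close>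

lemma pair_index_hs:
  fixes P Q :: "'a::complex_hilbert \<Rightarrow> 'a"
  assumes P: "orth_projection P" and Q: "orth_projection Q"
    and B: "onb B (range P)" and H: "onb H (kernel P)"
    and fin: "hs (\<lambda>x. x - Q x) B < top" "hs Q H < top"
    and idx: "pair_index P Q = int k"
  obtains V where "onb V (kernel Q \<inter> range P)" "finite V" "k \<le> card V"
    "hs (\<lambda>x. x - Q x) B = of_nat k + hs Q H"
proof -
  have V: "csubspace (kernel Q \<inter> range P)" "closed (kernel Q \<inter> range P)"
    and V': "csubspace (range Q \<inter> kernel P)" "closed (range Q \<inter> kernel P)"
    using P Q by (auto intro!: complex_vector.subspace_inter closed_Int csubspace_kernel
        closed_kernel csubspace_range_projection closed_range_projection orth_projectionD(1))
  obtain V where V: "onb V (kernel Q \<inter> range P)" using onb_exists[OF V] by blast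
  obtain V' where V': "onb V' (range Q \<inter> kernel P)" using onb_exists[OF V'] by blast
  obtain c where c: "hs (\<lambda>x. x - Q x) B = hs (\<lambda>x. x) V + c" "hs Q H = hs (\<lambda>x. x) V' + c"
    using projection_pair_index_identity[OF P Q B H V V'] by metis
  note hsV = hs_unit[of V "\<lambda>x. x", OF orthonormalD(2)[OF onbD(3)[OF V]]]
  note hsV' = hs_unit[of V' "\<lambda>x. x", OF orthonormalD(2)[OF onbD(3)[OF V']]]
  have finV: "finite V" using fin(1) unfolding c(1) by (simp add: hsV(1)[symmetric])
  have finV': "finite V'" using fin(2) unfolding c(2) by (simp add: hsV'(1)[symmetric])
  have "int (card V) - int (card V') = int k"
    using idx unfolding pair_index_def finite_onb_dim(2)[OF V finV] finite_onb_dim(2)[OF V' finV'] .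
  then have card: "card V = k + card V'" by linarith
  show thesis
  proof (rule that[OF V finV])
    show "k \<le> card V" by (simp add: card)
    show "hs (\<lambda>x. x - Q x) B = of_nat k + hs Q H"
      unfolding c by (simp add: hsV(2) hsV'(2) finV finV' card add.assoc)
  qed
qed


section \<open>Synthesis operators\<close>

lemma coord_eq_cinner: "coord x i = cinner x (std_basis i)"
proof -
  have "(\<lambda>j. coord x j * cnj (coord (std_basis i) j)) sums (\<Sum>j\<in>{i}. coord x j * cnj (coord (std_basis i) j))"
    by (rule sums_finite) (auto simp: coord_std_basis)
  then show ?thesis by (simp add: cinner_ell2_def sums_iff coord_std_basis)
qed

lemma inj_std_basis: "inj std_basis"
proof
  fix i j assume "std_basis i = std_basis j"
  then have "coord (std_basis i) j = coord (std_basis j) j" by simp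
  then show "i = j" by (simp add: coord_std_basis split: if_splits)
qed

lemma onb_std_basis: "onb (range std_basis) UNIV"
  unfolding onb_def
proof (intro conjI ballI impI)
  have "cinner (std_basis i) (std_basis j) = (if std_basis i = std_basis j then 1 else 0)" for i j
    unfolding coord_eq_cinner[symmetric] coord_std_basis inj_eq[OF inj_std_basis] by auto
  then show "orthonormal (range std_basis)" unfolding orthonormal_def by blast
  show "x = 0" if "\<forall>b\<in>range std_basis. cinner x b = 0" for x
    by (rule ell2_eqI) (use that in \<open>simp add: coord_eq_cinner\<close>)
qed (simp_all add: complex_vector.subspace_UNIV)

abbreviation std_hs :: "(ell2 \<Rightarrow> 'h::complex_hilbert) \<Rightarrow> ennreal" where
  "std_hs T \<equiv> hs T (range std_basis)"

lemma std_hs_eq: "std_hs T = (\<Sum>i. ennreal ((norm (T (std_basis i)))\<^sup>2))"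
  unfolding hs_image[OF inj_std_basis] unfolding hs_def by (rule nn_integral_count_space_nat)

lemma std_hs_summable:
  "std_hs T < top \<longleftrightarrow> summable (\<lambda>i. (norm (T (std_basis i)))\<^sup>2)"
  "summable (\<lambda>i. (norm (T (std_basis i)))\<^sup>2) \<Longrightarrow>
    std_hs T = ennreal (\<Sum>i. (norm (T (std_basis i)))\<^sup>2)"
proof -
  show *: "std_hs T = ennreal (\<Sum>i. (norm (T (std_basis i)))\<^sup>2)"
    if "summable (\<lambda>i. (norm (T (std_basis i)))\<^sup>2)"
    unfolding std_hs_eq using that by (intro suminf_ennreal2) auto
  show "std_hs T < top \<longleftrightarrow> summable (\<lambda>i. (norm (T (std_basis i)))\<^sup>2)"
  proof
    assume "std_hs T < top"
    then show "summable (\<lambda>i. (norm (T (std_basis i)))\<^sup>2)"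
      unfolding std_hs_eq by (intro summable_suminf_not_top) auto
  next
    assume "summable (\<lambda>i. (norm (T (std_basis i)))\<^sup>2)"
    from *[OF this] show "std_hs T < top" by simp
  qed
qed

lemma coord_adj: "bounded_clinear T \<Longrightarrow> coord (adj T y) i = cinner y (T (std_basis i))"
  by (simp add: coord_eq_cinner cinner_adj_left)

lemma ell2_operator_eqI:
  assumes "bounded_clinear S" "bounded_clinear T" "\<And>i. S (std_basis i) = T (std_basis i)"
  shows "S = T"
proof -
  have "adj S = adj T" by (intro ext ell2_eqI) (simp add: coord_adj assms)
  then show ?thesis using assms(1,2) by (metis adj_adj)
qed

lemma synthesis_eqI:
  assumes T: "bounded_clinear T" "\<And>i. T (std_basis i) = f i"
  shows "synthesis f = T"
  unfolding synthesis_def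
proof (rule the_equality)
  show "S = T" if "bounded_clinear S \<and> (\<forall>i. S (std_basis i) = f i)" for S
    using that T by (intro ell2_operator_eqI) auto
qed (use T in simp)

text \<open>The synthesis operator is obtained as the adjoint of the analysis operator
  \<open>y \<mapsto> (\<langle>y, f\<^sub>i\<rangle>)\<^sub>i\<close>.\<close>

lemma bessel_synthesis:
  fixes f :: "nat \<Rightarrow> 'h::complex_hilbert"
  assumes K: "csubspace K" "closed K" and f: "\<And>i. f i \<in> K"
    and bessel: "\<And>x. x \<in> K \<Longrightarrow> summable (\<lambda>i. (cmod (cinner x (f i)))\<^sup>2) \<and>
      (\<Sum>i. (cmod (cinner x (f i)))\<^sup>2) \<le> b * (norm x)\<^sup>2"
  shows "bounded_clinear (synthesis f)" "synthesis f (std_basis i) = f i"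
proof -
  define E where "E = projection_onto K"
  note E = projection_onto[OF K, folded E_def]
  have Ef: "cinner (E x) (f i) = cinner x (f i)" for x i
    using f[of i] range_orth_projection[OF E(1)] E(2) by (simp add: orth_projectionD(3)[OF E(1)])
  have ExK: "E x \<in> K" for x using E(2) by blast
  have sum: "summable (\<lambda>i. (cmod (cinner x (f i)))\<^sup>2)" for x
    using bessel[OF ExK[of x]] by (simp add: Ef)
  define \<theta> where "\<theta> x = Abs_ell2 (\<lambda>i. cinner x (f i))" for x
  have \<theta>: "coord (\<theta> x) i = cinner x (f i)" for x i
    by (simp add: \<theta>_def coord_Abs sum)
  have lin: "bounded_clinear \<theta>"
  proof (rule bounded_clinearI)
    show "\<theta> (x + y) = \<theta> x + \<theta> y" for x y by (rule ell2_eqI) (simp add: \<theta> cinner_algebra)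
    show "\<theta> (a *\<^sub>C x) = a *\<^sub>C \<theta> x" for a x by (rule ell2_eqI) (simp add: \<theta> cinner_algebra)
    fix x
    have "(norm (\<theta> x))\<^sup>2 \<le> b * (norm (E x))\<^sup>2"
      using bessel[OF ExK[of x]] by (simp add: norm_ell2_power2 \<theta> Ef)
    also have "\<dots> \<le> (sqrt \<bar>b\<bar> * norm x)\<^sup>2"
      unfolding power_mult_distrib using orth_projectionD(6)[OF E(1), of x]
      by (intro mult_mono power_mono) auto
    finally show "norm (\<theta> x) \<le> sqrt \<bar>b\<bar> * norm x" by (rule power2_le_imp_le) simp
  qed
  have "adj \<theta> (std_basis i) = f i" for i
    by (rule cinner_right_unique) (simp add: cinner_adj_right[OF lin] coord_eq_cinner[symmetric] \<theta>)
  then have "synthesis f = adj \<theta>" by (intro synthesis_eqI bounded_clinear_adj lin)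
  then show "bounded_clinear (synthesis f)" "synthesis f (std_basis i) = f i"
    using bounded_clinear_adj[OF lin] \<open>\<And>i. adj \<theta> (std_basis i) = f i\<close> by simp_all
qed

text \<open>The last claim is the lower frame bound at \<open>y = F x\<close>, because \<open>\<parallel>F\<^sup>* y\<parallel>\<^sup>2 = \<Sum>\<^sub>i |\<langle>y, f\<^sub>i\<rangle>|\<^sup>2\<close>.\<close>

lemma frame_synthesis:
  assumes f: "frame_in K f"
  shows "bounded_clinear (synthesis f)" "synthesis f (std_basis i) = f i"
    "\<exists>A>0. \<forall>x. A * (norm (synthesis f x))\<^sup>2 \<le> (norm (adj (synthesis f) (synthesis f x)))\<^sup>2"
proof -
  obtain A b where A: "A > 0" and K: "csubspace K" "closed K" "\<And>i. f i \<in> K"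
    and bd: "\<And>x. x \<in> K \<Longrightarrow> summable (\<lambda>i. (cmod (cinner x (f i)))\<^sup>2) \<and>
        A * (norm x)\<^sup>2 \<le> (\<Sum>i. (cmod (cinner x (f i)))\<^sup>2) \<and>
        (\<Sum>i. (cmod (cinner x (f i)))\<^sup>2) \<le> b * (norm x)\<^sup>2"
    using f unfolding frame_in_def by metis
  have bessel: "summable (\<lambda>i. (cmod (cinner x (f i)))\<^sup>2) \<and>
      (\<Sum>i. (cmod (cinner x (f i)))\<^sup>2) \<le> b * (norm x)\<^sup>2" if "x \<in> K" for x
    using bd[OF that] by (elim conjE, intro conjI)
  note F = bessel_synthesis[OF K bessel]
  show "bounded_clinear (synthesis f)" by (rule F(1))
  show "synthesis f (std_basis i) = f i" by (rule F(2))
  have "synthesis f x \<in> K" for x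
  proof -
    have "cinner (synthesis f x) y = 0" if "y \<in> ortho_compl K" for y
    proof -
      have "adj (synthesis f) y = 0"
        by (rule ell2_eqI) (use that K(3) in \<open>simp add: coord_adj F ortho_compl_def\<close>)
      then show ?thesis using cinner_adj_right[OF F(1), of x y] by simp
    qed
    then have "synthesis f x \<in> ortho_compl (ortho_compl K)" by (simp add: ortho_compl_def)
    then show ?thesis by (simp add: double_ortho_compl K)
  qed
  moreover have "(norm (adj (synthesis f) y))\<^sup>2 = (\<Sum>i. (cmod (cinner y (f i)))\<^sup>2)" for y
    by (simp add: norm_ell2_power2 coord_adj F)
  ultimately show "\<exists>A>0. \<forall>x. A * (norm (synthesis f x))\<^sup>2 \<le> (norm (adj (synthesis f) (synthesis f x)))\<^sup>2"
    using A bd by (intro exI[of _ A]) auto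
qed

text \<open>Parseval's identity on \<open>M\<close> says that the quadratic form of \<open>X X\<^sup>*\<close> is that of the projection onto
  \<open>M\<close>; so \<open>X\<^sup>*\<close>, and with it \<open>X\<close>, is a partial isometry.\<close>

lemma parseval_synthesis:
  assumes x: "parseval_frame_in M x"
  shows "partial_isometry (synthesis x)" "synthesis x (std_basis i) = x i"
proof -
  have M: "csubspace M" "closed M" "\<And>i. x i \<in> M"
    and pars: "\<And>y. y \<in> M \<Longrightarrow> (\<lambda>i. (cmod (cinner y (x i)))\<^sup>2) sums (norm y)\<^sup>2"
    using x by (auto simp: parseval_frame_in_def)
  have bessel: "summable (\<lambda>i. (cmod (cinner y (x i)))\<^sup>2) \<and>
      (\<Sum>i. (cmod (cinner y (x i)))\<^sup>2) \<le> 1 * (norm y)\<^sup>2" if "y \<in> M" for y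
    using pars[OF that] by (simp add: sums_iff)
  note X = bessel_synthesis[OF M bessel]
  show "synthesis x (std_basis i) = x i" by (rule X(2))
  define E where "E = projection_onto M"
  note E = projection_onto[OF M(1,2), folded E_def]
  have EyM: "E y \<in> M" for y using E(2) by blast
  have adj_E: "adj (synthesis x) y = adj (synthesis x) (E y)" for y
  proof (rule ell2_eqI)
    fix i
    have "E (x i) = x i" using M(3)[of i] range_orth_projection[OF E(1)] E(2) by simp
    then show "coord (adj (synthesis x) y) i = coord (adj (synthesis x) (E y)) i"
      by (simp add: coord_adj X orth_projectionD(3)[OF E(1)])
  qed
  have norm_adj: "(norm (adj (synthesis x) y))\<^sup>2 = (norm (E y))\<^sup>2" for y
    unfolding adj_E[of y] using pars[OF EyM[of y]] by (simp add: norm_ell2_power2 coord_adj X sums_iff)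
  have linA: "bounded_clinear (adj (synthesis x))" by (rule bounded_clinear_adj[OF X(1)])
  have "adj (adj (synthesis x)) \<circ> adj (synthesis x) = E"
  proof (rule clinear_eqI_quadratic_form)
    fix y
    show "cinner ((adj (adj (synthesis x)) \<circ> adj (synthesis x)) y) y = cinner (E y) y"
      by (simp add: cinner_adj_self[OF linA] orth_projectionD(4)[OF E(1)] norm_adj del: of_real_power)
  next
    show "bounded_clinear E" by (rule orth_projectionD(1)[OF E(1)])
  qed (intro bounded_clinear_compose bounded_clinear_adj X)
  then have "partial_isometry (adj (synthesis x))" using E(1) by (intro partial_isometryI linA) simp
  then show "partial_isometry (synthesis x)" using adj_partial_isometry adj_adj[OF X(1)] by metis
qed

lemma partial_isometry_parseval:
  assumes X: "partial_isometry X"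
  shows "parseval_frame_in (range X) (\<lambda>i. X (std_basis i))"
  unfolding parseval_frame_in_def
proof (intro conjI ballI allI rangeI)
  note lin = partial_isometry_linear[OF X]
  note fin = orth_projection_final[OF X]
  have r: "range X = range (X \<circ> adj X)"
  proof
    show "range X \<subseteq> range (X \<circ> adj X)"
    proof
      fix y assume "y \<in> range X"
      then obtain x where "y = X x" by blast
      then have "y = (X \<circ> adj X) (X x)" by (simp add: partial_isometry_initial(4)[OF X])
      then show "y \<in> range (X \<circ> adj X)" by (rule range_eqI)
    qed
  qed auto
  show "csubspace (range X)" by (rule csubspace_range[OF lin])
  show "closed (range X)" unfolding r by (rule closed_range_projection[OF fin])
  fix y assume "y \<in> range X"
  then have "X (adj X y) = y" unfolding r range_orth_projection[OF fin] by simp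
  then have "norm (adj X y) = norm y"
    using partial_isometry_initial(5)[OF adj_partial_isometry[OF X], of y] adj_adj[OF lin] by simp
  moreover have "(\<lambda>i. (cmod (coord (adj X y) i))\<^sup>2) sums (norm (adj X y))\<^sup>2"
    unfolding norm_ell2_power2 by (rule summable_sums[OF coord_summable])
  ultimately show "(\<lambda>i. (cmod (cinner y (X (std_basis i))))\<^sup>2) sums (norm y)\<^sup>2"
    by (simp add: coord_adj[OF lin])
qed

text \<open>Quadratically close Parseval frames are the partial isometries at finite Hilbert--Schmidt distance
  from \<open>F\<close>.\<close>

lemma close_parseval_frames_iff:
  assumes F: "\<And>i. F (std_basis i) = f i"
  shows "x \<in> close_parseval_frames f \<longleftrightarrow>
    (\<exists>X. partial_isometry X \<and> synthesis x = X \<and> x = (\<lambda>i. X (std_basis i)) \<and>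
      std_hs (\<lambda>v. F v - X v) < top)"
proof
  assume "x \<in> close_parseval_frames f"
  then obtain M where "parseval_frame_in M x" and cl: "quadratically_close f x"
    by (auto simp: close_parseval_frames_def)
  note X = parseval_synthesis[OF this(1)]
  show "\<exists>X. partial_isometry X \<and> synthesis x = X \<and> x = (\<lambda>i. X (std_basis i)) \<and>
      std_hs (\<lambda>v. F v - X v) < top"
    using X cl by (intro exI[of _ "synthesis x"])
      (auto simp: std_hs_summable(1) quadratically_close_def F)
next
  assume "\<exists>X. partial_isometry X \<and> synthesis x = X \<and> x = (\<lambda>i. X (std_basis i)) \<and>
      std_hs (\<lambda>v. F v - X v) < top"
  then obtain X where X: "partial_isometry X" "x = (\<lambda>i. X (std_basis i))"
    "std_hs (\<lambda>v. F v - X v) < top" by blast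
  then show "x \<in> close_parseval_frames f"
    using partial_isometry_parseval[OF X(1)]
    by (auto simp: close_parseval_frames_def std_hs_summable(1) quadratically_close_def F)
qed


section \<open>Weighted sums over the smallest weights\<close>

text \<open>Subtracting the least weight \<open>m\<close> from all weights removes one element of \<open>S\<close>; the constant
  part \<open>m\<close> is controlled by the bound on the total mass.\<close>

lemma sum_smallest_le_weighted_sum:
  fixes s w :: "'i \<Rightarrow> real"
  assumes "finite S" "S \<subseteq> I" "\<And>i. i \<in> I \<Longrightarrow> 0 \<le> s i" "\<And>i. i \<in> I \<Longrightarrow> 0 \<le> w i"
    "\<And>i j. i \<in> S \<Longrightarrow> j \<in> I - S \<Longrightarrow> s i \<le> s j"
    "\<And>J. J \<subseteq> S \<Longrightarrow>
      of_nat (card S) \<le> (\<integral>\<^sup>+i. ennreal (w i) \<partial>count_space (I - J)) + of_nat (card J)"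
  shows "ennreal (\<Sum>i\<in>S. s i) \<le> (\<integral>\<^sup>+i. ennreal (s i * w i) \<partial>count_space I)"
  using assms
proof (induction "card S" arbitrary: S I s)
  case 0
  then show ?case by simp
next
  case (Suc n)
  note fin = Suc.prems(1) and SI = Suc.prems(2) and s0 = Suc.prems(3) and w0 = Suc.prems(4)
    and low = Suc.prems(5) and mass = Suc.prems(6)
  have "S \<noteq> {}" using Suc.hyps(2) by auto
  define m where "m = Min (s ` S)"
  obtain i0 where i0: "i0 \<in> S" "s i0 = m"
  proof -
    have "m \<in> s ` S" unfolding m_def using fin \<open>S \<noteq> {}\<close> by (intro Min_in) auto
    then show ?thesis using that by blast
  qed
  have m_le_S: "m \<le> s i" if "i \<in> S" for i using that fin by (simp add: m_def)
  have m_le: "m \<le> s i" if "i \<in> I" for i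
  proof (cases "i \<in> S")
    case False
    then show ?thesis using low[OF i0(1), of i] that by (simp add: i0(2))
  qed (rule m_le_S)
  have m0: "0 \<le> m" using s0[OF subsetD[OF SI i0(1)]] by (simp add: i0(2))
  define S' where "S' = S - {i0}"
  define I' where "I' = I - {i0}"
  define s' where "s' i = s i - m" for i
  have cardS: "card S = Suc (card S')" using card_Suc_Diff1[OF fin i0(1)] by (simp add: S'_def)
  have "ennreal (\<Sum>i\<in>S'. s' i) \<le> (\<integral>\<^sup>+i. ennreal (s' i * w i) \<partial>count_space I')"
  proof (rule Suc.hyps(1))
    show "n = card S'" using Suc.hyps(2) cardS by simp
    show "s' i \<le> s' j" if "i \<in> S'" "j \<in> I' - S'" for i j
      using that low by (auto simp: s'_def S'_def I'_def)
    fix J assume J: "J \<subseteq> S'"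
    have fJ: "finite J" and i0J: "i0 \<notin> J"
      using J fin finite_subset by (auto simp: S'_def)
    have "of_nat (card S) \<le> (\<integral>\<^sup>+i. ennreal (w i) \<partial>count_space (I - insert i0 J)) +
        of_nat (card (insert i0 J))"
      by (rule mass) (use J i0 in \<open>auto simp: S'_def\<close>)
    moreover have "I - insert i0 J = I' - J" by (auto simp: I'_def)
    ultimately have "1 + of_nat (card S') \<le> 1 +
        ((\<integral>\<^sup>+i. ennreal (w i) \<partial>count_space (I' - J)) + of_nat (card J))"
      using fJ i0J by (simp add: cardS add_ac)
    then show "of_nat (card S') \<le> (\<integral>\<^sup>+i. ennreal (w i) \<partial>count_space (I' - J)) + of_nat (card J)"
      by (simp only: ennreal_add_left_cancel_le) simp
  qed (use fin SI w0 m_le in \<open>auto simp: S'_def I'_def s'_def\<close>)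
  also have "\<dots> \<le> (\<integral>\<^sup>+i. ennreal (s' i * w i) \<partial>count_space I)"
    by (rule nn_integral_count_space_mono_set) (auto simp: I'_def)
  finally have 1: "ennreal (\<Sum>i\<in>S'. s' i) \<le> (\<integral>\<^sup>+i. ennreal (s' i * w i) \<partial>count_space I)" .
  have 2: "ennreal (m * card S) \<le> ennreal m * (\<integral>\<^sup>+i. ennreal (w i) \<partial>count_space I)"
    using mult_left_mono[OF mass[of "{}"], of "ennreal m"] m0
    by (simp add: ennreal_mult ennreal_of_nat_eq_real_of_nat)
  have "(\<Sum>i\<in>S. s i) = (\<Sum>i\<in>S. s' i) + m * card S" by (simp add: s'_def sum_subtractf)
  also have "(\<Sum>i\<in>S. s' i) = (\<Sum>i\<in>S'. s' i)"
    using i0(2) by (simp add: S'_def sum.remove[OF fin i0(1)] s'_def)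
  finally have "ennreal (\<Sum>i\<in>S. s i) = ennreal (\<Sum>i\<in>S'. s' i) + ennreal (m * card S)"
    using m0 m_le_S by (auto simp: S'_def s'_def intro!: ennreal_plus sum_nonneg)
  also have "\<dots> \<le> (\<integral>\<^sup>+i. ennreal (s' i * w i) \<partial>count_space I) +
      ennreal m * (\<integral>\<^sup>+i. ennreal (w i) \<partial>count_space I)"
    by (intro add_mono 1 2)
  also have "\<dots> = (\<integral>\<^sup>+i. ennreal (s' i * w i) + ennreal m * ennreal (w i) \<partial>count_space I)"
    by (simp add: nn_integral_add nn_integral_cmult)
  also have "\<dots> = (\<integral>\<^sup>+i. ennreal (s i * w i) \<partial>count_space I)"
  proof (rule nn_integral_cong)
    fix i assume "i \<in> space (count_space I)"
    then have i: "i \<in> I" by simp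
    have "ennreal (s' i * w i) + ennreal m * ennreal (w i) = ennreal (s' i * w i + m * w i)"
      using m_le[OF i] w0[OF i] m0 by (simp add: s'_def ennreal_mult[symmetric] flip: ennreal_plus)
    then show "ennreal (s' i * w i) + ennreal m * ennreal (w i) = ennreal (s i * w i)"
      by (simp add: s'_def algebra_simps)
  qed
  finally show ?case .
qed

text \<open>With \<open>m\<close> the least weight, the bound for the weights \<open>s\<^sub>i - m\<close> leaves \<open>m \<Sum>\<^sub>i w\<^sub>i \<le> m card S\<close>.\<close>

lemma total_mass_eq_if_weighted_sum_minimal:
  fixes s w :: "'i \<Rightarrow> real"
  assumes S: "finite S" "S \<noteq> {}" "S \<subseteq> I"
    and s: "\<And>i. i \<in> I \<Longrightarrow> 0 < s i" and w: "\<And>i. i \<in> I \<Longrightarrow> 0 \<le> w i"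
    and low: "\<And>i j. i \<in> S \<Longrightarrow> j \<in> I - S \<Longrightarrow> s i \<le> s j"
    and mass: "\<And>J. J \<subseteq> S \<Longrightarrow>
      of_nat (card S) \<le> (\<integral>\<^sup>+i. ennreal (w i) \<partial>count_space (I - J)) + of_nat (card J)"
    and min: "(\<integral>\<^sup>+i. ennreal (s i * w i) \<partial>count_space I) \<le> ennreal (\<Sum>i\<in>S. s i)"
  shows "(\<integral>\<^sup>+i. ennreal (w i) \<partial>count_space I) = of_nat (card S)"
proof (rule antisym)
  define m where "m = Min (s ` S)"
  obtain i0 where i0: "i0 \<in> S" "s i0 = m"
  proof -
    have "m \<in> s ` S" unfolding m_def using S(1,2) by (intro Min_in) auto
    then show ?thesis using that by blast
  qed
  have m_le_S: "m \<le> s i" if "i \<in> S" for i using that S by (simp add: m_def)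
  have m_le: "m \<le> s i" if "i \<in> I" for i
  proof (cases "i \<in> S")
    case False
    then show ?thesis using low[OF i0(1), of i] that by (simp add: i0(2))
  qed (rule m_le_S)
  have m0: "0 < m" using s[OF subsetD[OF S(3) i0(1)]] by (simp add: i0(2))
  define W where "W = (\<integral>\<^sup>+i. ennreal (w i) \<partial>count_space I)"
  have "ennreal (\<Sum>i\<in>S. s i - m) + ennreal m * W \<le>
      (\<integral>\<^sup>+i. ennreal ((s i - m) * w i) \<partial>count_space I) + ennreal m * W"
    by (intro add_right_mono sum_smallest_le_weighted_sum S mass)
      (use m_le w low in auto)
  also have "\<dots> = (\<integral>\<^sup>+i. ennreal ((s i - m) * w i) + ennreal m * ennreal (w i) \<partial>count_space I)"
    unfolding W_def by (simp add: nn_integral_add nn_integral_cmult)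
  also have "\<dots> = (\<integral>\<^sup>+i. ennreal (s i * w i) \<partial>count_space I)"
  proof (rule nn_integral_cong)
    fix i assume "i \<in> space (count_space I)"
    then have i: "i \<in> I" by simp
    have "ennreal ((s i - m) * w i) + ennreal m * ennreal (w i) = ennreal ((s i - m) * w i + m * w i)"
      using m_le[OF i] w[OF i] m0 by (simp add: ennreal_mult[symmetric] flip: ennreal_plus)
    then show "ennreal ((s i - m) * w i) + ennreal m * ennreal (w i) = ennreal (s i * w i)"
      by (simp add: algebra_simps)
  qed
  also have "\<dots> \<le> ennreal (\<Sum>i\<in>S. s i)" by (rule min)
  also have "(\<Sum>i\<in>S. s i) = (\<Sum>i\<in>S. s i - m) + m * card S" by (simp add: sum_subtractf)
  also have "ennreal \<dots> = ennreal (\<Sum>i\<in>S. s i - m) + ennreal m * of_nat (card S)"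
    using m0 m_le_S by (simp add: ennreal_plus sum_nonneg ennreal_mult ennreal_of_nat_eq_real_of_nat)
  finally have "ennreal m * W \<le> ennreal m * of_nat (card S)"
    by (simp only: ennreal_add_left_cancel_le) simp
  then show "W \<le> of_nat (card S)"
    using m0 by (simp add: ennreal_mult_le_mult_iff)
  show "of_nat (card S) \<le> W" using mass[of "{}"] by (simp add: W_def)
qed


section \<open>Dimension and orthogonality\<close>

text \<open>The cardinality of an orthonormal set is the Hilbert--Schmidt sum of the identity over it.\<close>

lemma onb_card_le:
  assumes B: "onb B M" "finite B" and A: "orthonormal A" "A \<subseteq> M"
  shows "finite A" "card A \<le> card B"
proof -
  have le: "hs (\<lambda>x. x) A \<le> of_nat (card B)"
    using hs_orthonormal_le[OF bounded_clinear_ident B(1) A]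
      hs_unit(2)[of B "\<lambda>x. x", OF orthonormalD(2)[OF onbD(3)[OF B(1)]] B(2)] by simp
  then have "hs (\<lambda>x. x) A < top" using order_le_less_trans by (metis ennreal_of_nat_neq_top less_top)
  then show fin: "finite A"
    using hs_unit(1)[of A "\<lambda>x. x", OF orthonormalD(2)[OF A(1)]] by simp
  show "card A \<le> card B"
    using le hs_unit(2)[of A "\<lambda>x. x", OF orthonormalD(2)[OF A(1)] fin] by simp
qed

text \<open>For vectors of \<open>M\<close>, orthogonality to \<open>a\<close> is orthogonality to the projection \<open>p\<close> of \<open>a\<close> to \<open>M\<close>. So a
  basis of \<open>M \<inter> {a}\<^sup>\<bottom>\<close> becomes one of \<open>M\<close> by adding at most one vector.\<close>

lemma orthonormal_in_hyperplane:
  assumes M: "csubspace M" "closed M" and V: "finite V" "orthonormal V" "V \<subseteq> M"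
  shows "\<exists>C. finite C \<and> orthonormal C \<and> C \<subseteq> M \<inter> ortho_compl {a} \<and> card V \<le> Suc (card C)"
proof -
  have "csubspace (M \<inter> ortho_compl {a})" "closed (M \<inter> ortho_compl {a})"
    using M by (auto intro: complex_vector.subspace_inter csubspace_ortho_compl closed_ortho_compl)
  then obtain B where B: "onb B (M \<inter> ortho_compl {a})" using onb_exists by blast
  show ?thesis
  proof (cases "finite B")
    case False
    then obtain C where "C \<subseteq> B" "finite C" "card C = card V"
      using infinite_arbitrarily_large by blast
    then show ?thesis using onbD(3,4)[OF B] orthonormal_subset by (intro exI[of _ C]) auto
  next
    case True
    define E where "E = projection_onto M"
    note E = projection_onto[OF M, folded E_def]
    define p where "p = E a"
    have pM: "p \<in> M" using E(2) by (auto simp: p_def)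
    have xp: "cinner x p = cinner x a" if "x \<in> M" for x
    proof -
      have "E x = x" using that range_orth_projection[OF E(1)] E(2) by auto
      then show ?thesis using orth_projectionD(3)[OF E(1), of x a] by (simp add: p_def)
    qed
    define e where "e = inverse (norm p) *\<^sub>R p"
    define B' where "B' = (if p = 0 then {} else {e})"
    have eM: "e \<in> M" using pM M by (simp add: e_def csubspaceD)
    have "onb (B \<union> B') M"
      unfolding onb_def
    proof (intro conjI ballI impI M)
      have "orthonormal B'"
        by (auto simp: B'_def orthonormal_def e_def cinner_algebra cinner_self power2_eq_square)
      moreover have "cinner b e = 0" if "b \<in> B" for b
      proof -
        have b: "b \<in> M" "cinner b a = 0" using onbD(4)[OF B] that by (auto simp: ortho_compl_def)
        show ?thesis by (simp add: e_def cinner_scaleR_right xp[OF b(1)] b(2))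
      qed
      ultimately show "orthonormal (B \<union> B')"
        by (intro orthonormal_Un onbD(3)[OF B]) (auto simp: B'_def split: if_splits)
      show "B \<union> B' \<subseteq> M" using onbD(4)[OF B] eM by (auto simp: B'_def)
      fix x assume x: "x \<in> M" and orth: "\<forall>b\<in>B \<union> B'. cinner x b = 0"
      have "cinner x p = 0"
      proof (cases "p = 0")
        case False
        then have "cinner x e = 0" using orth by (simp add: B'_def)
        then show ?thesis using False by (simp add: e_def cinner_scaleR_right)
      qed simp
      then have "x \<in> M \<inter> ortho_compl {a}" using x xp by (simp add: ortho_compl_def)
      then show "x = 0" by (rule onbD(5)[OF B]) (use orth in blast)
    qed
    moreover have "finite (B \<union> B')" using True by (simp add: B'_def)
    ultimately have "card V \<le> card (B \<union> B')" using V(2,3) by (rule onb_card_le(2))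
    also have "\<dots> \<le> card B + card B'" by (rule card_Un_le)
    also have "\<dots> \<le> Suc (card B)" by (simp add: B'_def)
    finally show ?thesis using True onbD(3,4)[OF B] by blast
  qed
qed

lemma orthonormal_in_ortho_compl:
  assumes G: "finite G" and M: "csubspace M" "closed M"
    and V: "finite V" "orthonormal V" "V \<subseteq> M"
  shows "\<exists>C. finite C \<and> orthonormal C \<and> C \<subseteq> M \<inter> ortho_compl G \<and> card V \<le> card C + card G"
  using G
proof (induction G)
  case empty
  then show ?case using V by (intro exI[of _ V]) (auto simp: ortho_compl_def)
next
  case (insert a G)
  then obtain C where C: "finite C" "orthonormal C" "C \<subseteq> M \<inter> ortho_compl G"
    "card V \<le> card C + card G" by blast
  have "csubspace (M \<inter> ortho_compl G)" "closed (M \<inter> ortho_compl G)"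
    using M by (auto intro: complex_vector.subspace_inter csubspace_ortho_compl closed_ortho_compl)
  from orthonormal_in_hyperplane[OF this C(1-3), of a]
  obtain D where D: "finite D" "orthonormal D" "D \<subseteq> M \<inter> ortho_compl G \<inter> ortho_compl {a}"
    "card C \<le> Suc (card D)" by blast
  then have "D \<subseteq> M \<inter> ortho_compl (insert a G)" by (auto simp: ortho_compl_def)
  moreover have "card V \<le> card D + card (insert a G)" using C(4) D(4) insert.hyps by simp
  ultimately show ?case using D(1,2) by blast
qed

lemma onb_operator_eqI:
  assumes S: "bounded_clinear S" and T: "bounded_clinear T" and B: "onb B UNIV"
    and eq: "\<And>b. b \<in> B \<Longrightarrow> S b = T b"
  shows "S = T"
proof -
  have "adj S y - adj T y = 0" for y
    by (rule onbD(5)[OF B])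
      (simp_all add: cinner_diff_left cinner_adj_left[OF S] cinner_adj_left[OF T] eq)
  then have "adj S = adj T" by (auto simp: fun_eq_iff)
  then show ?thesis using S T by (metis adj_adj)
qed

lemma hs_compose_left_finite:
  fixes T :: "'a \<Rightarrow> 'b::complex_hilbert" and S :: "'b \<Rightarrow> 'c::complex_hilbert"
  assumes S: "bounded_clinear S" and fin: "hs T B < top"
  shows "hs (\<lambda>x. S (T x)) B < top"
proof -
  obtain c where c: "c > 0" "\<And>x. norm (S x) \<le> c * norm x" using bounded_clinear_bound[OF S] by metis
  have "hs (\<lambda>x. S (T x)) B \<le> hs (\<lambda>x. c *\<^sub>R T x) B" using c by (intro hs_mono) simp
  also have "\<dots> = ennreal (c\<^sup>2) * hs T B"
    unfolding hs_def by (simp add: power_mult_distrib ennreal_mult nn_integral_cmult)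
  also have "\<dots> < top" using fin by (simp add: ennreal_mult_less_top)
  finally show ?thesis .
qed

lemma has_rank_iff_onb:
  assumes "orth_projection E"
  shows "has_rank E k \<longleftrightarrow> (\<exists>V. onb V (range E) \<and> finite V \<and> card V = k)"
proof
  assume E: "has_rank E k"
  obtain V where V: "onb V (range E)"
    using onb_exists[OF csubspace_range_projection[OF assms] closed_range_projection[OF assms]] by blast
  have "finite V" using E finite_onb_iff[OF V] by (simp add: has_rank_def)
  then show "\<exists>V. onb V (range E) \<and> finite V \<and> card V = k"
    using E V finite_onb_dim(2)[OF V] by (auto simp: has_rank_def)
qed (auto simp: has_rank_def finite_onb_dim)

text \<open>In a basis of \<open>M\<close> that extends \<open>V\<close>, the projection \<open>E\<close> keeps \<open>V\<close> and annihilates the rest.\<close>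

lemma hs_projection:
  assumes E: "orth_projection E" and V: "onb V (range E)" "finite V"
    and B: "onb B M" and sub: "range E \<subseteq> M"
  shows "hs E B = of_nat (card V)"
proof -
  have "V \<subseteq> M" using onbD(4)[OF V(1)] sub by (rule order_trans)
  then obtain B' where B': "V \<subseteq> B'" "onb B' M"
    using extend_to_onb[OF onbD(1,2)[OF B] onbD(3)[OF V(1)]] by metis
  have V_fix: "E b = b" if "b \<in> V" for b
    using onbD(4)[OF V(1)] that range_orth_projection[OF E] by blast
  have "E b = 0" if b: "b \<in> B' - V" for b
  proof -
    have "b \<in> ortho_compl (range E)"
      by (rule onb_orthogonal[OF V(1)])
        (use b B'(1) orthonormalD(3)[OF onbD(3)[OF B'(2)]] in blast)
    then show ?thesis by (simp add: kernel_ortho_compl_range[OF E, symmetric] kernel_def)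
  qed
  then have 0: "hs E (B' - V) = 0" by (rule hs_eq_0)
  have "hs E V = of_nat (card V)"
    by (rule hs_unit(2)[OF _ V(2)]) (simp add: V_fix orthonormalD(2)[OF onbD(3)[OF V(1)]])
  moreover have "hs E B = hs E B'"
    by (rule hs_independent_of_basis[OF orth_projectionD(1)[OF E] B B'(2)])
  moreover have "hs E B' = hs E (V \<union> (B' - V))" using B'(1) by (simp add: Un_absorb1)
  moreover have "hs E (V \<union> (B' - V)) = hs E V + hs E (B' - V)" by (rule hs_Un) auto
  ultimately show ?thesis using 0 by simp
qed


section \<open>The cost of a partial isometry\<close>

text \<open>The frame only enters through its synthesis operator \<open>F\<close>: \<open>lower_bound\<close> is what remains of the
  lower frame bound, and \<open>close\<close> of the existence of a quadratically close Parseval frame. The family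
  \<open>g\<close> is an orthonormal basis of \<open>(ker F)\<^sup>\<bottom>\<close> that diagonalizes \<open>|F|\<close>.\<close>

locale singular_system =
  fixes F :: "ell2 \<Rightarrow> 'h::complex_hilbert" and I :: "nat set" and s :: "nat \<Rightarrow> real"
    and g :: "nat \<Rightarrow> ell2"
  assumes F: "bounded_clinear F"
    and lower_bound: "\<exists>A>0. \<forall>x. A * (norm (F x))\<^sup>2 \<le> (norm (adj F (F x)))\<^sup>2"
    and close: "\<exists>X. partial_isometry X \<and> std_hs (\<lambda>x. F x - X x) < top"
    and g_orthonormal: "\<And>i j. i \<in> I \<Longrightarrow> j \<in> I \<Longrightarrow> cinner (g i) (g j) = (if i = j then 1 else 0)"
    and g_total: "closure (cspan (g ` I)) = ortho_compl (kernel F)"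
    and s_pos: "\<And>i. i \<in> I \<Longrightarrow> 0 < s i"
    and eigen: "\<And>i. i \<in> I \<Longrightarrow> abs_op F (g i) = s i *\<^sub>R g i"
begin

abbreviation U where "U \<equiv> polar_part F"
abbreviation N where "N \<equiv> ortho_compl (kernel F)"
abbreviation isum :: "(nat \<Rightarrow> real) \<Rightarrow> ennreal" where
  "isum h \<equiv> \<integral>\<^sup>+i. ennreal (h i) \<partial>count_space I"

lemma eigenvector_in_N: "i \<in> I \<Longrightarrow> g i \<in> N"
  unfolding g_total[symmetric]
  by (intro subsetD[OF closure_subset] complex_vector.span_base imageI)

lemma inj_on_g: "inj_on g I"
  by (rule inj_onI) (metis g_orthonormal zero_neq_one)

lemma orthonormal_g: "A \<subseteq> I \<Longrightarrow> orthonormal (g ` A)"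
  unfolding orthonormal_def using inj_on_g
  by (auto simp: g_orthonormal subset_iff inj_on_eq_iff)

lemma onb_g: "onb (g ` I) N"
  unfolding onb_def
proof (intro conjI ballI impI csubspace_ortho_compl closed_ortho_compl)
  fix x assume x: "x \<in> N" and orth: "\<forall>b\<in>g ` I. cinner x b = 0"
  have "g ` I \<subseteq> ortho_compl {x}"
    using orth by (auto simp: ortho_compl_def cinner_zero_commute[of x])
  then have "closure (cspan (g ` I)) \<subseteq> ortho_compl {x}"
    by (intro closure_minimal complex_vector.span_minimal csubspace_ortho_compl closed_ortho_compl)
  then have "cinner x x = 0" using x unfolding g_total by (auto simp: ortho_compl_def)
  then show "x = 0" by simp
qed (use eigenvector_in_N orthonormal_g in auto)

lemmas polar = polar_part[OF F]
lemmas bounded_clinear_U = partial_isometry_linear[OF polar(1)]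

lemma kernel_U: "kernel U = kernel F" by (rule polar(3))

lemma polar_part_on_N:
  assumes "x \<in> N"
  shows "adj U (U x) = x" "cinner (U x) (U y) = cinner x y" "norm (U x) = norm x"
  using partial_isometry_cinner[OF polar(1), of x] assms by (simp_all add: kernel_U)

lemma initial_projection:
  "orth_projection (adj U \<circ> U)" "range (adj U \<circ> U) = N" "kernel (adj U \<circ> U) = kernel F"
  using partial_isometry_initial(1-3)[OF polar(1)] by (simp_all add: kernel_U)

lemma F_eigenvector: "i \<in> I \<Longrightarrow> F (g i) = s i *\<^sub>R U (g i)"
  using polar(2)[of "g i"] by (simp add: eigen bounded_clinearD[OF bounded_clinear_U])

lemma norm_g: "i \<in> I \<Longrightarrow> norm (g i) = 1"
  using orthonormalD(2)[OF orthonormal_g[OF subset_refl]] by blast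

lemma ortho_compl_N: "ortho_compl N = kernel F"
  by (intro double_ortho_compl csubspace_kernel closed_kernel F)

definition H where "H = (SOME H. onb H (kernel F))"

lemma onb_H: "onb H (kernel F)"
  unfolding H_def using onb_exists[OF csubspace_kernel[OF F] closed_kernel[OF F]]
  by (metis someI_ex)

lemma vanish_on_H: "h \<in> H \<Longrightarrow> F h = 0" "h \<in> H \<Longrightarrow> U h = 0"
  using onbD(4)[OF onb_H] kernel_U by (auto simp: kernel_def)

lemma onb_gH: "onb (g ` I \<union> H) UNIV" "g ` I \<inter> H = {}"
  using onb_Un[OF onb_g, of H] onb_H by (simp_all add: ortho_compl_N)

lemma hs_eigenvectors: "A \<subseteq> I \<Longrightarrow> hs T (g ` A) = (\<integral>\<^sup>+i. ennreal ((norm (T (g i)))\<^sup>2) \<partial>count_space A)"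
  unfolding hs_image[OF inj_on_subset[OF inj_on_g]] unfolding hs_def ..

lemma std_hs_split:
  fixes T :: "ell2 \<Rightarrow> 'k::complex_hilbert"
  assumes "bounded_clinear T"
  shows "std_hs T = hs T (g ` I) + hs T H"
  using hs_independent_of_basis[OF assms onb_std_basis onb_gH(1)] hs_Un[OF onb_gH(2)] by simp

text \<open>The defect of \<open>X\<close> at \<open>g\<^sub>i\<close>: it vanishes iff \<open>X g\<^sub>i = U g\<^sub>i\<close>, and the cost of \<open>X\<close> turns out to be affine in
  it (lemma \<open>cost\<close>).\<close>

definition w :: "(ell2 \<Rightarrow> 'h) \<Rightarrow> nat \<Rightarrow> real" where
  "w X i = 1 - Re (cinner (U (g i)) (X (g i)))"

lemma w_identities:
  assumes X: "partial_isometry X" and i: "i \<in> I"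
  shows "2 * w X i = (norm (U (g i) - X (g i)))\<^sup>2 + (norm (g i - adj X (X (g i))))\<^sup>2"
    "(norm (F (g i) - X (g i)))\<^sup>2 + (norm (g i - adj X (X (g i))))\<^sup>2 =
      (s i - 1)\<^sup>2 + 2 * (s i * w X i)"
proof -
  have d: "(norm (g i - adj X (X (g i))))\<^sup>2 = 1 - (norm (X (g i)))\<^sup>2"
    using orth_projectionD(5)[OF partial_isometry_initial(1)[OF X], of "g i"]
    by (simp add: norm_g[OF i] partial_isometry_initial(5)[OF X, symmetric])
  have nU: "norm (U (g i)) = 1" using polar_part_on_N(3)[OF eigenvector_in_N[OF i]] by (simp add: norm_g[OF i])
  show "2 * w X i = (norm (U (g i) - X (g i)))\<^sup>2 + (norm (g i - adj X (X (g i))))\<^sup>2"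
    unfolding d by (simp add: norm_diff_square nU w_def)
  show "(norm (F (g i) - X (g i)))\<^sup>2 + (norm (g i - adj X (X (g i))))\<^sup>2 =
      (s i - 1)\<^sup>2 + 2 * (s i * w X i)"
    unfolding d F_eigenvector[OF i] norm_diff_square[of "s i *\<^sub>R U (g i)"]
    by (simp add: nU w_def cinner_scaleR_left) (simp add: power2_eq_square algebra_simps)
qed

lemma w_nonneg: "partial_isometry X \<Longrightarrow> i \<in> I \<Longrightarrow> 0 \<le> w X i"
  using w_identities(1)[of X i] by (smt (verit) zero_le_power2)

lemma bounded_clinear_defect: "partial_isometry X \<Longrightarrow> bounded_clinear (\<lambda>x. x - adj X (X x))"
  using bounded_clinear_diff[OF bounded_clinear_ident
      bounded_clinear_compose[OF bounded_clinear_adj[OF partial_isometry_linear]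
        partial_isometry_linear], of X X] by (simp add: o_def)

lemma energy:
  assumes X: "partial_isometry X"
  shows "std_hs (\<lambda>x. F x - X x) + hs (\<lambda>x. x - adj X (X x)) (g ` I) =
    isum (\<lambda>i. (s i - 1)\<^sup>2) + 2 * isum (\<lambda>i. s i * w X i) + hs X H"
proof -
  note linX = partial_isometry_linear[OF X]
  have "std_hs (\<lambda>x. F x - X x) = hs (\<lambda>x. F x - X x) (g ` I) + hs X H"
    unfolding std_hs_split[OF bounded_clinear_diff[OF F linX]]
    by (intro arg_cong2[where f="(+)"] hs_cong) (simp_all add: vanish_on_H)
  moreover have "hs (\<lambda>x. F x - X x) (g ` I) + hs (\<lambda>x. x - adj X (X x)) (g ` I) =
      isum (\<lambda>i. (s i - 1)\<^sup>2) + 2 * isum (\<lambda>i. s i * w X i)"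
  proof -
    have "hs (\<lambda>x. F x - X x) (g ` I) + hs (\<lambda>x. x - adj X (X x)) (g ` I) =
        (\<integral>\<^sup>+i. ennreal ((norm (F (g i) - X (g i)))\<^sup>2) + ennreal ((norm (g i - adj X (X (g i))))\<^sup>2)
          \<partial>count_space I)"
      unfolding hs_eigenvectors[OF subset_refl] by (simp add: nn_integral_add)
    also have "\<dots> = (\<integral>\<^sup>+i. ennreal ((s i - 1)\<^sup>2) + 2 * ennreal (s i * w X i) \<partial>count_space I)"
    proof (rule nn_integral_cong)
      fix i assume "i \<in> space (count_space I)"
      then have i: "i \<in> I" by simp
      have "0 \<le> s i * w X i" using s_pos[OF i] w_nonneg[OF X i] by simp
      then have "ennreal ((s i - 1)\<^sup>2) + 2 * ennreal (s i * w X i) =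
          ennreal ((s i - 1)\<^sup>2 + 2 * (s i * w X i))"
        by (simp add: ennreal_mult)
      then show "ennreal ((norm (F (g i) - X (g i)))\<^sup>2) + ennreal ((norm (g i - adj X (X (g i))))\<^sup>2) =
          ennreal ((s i - 1)\<^sup>2) + 2 * ennreal (s i * w X i)"
        by (simp add: w_identities(2)[OF X i, symmetric])
    qed
    also have "\<dots> = isum (\<lambda>i. (s i - 1)\<^sup>2) + 2 * isum (\<lambda>i. s i * w X i)"
      by (simp add: nn_integral_add nn_integral_cmult)
    finally show ?thesis .
  qed
  ultimately show ?thesis by (simp add: add_ac)
qed

text \<open>If \<open>F - X\<close> is Hilbert--Schmidt, then so is \<open>T = F\<^sup>* F - X\<^sup>* X\<close>. As \<open>X\<^sup>* X\<close> is a projection \<open>Q\<close>,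
  \<open>T g\<^sub>i = s\<^sub>i\<^sup>2 g\<^sub>i - Q g\<^sub>i\<close> has a norm of at least a multiple of \<open>\<bar>s\<^sub>i - 1\<bar>\<close>, uniformly in \<open>i\<close> because the
  \<open>s\<^sub>i\<close> are bounded away from \<open>0\<close>.\<close>

lemma isum_singular_values_finite: "isum (\<lambda>i. (s i - 1)\<^sup>2) < top"
proof -
  obtain X where X: "partial_isometry X" and fin: "std_hs (\<lambda>x. F x - X x) < top"
    using close by blast
  obtain A where A: "A > 0" "\<And>x. A * (norm (F x))\<^sup>2 \<le> (norm (adj F (F x)))\<^sup>2"
    using lower_bound by blast
  note linX = partial_isometry_linear[OF X]
  note Q = partial_isometry_initial(1)[OF X]
  define D where "D = (\<lambda>x. F x - X x)"
  have D: "bounded_clinear D" unfolding D_def by (rule bounded_clinear_diff[OF F linX])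
  define T where "T x = adj F (D x) + adj D (X x)" for x
  have linT1: "bounded_clinear (\<lambda>x. adj F (D x))" and linT2: "bounded_clinear (adj D \<circ> X)"
    using bounded_clinear_compose[OF bounded_clinear_adj[OF F] D]
      bounded_clinear_compose[OF bounded_clinear_adj[OF D] linX] by (simp_all add: o_def)
  have finD: "std_hs D < top" using fin by (simp add: D_def)
  have 1: "std_hs (\<lambda>x. adj F (D x)) < top"
    by (rule hs_compose_left_finite[OF bounded_clinear_adj[OF F] finD])
  have 2: "std_hs (\<lambda>x. adj D (X x)) < top"
  proof -
    have "adj (adj D \<circ> X) = adj X \<circ> D"
      by (simp add: adj_compose[OF bounded_clinear_adj[OF D] linX] adj_adj[OF D])
    then have "std_hs (adj D \<circ> X) = std_hs (adj X \<circ> D)"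
      using hs_adj_UNIV[OF linT2 onb_std_basis onb_std_basis] by simp
    also have "\<dots> < top"
      using hs_compose_left_finite[OF bounded_clinear_adj[OF linX] finD] by (simp add: o_def)
    finally show ?thesis by (simp add: o_def)
  qed
  have "std_hs T < top" unfolding T_def by (rule hs_add_finite[OF 1 2])
  moreover have linT: "bounded_clinear T"
    unfolding T_def using bounded_clinear_add[OF linT1 linT2] by (simp add: o_def)
  ultimately have finT: "hs T (g ` I) < top" unfolding std_hs_split[OF linT] by simp
  have T: "T x = adj F (F x) - adj X (X x)" for x
    using fun_cong[OF adj_diff[OF F linX], of "X x"]
    by (simp add: T_def D_def bounded_clinearD[OF bounded_clinear_adj[OF F]])
  (* The square of the norm of T (g i) is affine in q = |Q g_i|^2, and c dominates both of its
     endpoint values, at q = 0 through s_i^2 >= A and at q = 1 through s_i + 1 >= 1. *)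
  define c where "c = 1 + 1 / A\<^sup>2 + 1 / A"
  have c: "c \<ge> 1" using A(1) by (simp add: c_def)
  have bound: "(s i - 1)\<^sup>2 \<le> c * (norm (T (g i)))\<^sup>2" if i: "i \<in> I" for i
  proof -
    have FF: "adj F (F (g i)) = (s i)\<^sup>2 *\<^sub>R g i"
      unfolding abs_op_facts(3)[OF F, symmetric]
      by (simp add: eigen[OF i] bounded_clinearD[OF abs_op_facts(1)[OF F]] power2_eq_square)
    have "norm (F (g i)) = s i"
      using abs_op_facts(4)[OF F, of "g i"] s_pos[OF i] by (simp add: eigen[OF i] norm_g[OF i])
    then have "A * (s i)\<^sup>2 \<le> (s i)\<^sup>2 * (s i)\<^sup>2"
      using A(2)[of "g i"] by (simp add: FF norm_g[OF i] power2_eq_square[of "_\<^sup>2"])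
    then have As: "A \<le> (s i)\<^sup>2" using s_pos[OF i] by (metis mult_right_le_imp_le zero_less_power)
    define q where "q = (norm (adj X (X (g i))))\<^sup>2"
    have q: "0 \<le> q" "q \<le> 1"
      using orth_projectionD(6)[OF Q, of "g i"] by (auto simp: q_def norm_g[OF i] power_le_one)
    have cq: "Re (cinner (g i) (adj X (X (g i)))) = q"
      using orth_projectionD(3,4)[OF Q, of "g i"] by (simp add: q_def flip: of_real_power)
    have Tg: "(norm (T (g i)))\<^sup>2 = (1 - q) * ((s i)\<^sup>2)\<^sup>2 + q * ((s i)\<^sup>2 - 1)\<^sup>2"
      unfolding T FF norm_diff_square
      by (simp add: cinner_scaleR_left norm_g[OF i] cq flip: q_def)
        (simp add: power2_eq_square power4_eq_xxxx algebra_simps)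
    have "(s i - 1)\<^sup>2 \<le> 1 + (s i)\<^sup>2" using s_pos[OF i] by (simp add: power2_diff)
    also have "\<dots> \<le> (1 / A\<^sup>2 + 1 / A) * ((s i)\<^sup>2)\<^sup>2"
    proof -
      have "1 \<le> (s i)\<^sup>2 / A" using As A(1) by simp
      then have "1 \<le> ((s i)\<^sup>2 / A)\<^sup>2" and "(s i)\<^sup>2 * 1 \<le> (s i)\<^sup>2 * ((s i)\<^sup>2 / A)"
        by (simp_all only: one_le_power mult_left_mono zero_le_power2)
      then show ?thesis by (simp add: power2_eq_square field_simps)
    qed
    also have "\<dots> \<le> c * ((s i)\<^sup>2)\<^sup>2" by (intro mult_right_mono) (auto simp: c_def)
    finally have low: "(s i - 1)\<^sup>2 \<le> c * ((s i)\<^sup>2)\<^sup>2" .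
    have "(s i - 1)\<^sup>2 * 1 \<le> (s i - 1)\<^sup>2 * (s i + 1)\<^sup>2"
      using s_pos[OF i] by (intro mult_left_mono) (auto simp: one_le_power)
    also have "\<dots> = ((s i)\<^sup>2 - 1)\<^sup>2" by (simp add: power2_eq_square algebra_simps)
    also have "\<dots> \<le> c * ((s i)\<^sup>2 - 1)\<^sup>2" using c by (simp add: mult_le_cancel_right1)
    finally have high: "(s i - 1)\<^sup>2 \<le> c * ((s i)\<^sup>2 - 1)\<^sup>2" by simp
    have "(s i - 1)\<^sup>2 = (1 - q) * (s i - 1)\<^sup>2 + q * (s i - 1)\<^sup>2" by (simp add: algebra_simps)
    also have "\<dots> \<le> (1 - q) * (c * ((s i)\<^sup>2)\<^sup>2) + q * (c * ((s i)\<^sup>2 - 1)\<^sup>2)"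
      using q by (intro add_mono mult_left_mono low high) auto
    finally show ?thesis unfolding Tg by (simp add: algebra_simps)
  qed
  have "isum (\<lambda>i. (s i - 1)\<^sup>2) \<le> (\<integral>\<^sup>+i. ennreal c * ennreal ((norm (T (g i)))\<^sup>2) \<partial>count_space I)"
    using bound c by (intro nn_integral_mono) (auto simp: ennreal_mult[symmetric] intro!: ennreal_leI)
  also have "\<dots> = ennreal c * hs T (g ` I)"
    by (simp add: hs_eigenvectors[OF subset_refl] nn_integral_cmult)
  also have "\<dots> < top" using finT by (simp add: ennreal_mult_less_top)
  finally show ?thesis .
qed

lemma hs_F_minus_polar_part: "std_hs (\<lambda>x. F x - U x) = isum (\<lambda>i. (s i - 1)\<^sup>2)"
proof -
  have "hs (\<lambda>x. F x - U x) H = 0" by (rule hs_eq_0) (simp add: vanish_on_H)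
  moreover have "hs (\<lambda>x. F x - U x) (g ` I) = isum (\<lambda>i. (s i - 1)\<^sup>2)"
    unfolding hs_eigenvectors[OF subset_refl]
  proof (rule nn_integral_cong)
    fix i assume "i \<in> space (count_space I)"
    then have i: "i \<in> I" by simp
    have "F (g i) - U (g i) = (s i - 1) *\<^sub>R U (g i)" by (simp add: F_eigenvector[OF i] algebra_simps)
    then show "ennreal ((norm (F (g i) - U (g i)))\<^sup>2) = ennreal ((s i - 1)\<^sup>2)"
      by (simp add: polar_part_on_N(3)[OF eigenvector_in_N[OF i]] norm_g[OF i])
  qed
  ultimately show ?thesis unfolding std_hs_split[OF bounded_clinear_diff[OF F bounded_clinear_U]] by simp
qed

text \<open>Both \<open>X\<close> and \<open>U\<close> have finite Hilbert--Schmidt distance from \<open>F\<close>, so \<open>D = U - X\<close> is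
  Hilbert--Schmidt. The last claim follows with \<open>(1 - Q) g\<^sub>i = (1 - Q) D\<^sup>* U g\<^sub>i\<close> for \<open>Q = X\<^sup>* X\<close>, which holds
  as \<open>g\<^sub>i = U\<^sup>* U g\<^sub>i\<close> and \<open>Q X\<^sup>* = X\<^sup>*\<close>.\<close>

lemma close_finite:
  assumes X: "partial_isometry X" and fin: "std_hs (\<lambda>x. F x - X x) < top"
  shows "std_hs (\<lambda>x. U x - X x) < top" "hs X H < top"
    "hs (\<lambda>x. x - adj X (X x)) (g ` I) < top"
proof -
  note linX = partial_isometry_linear[OF X]
  define D where "D = (\<lambda>x. U x - X x)"
  have D: "bounded_clinear D" unfolding D_def by (rule bounded_clinear_diff[OF bounded_clinear_U linX])
  have "std_hs (\<lambda>x. (F x - X x) - (F x - U x)) < top"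
    by (rule hs_diff_finite[OF fin]) (simp add: hs_F_minus_polar_part isum_singular_values_finite)
  then show finD: "std_hs (\<lambda>x. U x - X x) < top" by simp
  have "hs X H = hs D H" by (rule hs_cong) (simp add: D_def vanish_on_H)
  then show "hs X H < top"
    using finD by (simp add: std_hs_split[OF D] flip: D_def)
  have "hs (\<lambda>x. x - adj X (X x)) (g ` I) \<le> hs (\<lambda>x. adj D (U x)) (g ` I)"
  proof (rule hs_mono)
    fix x assume "x \<in> g ` I"
    then have x: "adj U (U x) = x" using eigenvector_in_N polar_part_on_N(1) by blast
    have adjX: "adj X (X (adj X y)) = adj X y" for y
      using partial_isometry_initial(4)[OF adj_partial_isometry[OF X], of y] adj_adj[OF linX] by simp
    define z where "z = adj D (U x)"
    have z: "z = x - adj X (U x)"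
      unfolding z_def D_def adj_diff[OF bounded_clinear_U linX] by (simp add: x)
    have "x - adj X (X x) = z - adj X (X z)"
      unfolding z bounded_clinearD(2)[OF linX] bounded_clinearD(2)[OF bounded_clinear_adj[OF linX]] adjX
      by simp
    then show "norm (x - adj X (X x)) \<le> norm (adj D (U x))"
      using orth_projectionD(6)[OF orth_projection_complement[OF partial_isometry_initial(1)[OF X]], of z]
      by (simp add: z_def)
  qed
  also have "\<dots> = hs (adj D) (U ` g ` I)"
  proof (rule hs_image[symmetric], rule inj_on_inverseI)
    show "adj U (U x) = x" if "x \<in> g ` I" for x using that eigenvector_in_N polar_part_on_N(1) by blast
  qed
  also have "\<dots> \<le> std_hs D"
  proof -
    obtain C where C: "onb C (UNIV :: 'h set)" using onb_UNIV_exists by blast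
    have "orthonormal (U ` g ` I)"
      unfolding orthonormal_def
    proof (intro ballI)
      fix b c assume "b \<in> U ` g ` I" "c \<in> U ` g ` I"
      then obtain i j where ij: "i \<in> I" "j \<in> I" "b = U (g i)" "c = U (g j)" by blast
      have "b = c \<longleftrightarrow> i = j"
        unfolding ij(3,4) using polar_part_on_N(1)[OF eigenvector_in_N[OF ij(1)]] polar_part_on_N(1)[OF eigenvector_in_N[OF ij(2)]] inj_on_g ij(1,2)
        by (metis inj_on_eq_iff)
      then show "cinner b c = (if b = c then 1 else 0)"
        unfolding ij(3,4) polar_part_on_N(2)[OF eigenvector_in_N[OF ij(1)]] g_orthonormal[OF ij(1,2)] by simp
    qed
    then have "hs (adj D) (U ` g ` I) \<le> hs (adj D) C"
      by (intro hs_orthonormal_le[OF bounded_clinear_adj[OF D] C]) auto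
    then show ?thesis using hs_adj_UNIV[OF D onb_std_basis C] by simp
  qed
  also have "\<dots> < top" using finD by (simp add: D_def)
  finally show "hs (\<lambda>x. x - adj X (X x)) (g ` I) < top" .
qed

text \<open>The operators whose frames form \<open>Q\<^sub>F\<^sup>k\<close> (lemma \<open>close_parseval_frames_index_iff\<close>).\<close>

definition admissible :: "nat \<Rightarrow> (ell2 \<Rightarrow> 'h) \<Rightarrow> bool" where
  "admissible k X \<longleftrightarrow> partial_isometry X \<and> std_hs (\<lambda>x. F x - X x) < top \<and>
     fredholm_pair (adj U \<circ> U) (adj X \<circ> X) \<and> pair_index (adj U \<circ> U) (adj X \<circ> X) = int k"

lemma admissible_kernel:
  assumes X: "admissible k X"
  obtains V where "onb V (kernel X \<inter> N)" "finite V" "k \<le> card V"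
    "hs (\<lambda>x. x - adj X (X x)) (g ` I) = of_nat k + hs X H"
proof -
  have pX: "partial_isometry X" and fin: "std_hs (\<lambda>x. F x - X x) < top"
    and idx: "pair_index (adj U \<circ> U) (adj X \<circ> X) = int k"
    using X by (auto simp: admissible_def)
  note Q = partial_isometry_initial[OF pX]
  have hsQ: "hs (adj X \<circ> X) H = hs X H" by (rule hs_cong) (simp add: Q(5)[symmetric])
  have "onb (g ` I) (range (adj U \<circ> U))" "onb H (kernel (adj U \<circ> U))"
    using onb_g onb_H by (simp_all only: initial_projection)
  from pair_index_hs[OF initial_projection(1) Q(1) this _ _ idx] close_finite(2,3)[OF pX fin]
  obtain V where "onb V (kernel (adj X \<circ> X) \<inter> range (adj U \<circ> U))" "finite V" "k \<le> card V"
    "hs (\<lambda>x. x - (adj X \<circ> X) x) (g ` I) = of_nat k + hs (adj X \<circ> X) H"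
    unfolding hsQ by auto
  then show thesis using that unfolding initial_projection(2) Q(3) hsQ by simp
qed

text \<open>By the index formula, the sum of the \<open>\<parallel>(1 - X\<^sup>* X) g\<^sub>i\<parallel>\<^sup>2\<close> in \<open>energy\<close> exceeds the contribution of
  \<open>ker F\<close> by exactly \<open>k\<close>.\<close>

lemma cost:
  assumes X: "admissible k X"
  shows "std_hs (\<lambda>x. F x - X x) + of_nat k = isum (\<lambda>i. (s i - 1)\<^sup>2) + 2 * isum (\<lambda>i. s i * w X i)"
proof -
  have pX: "partial_isometry X" and fin: "std_hs (\<lambda>x. F x - X x) < top"
    using X by (auto simp: admissible_def)
  have "hs (\<lambda>x. x - adj X (X x)) (g ` I) = of_nat k + hs X H"
    using admissible_kernel[OF X] by blast
  then have "hs X H + (std_hs (\<lambda>x. F x - X x) + of_nat k) =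
      hs X H + (isum (\<lambda>i. (s i - 1)\<^sup>2) + 2 * isum (\<lambda>i. s i * w X i))"
    using energy[OF pX] by (simp add: add_ac)
  then show ?thesis using close_finite(2)[OF pX fin] by (simp add: ennreal_add_left_cancel less_top[symmetric])
qed

lemma cost_le_iff:
  assumes X: "admissible k X" and Y: "admissible k Y"
  shows "std_hs (\<lambda>x. F x - X x) \<le> std_hs (\<lambda>x. F x - Y x) \<longleftrightarrow>
    isum (\<lambda>i. s i * w X i) \<le> isum (\<lambda>i. s i * w Y i)"
proof -
  have "std_hs (\<lambda>x. F x - X x) \<le> std_hs (\<lambda>x. F x - Y x) \<longleftrightarrow>
      of_nat k + std_hs (\<lambda>x. F x - X x) \<le> of_nat k + std_hs (\<lambda>x. F x - Y x)"
    by (simp add: ennreal_add_left_cancel_le)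
  also have "\<dots> \<longleftrightarrow> isum (\<lambda>i. s i * w X i) \<le> isum (\<lambda>i. s i * w Y i)"
    using isum_singular_values_finite
    by (simp add: add.commute[of "of_nat k"] cost[OF X] cost[OF Y] ennreal_add_left_cancel_le
        ennreal_mult_le_mult_iff less_top[symmetric])
  finally show ?thesis .
qed

lemma isum_w_hs:
  assumes X: "partial_isometry X" and J: "J \<subseteq> I"
  shows "2 * (\<integral>\<^sup>+i. ennreal (w X i) \<partial>count_space J) =
    hs (\<lambda>x. U x - X x) (g ` J) + hs (\<lambda>x. x - adj X (X x)) (g ` J)"
proof -
  have "2 * (\<integral>\<^sup>+i. ennreal (w X i) \<partial>count_space J) = (\<integral>\<^sup>+i. 2 * ennreal (w X i) \<partial>count_space J)"
    by (simp add: nn_integral_cmult)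
  also have "\<dots> = (\<integral>\<^sup>+i. ennreal ((norm (U (g i) - X (g i)))\<^sup>2) +
      ennreal ((norm (g i - adj X (X (g i))))\<^sup>2) \<partial>count_space J)"
  proof (rule nn_integral_cong)
    fix i assume "i \<in> space (count_space J)"
    then have i: "i \<in> I" using J by auto
    have "2 * ennreal (w X i) = ennreal (2 * w X i)"
      using w_nonneg[OF X i] by (simp add: ennreal_mult)
    then show "2 * ennreal (w X i) = ennreal ((norm (U (g i) - X (g i)))\<^sup>2) +
      ennreal ((norm (g i - adj X (X (g i))))\<^sup>2)"
      by (simp add: w_identities(1)[OF X i])
  qed
  also have "\<dots> = hs (\<lambda>x. U x - X x) (g ` J) + hs (\<lambda>x. x - adj X (X x)) (g ` J)"
    by (simp add: nn_integral_add hs_eigenvectors[OF J])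
  finally show ?thesis .
qed

text \<open>On \<open>ker X \<inter> N\<close> both \<open>U - X\<close> and \<open>1 - X\<^sup>* X\<close> are isometric. Removing the
  indices \<open>J\<close> amounts to restricting to the orthogonal complement of \<open>g ` J\<close>, which keeps all but
  \<open>card J\<close> dimensions of \<open>ker X \<inter> N\<close>.\<close>

lemma mass_bound:
  assumes X: "admissible k X" and J: "finite J" "J \<subseteq> I"
  shows "of_nat k \<le> (\<integral>\<^sup>+i. ennreal (w X i) \<partial>count_space (I - J)) + of_nat (card J)"
proof -
  have pX: "partial_isometry X" using X by (simp add: admissible_def)
  note linX = partial_isometry_linear[OF pX]
  obtain V where V: "onb V (kernel X \<inter> N)" "finite V" "k \<le> card V"
    using admissible_kernel[OF X] by metis
  obtain C where C: "finite C" "orthonormal C" "C \<subseteq> (kernel X \<inter> N) \<inter> ortho_compl (g ` J)"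
    "card V \<le> card C + card (g ` J)"
    using orthonormal_in_ortho_compl[OF finite_imageI[OF J(1)] onbD(1,2)[OF V(1)] V(2)
        onbD(3,4)[OF V(1)], of g] by blast
  have kC: "k \<le> card C + card J" using V(3) C(4) card_image_le[OF J(1), of g] by linarith
  have M: "onb (g ` (I - J)) (N \<inter> ortho_compl (g ` J))"
    unfolding onb_def
  proof (intro conjI ballI impI)
    show "csubspace (N \<inter> ortho_compl (g ` J))" "closed (N \<inter> ortho_compl (g ` J))"
      by (auto intro: complex_vector.subspace_inter csubspace_ortho_compl closed_ortho_compl)
    show "orthonormal (g ` (I - J))" by (rule orthonormal_g) auto
    show "g ` (I - J) \<subseteq> N \<inter> ortho_compl (g ` J)"
      using J(2) eigenvector_in_N g_orthonormal by (auto simp: ortho_compl_def subset_iff)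
    fix x assume x: "x \<in> N \<inter> ortho_compl (g ` J)" "\<forall>b\<in>g ` (I - J). cinner x b = 0"
    show "x = 0"
      by (rule onbD(5)[OF onb_g]) (use x in \<open>auto simp: ortho_compl_def\<close>)
  qed
  have CN: "x \<in> N" "X x = 0" "norm x = 1" if "x \<in> C" for x
    using C(3) that orthonormalD(2)[OF C(2)] by (auto simp: kernel_def)
  have "of_nat (card C) = hs (\<lambda>x. U x - X x) C"
    by (rule hs_unit(2)[OF _ C(1), symmetric]) (simp add: CN polar_part_on_N(3))
  also have "\<dots> \<le> hs (\<lambda>x. U x - X x) (g ` (I - J))"
    using C(3) by (intro hs_orthonormal_le[OF bounded_clinear_diff[OF bounded_clinear_U linX] M C(2)]) auto
  finally have 1: "of_nat (card C) \<le> hs (\<lambda>x. U x - X x) (g ` (I - J))" .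
  have "of_nat (card C) = hs (\<lambda>x. x - adj X (X x)) C"
    by (rule hs_unit(2)[OF _ C(1), symmetric])
      (simp add: CN bounded_clinearD(4)[OF bounded_clinear_adj[OF linX]])
  also have "\<dots> \<le> hs (\<lambda>x. x - adj X (X x)) (g ` (I - J))"
    using C(3) by (intro hs_orthonormal_le[OF bounded_clinear_defect[OF pX] M C(2)]) auto
  finally have 2: "of_nat (card C) \<le> hs (\<lambda>x. x - adj X (X x)) (g ` (I - J))" .
  have "2 * of_nat (card C) \<le> 2 * (\<integral>\<^sup>+i. ennreal (w X i) \<partial>count_space (I - J))"
    using add_mono[OF 1 2] unfolding isum_w_hs[OF pX Diff_subset] by (simp add: mult_2)
  then have "of_nat (card C) \<le> (\<integral>\<^sup>+i. ennreal (w X i) \<partial>count_space (I - J))"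
    by (simp add: ennreal_mult_le_mult_iff)
  then have "of_nat (card C + card J) \<le>
      (\<integral>\<^sup>+i. ennreal (w X i) \<partial>count_space (I - J)) + of_nat (card J)"
    by (simp add: add_right_mono)
  moreover have "of_nat k \<le> (of_nat (card C + card J) :: ennreal)"
    using kC by (simp only: of_nat_le_iff)
  ultimately show ?thesis by (rule order_trans[rotated])
qed


section \<open>Truncations of the polar part\<close>

definition cut :: "nat \<Rightarrow> (ell2 \<Rightarrow> ell2) \<Rightarrow> bool" where
  "cut k E \<longleftrightarrow> orth_projection E \<and> range E \<subseteq> N \<and> has_rank E k"

definition truncation :: "(ell2 \<Rightarrow> ell2) \<Rightarrow> ell2 \<Rightarrow> 'h" where
  "truncation E = (\<lambda>x. U (x - E x))"

text \<open>Since \<open>E\<close> is a subprojection of \<open>U\<^sup>* U\<close>, the operator \<open>U (1 - E)\<close> has the projection \<open>U\<^sup>* U - E\<close> as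
  its initial projection.\<close>

lemma truncation_initial:
  assumes E: "orth_projection E" and sub: "range E \<subseteq> N"
  shows "adj U (U (E x)) = E x" "partial_isometry (truncation E)"
    "adj (truncation E) (truncation E x) = adj U (U x) - E x"
proof -
  note linE = orth_projectionD(1)[OF E]
  define P where "P = adj U \<circ> U"
  note P = initial_projection[folded P_def]
  have P_app: "adj U (U x) = P x" for x by (simp add: P_def)
  have linP: "bounded_clinear P" by (rule orth_projectionD(1)[OF P(1)])
  show "adj U (U (E x)) = E x" using sub polar_part_on_N(1) by blast
  then have PE: "P (E x) = E x" for x using sub polar_part_on_N(1) P_app by (metis range_subsetD)
  have EP: "E (P x) = E x" for x
    by (rule cinner_left_unique) (simp only: orth_projectionD(3)[OF E] orth_projectionD(3)[OF P(1)] PE)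
  have lin: "bounded_clinear (truncation E)"
    unfolding truncation_def
    using bounded_clinear_compose[OF bounded_clinear_U bounded_clinear_diff[OF bounded_clinear_ident linE]]
    by (simp add: o_def)
  have adj_t: "adj (truncation E) = (\<lambda>y. adj U y - E (adj U y))"
    by (rule adj_eqI[OF lin])
      (simp add: truncation_def cinner_adj_right[OF bounded_clinear_U, symmetric] cinner_diff_left
        cinner_diff_right orth_projectionD(3)[OF E])
  show *: "adj (truncation E) (truncation E x) = adj U (U x) - E x" for x
    unfolding adj_t unfolding truncation_def P_app bounded_clinearD(2)[OF linP] bounded_clinearD(2)[OF linE] PE EP
      orth_projectionD(2)[OF E] by simp
  have "orth_projection (adj (truncation E) \<circ> truncation E)"
    unfolding orth_projection_def
  proof (intro conjI allI)
    show "bounded_clinear (adj (truncation E) \<circ> truncation E)"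
      by (intro bounded_clinear_compose bounded_clinear_adj lin)
    show "(adj (truncation E) \<circ> truncation E) \<circ> (adj (truncation E) \<circ> truncation E) =
        adj (truncation E) \<circ> truncation E"
    proof
      fix x
      have "P (P x - E x) - E (P x - E x) = P x - E x"
        by (simp only: bounded_clinearD(2)[OF linP] bounded_clinearD(2)[OF linE] PE EP
            orth_projectionD(2)[OF P(1)] orth_projectionD(2)[OF E]) simp
      then show "((adj (truncation E) \<circ> truncation E) \<circ> (adj (truncation E) \<circ> truncation E)) x =
          (adj (truncation E) \<circ> truncation E) x"
        by (simp add: * P_app)
    qed
    show "cinner ((adj (truncation E) \<circ> truncation E) x) y =
        cinner x ((adj (truncation E) \<circ> truncation E) y)" for x y
      by (simp add: * P_app cinner_diff_left cinner_diff_right orth_projectionD(3)[OF E]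
          orth_projectionD(3)[OF P(1)])
  qed
  then show "partial_isometry (truncation E)" by (rule partial_isometryI[OF lin])
qed

lemma w_truncation:
  assumes E: "orth_projection E" and i: "i \<in> I"
  shows "w (truncation E) i = (norm (E (g i)))\<^sup>2"
proof -
  have "cinner (U (g i)) (truncation E (g i)) = 1 - cinner (E (g i)) (g i)"
    unfolding truncation_def polar_part_on_N(2)[OF eigenvector_in_N[OF i]]
    by (simp add: cinner_diff_right g_orthonormal[OF i i] orth_projectionD(3)[OF E])
  then show ?thesis by (simp add: w_def orth_projectionD(4)[OF E] flip: of_real_power)
qed

text \<open>For \<open>P = U\<^sup>* U\<close> and \<open>Q = P - E\<close> one has \<open>ker Q \<inter> ran P = ran E\<close> and \<open>ran Q \<inter> ker P = 0\<close>; moreover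
  \<open>Q P = Q\<close>, so that the Fredholm conditions are immediate.\<close>

lemma admissible_truncation:
  assumes E: "cut k E" shows "admissible k (truncation E)"
proof -
  have pE: "orth_projection E" and sub: "range E \<subseteq> N" and rank: "has_rank E k"
    using E by (auto simp: cut_def)
  note T = truncation_initial[OF pE sub]
  note linE = orth_projectionD(1)[OF pE]
  define P where "P = adj U \<circ> U"
  note P = initial_projection[folded P_def]
  have P_app: "adj U (U x) = P x" for x by (simp add: P_def)
  define Q where "Q = adj (truncation E) \<circ> truncation E"
  have Q: "Q x = P x - E x" for x by (simp add: Q_def T(3) P_app)
  have projQ: "orth_projection Q" unfolding Q_def by (rule partial_isometry_initial(1)[OF T(2)])
  have PE: "P (E x) = E x" for x using T(1) by (simp add: P_app)
  have EE: "E (E x) = E x" for x by (rule orth_projectionD(2)[OF pE])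
  have fixP: "P x = x" if "x \<in> range P" for x using that range_orth_projection[OF P(1)] by blast
  have fin: "std_hs (\<lambda>x. F x - truncation E x) < top"
  proof -
    obtain V where V: "onb V (range E)" "finite V"
      using rank unfolding has_rank_iff_onb[OF pE] by blast
    have "std_hs E = of_nat (card V)" by (rule hs_projection[OF pE V onb_std_basis]) simp
    then have "std_hs E < top" by (simp add: less_top[symmetric])
    then have "std_hs (\<lambda>x. U (E x)) < top" by (rule hs_compose_left_finite[OF bounded_clinear_U])
    moreover have "std_hs (\<lambda>x. F x - U x) < top"
      unfolding hs_F_minus_polar_part by (rule isum_singular_values_finite)
    ultimately have "std_hs (\<lambda>x. (F x - U x) + U (E x)) < top" by (intro hs_add_finite)
    then show ?thesis by (simp add: truncation_def bounded_clinearD[OF bounded_clinear_U] algebra_simps)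
  qed
  have ker: "kernel Q \<inter> range P = range E"
  proof (intro equalityI subsetI)
    fix x assume x: "x \<in> kernel Q \<inter> range P"
    then have "P x = E x" by (simp add: kernel_def Q)
    then have "x = E x" using fixP[of x] x by simp
    then show "x \<in> range E" by (rule range_eqI)
  next
    fix x assume "x \<in> range E"
    then have x: "E x = x" using range_orth_projection[OF pE] by blast
    have Px: "P x = x" using PE[of x] by (simp only: x)
    have "x \<in> range P" using Px[symmetric] by (rule range_eqI)
    then show "x \<in> kernel Q \<inter> range P" by (intro IntI) (simp_all add: kernel_def Q x Px)
  qed
  have ran: "range Q \<inter> kernel P = {0}"
  proof
    show "range Q \<inter> kernel P \<subseteq> {0}"
    proof
      fix y assume y: "y \<in> range Q \<inter> kernel P"
      then obtain x where x: "y = P x - E x" using Q by blast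
      have "P y = y"
        unfolding x bounded_clinearD(2)[OF orth_projectionD(1)[OF P(1)]] PE
          orth_projectionD(2)[OF P(1)] ..
      then show "y \<in> {0}" using y by (simp add: kernel_def)
    qed
    show "{0} \<subseteq> range Q \<inter> kernel P"
      using csubspaceD(1)[OF csubspace_range_projection[OF projQ]]
        bounded_clinearD(4)[OF orth_projectionD(1)[OF P(1)]] by (simp add: kernel_def)
  qed
  have idx: "pair_index P Q = int k"
  proof -
    have "onb {} {0::ell2}" by (simp add: onb_def orthonormal_def complex_vector.subspace_def)
    then have "cdim {0::ell2} = 0" using finite_onb_dim(2) by fastforce
    then show ?thesis unfolding pair_index_def ker ran using rank by (simp add: has_rank_def)
  qed
  have QP: "Q (P x) = Q x" for x
  proof -
    have "E (P x) = E x"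
      by (rule cinner_left_unique)
        (simp only: orth_projectionD(3)[OF pE] orth_projectionD(3)[OF P(1)] PE)
    then show ?thesis by (simp add: Q orth_projectionD(2)[OF P(1)])
  qed
  have img: "(Q \<circ> P) ` range P = range Q"
    by (auto simp: QP orth_projectionD(2)[OF P(1)] image_image)
  have kerQP: "range P \<inter> kernel (Q \<circ> P) = range E"
    unfolding ker[symmetric] by (auto simp: kernel_def QP)
  have "fredholm_pair P Q"
    unfolding fredholm_pair_def fredholm_on_def kerQP img
  proof (intro conjI)
    show "finite_cdim (range E)" using rank by (simp add: has_rank_def)
    show "closed (range Q)" by (rule closed_range_projection[OF projQ])
    show "\<exists>B. finite B \<and> range Q = cspan (range Q \<union> B)"
      using csubspace_range_projection[OF projQ]
      by (intro exI[of _ "{}"]) (simp add: complex_vector.span_eq_iff[THEN iffD2])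
  qed
  then show ?thesis
    unfolding admissible_def using T(2) fin idx by (simp add: P_def Q_def)
qed

lemma isum_norm_cut:
  assumes E: "cut k E" shows "isum (\<lambda>i. (norm (E (g i)))\<^sup>2) = of_nat k"
proof -
  have pE: "orth_projection E" and sub: "range E \<subseteq> N" and rank: "has_rank E k"
    using E by (auto simp: cut_def)
  obtain V where V: "onb V (range E)" "finite V" "card V = k"
    using rank unfolding has_rank_iff_onb[OF pE] by blast
  show ?thesis
    using hs_projection[OF pE V(1,2) onb_g sub] by (simp add: hs_eigenvectors[OF subset_refl] V(3))
qed

definition lowest :: "nat set \<Rightarrow> bool" where
  "lowest S \<longleftrightarrow> finite S \<and> S \<subseteq> I \<and> (\<forall>i\<in>S. \<forall>j\<in>I - S. s i \<le> s j)"

lemma cost_lower_bound: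
  assumes X: "admissible k X" and S: "lowest S" "card S = k"
  shows "ennreal (\<Sum>i\<in>S. s i) \<le> isum (\<lambda>i. s i * w X i)"
proof (rule sum_smallest_le_weighted_sum)
  have pX: "partial_isometry X" using X by (simp add: admissible_def)
  show "finite S" "S \<subseteq> I" using S by (auto simp: lowest_def)
  show "0 \<le> s i" if "i \<in> I" for i using s_pos[OF that] by simp
  show "0 \<le> w X i" if "i \<in> I" for i by (rule w_nonneg[OF pX that])
  show "s i \<le> s j" if "i \<in> S" "j \<in> I - S" for i j using S(1) that by (simp add: lowest_def)
  show "of_nat (card S) \<le> (\<integral>\<^sup>+i. ennreal (w X i) \<partial>count_space (I - J)) + of_nat (card J)"
    if "J \<subseteq> S" for J
    unfolding S(2) using S(1) that
    by (intro mass_bound[OF X]) (auto simp: lowest_def intro: finite_subset)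
qed

text \<open>Equality in the lower bound leaves no room in the estimates behind it: \<open>ker X \<inter> N\<close> has
  dimension exactly \<open>k\<close>, and \<open>X\<close> agrees with \<open>U\<close> on the orthogonal complement of this space.\<close>

lemma minimal_is_truncation:
  assumes X: "admissible k X" and S: "lowest S" "card S = k" and k: "1 \<le> k"
    and min: "isum (\<lambda>i. s i * w X i) \<le> ennreal (\<Sum>i\<in>S. s i)"
  obtains E where "cut k E" "X = truncation E"
proof -
  have pX: "partial_isometry X" using X by (simp add: admissible_def)
  note linX = partial_isometry_linear[OF pX]
  note linUX = bounded_clinear_diff[OF bounded_clinear_U linX]
  have mass: "isum (w X) = of_nat (card S)"
  proof (rule total_mass_eq_if_weighted_sum_minimal)
    show "finite S" "S \<subseteq> I" using S by (auto simp: lowest_def)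
    show "S \<noteq> {}" using S(2) k by auto
    show "0 \<le> w X i" if "i \<in> I" for i by (rule w_nonneg[OF pX that])
    show "s i \<le> s j" if "i \<in> S" "j \<in> I - S" for i j using S(1) that by (simp add: lowest_def)
    show "of_nat (card S) \<le> (\<integral>\<^sup>+i. ennreal (w X i) \<partial>count_space (I - J)) + of_nat (card J)"
      if "J \<subseteq> S" for J
      unfolding S(2) using S(1) that
      by (intro mass_bound[OF X]) (auto simp: lowest_def intro: finite_subset)
  qed (use s_pos min in auto)
  obtain V where V: "onb V (kernel X \<inter> N)" "finite V" "k \<le> card V"
    and d: "hs (\<lambda>x. x - adj X (X x)) (g ` I) = of_nat k + hs X H"
    using admissible_kernel[OF X] by metis
  have VN: "v \<in> N" "X v = 0" "norm v = 1" if "v \<in> V" for v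
    using onbD(4)[OF V(1)] that orthonormalD(2)[OF onbD(3)[OF V(1)]] by (auto simp: kernel_def)
  obtain B where B: "V \<subseteq> B" "onb B N"
    using extend_to_onb[OF onbD(1,2)[OF onb_g] onbD(3)[OF V(1)]] VN(1) by blast
  define B2 where "B2 = B - V"
  have B_eq: "B = V \<union> B2" "V \<inter> B2 = {}" using B(1) by (auto simp: B2_def)
  have hsV: "hs (\<lambda>x. U x - X x) V = of_nat (card V)"
    by (rule hs_unit(2)[OF _ V(2)]) (simp add: VN polar_part_on_N(3))
  have hsUX: "hs (\<lambda>x. U x - X x) (g ` I) = of_nat (card V) + hs (\<lambda>x. U x - X x) B2"
    unfolding hs_independent_of_basis[OF linUX onb_g B(2)] hsV[symmetric] B_eq(1)
    by (rule hs_Un[OF B_eq(2)])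
  have "2 * of_nat k = of_nat (card V) + hs (\<lambda>x. U x - X x) B2 + (of_nat k + hs X H)"
    using isum_w_hs[OF pX subset_refl] unfolding mass S(2) hsUX d .
  moreover obtain m where m: "card V = k + m" using V(3) le_Suc_ex by blast
  ultimately have "of_nat (2 * k) + 0 =
      of_nat (2 * k) + (of_nat m + hs (\<lambda>x. U x - X x) B2 + hs X H)"
    by (simp add: add_ac mult_2)
  then have 0: "of_nat m + hs (\<lambda>x. U x - X x) B2 + hs X H = 0"
    using ennreal_of_nat_neq_top[of "2 * k"] by (auto simp only: ennreal_add_left_cancel infinity_ennreal_def)
  then have cardV: "card V = k" and z: "hs (\<lambda>x. U x - X x) B2 = 0" "hs X H = 0"
    using m by auto
  define E where "E x = (\<Sum>b\<in>V. cinner x b *\<^sub>C b)" for x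
  note E = finite_orthonormal_projection[OF V(2) onbD(3)[OF V(1)], folded E_def]
  have rE: "range E = kernel X \<inter> N" unfolding E(2) by (rule finite_onb_span[OF V(1,2)])
  have cutE: "cut k E"
    unfolding cut_def has_rank_iff_onb[OF E(1)] rE using E(1) V(1,2) cardV by auto
  have linT: "bounded_clinear (truncation E)"
    using truncation_initial(2)[OF E(1)] rE by (intro partial_isometry_linear) simp
  have onb_all: "onb (B \<union> H) UNIV" using onb_Un(1)[OF B(2), of H] onb_H by (simp add: ortho_compl_N)
  have "X = truncation E"
  proof (rule onb_operator_eqI[OF linX linT onb_all])
    fix b assume "b \<in> B \<union> H"
    then consider "b \<in> V" | "b \<in> B2" | "b \<in> H" using B_eq by blast
    then show "X b = truncation E b"
    proof cases
      case 1
      then show ?thesis by (simp add: VN truncation_def E(4) bounded_clinearD(4)[OF bounded_clinear_U])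
    next
      case 2
      have "cinner b v = 0" if "v \<in> V" for v
        using 2 that B(1) orthonormalD(3)[OF onbD(3)[OF B(2)]] unfolding B2_def by blast
      then have "E b = 0" by (simp add: E_def)
      then show ?thesis using hs_eq_0D[OF z(1) 2] by (simp add: truncation_def)
    next
      case 3
      have "cinner b v = 0" if "v \<in> V" for v
        using VN(1)[OF that] onbD(4)[OF onb_H] 3 ortho_compl_iff_right[of v "kernel F"] by blast
      then have "E b = 0" by (simp add: E_def)
      then show ?thesis using hs_eq_0D[OF z(2) 3] vanish_on_H(2)[OF 3] by (simp add: truncation_def)
    qed
  qed
  then show thesis using that cutE by blast
qed

definition coord_proj :: "nat set \<Rightarrow> ell2 \<Rightarrow> ell2" where
  "coord_proj S x = (\<Sum>b\<in>g ` S. cinner x b *\<^sub>C b)"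

lemma coord_proj:
  assumes S: "finite S" "S \<subseteq> I"
  shows "orth_projection (coord_proj S)" "range (coord_proj S) = cspan (g ` S)"
    "i \<in> I \<Longrightarrow> coord_proj S (g i) = (if i \<in> S then g i else 0)"
    "onb (g ` S) (range (coord_proj S))" "card (g ` S) = card S" "range (coord_proj S) \<subseteq> N"
proof -
  note on = orthonormal_g[OF S(2)]
  note E = finite_orthonormal_projection[OF finite_imageI[OF S(1)] on, folded coord_proj_def]
  show "orth_projection (coord_proj S)" "range (coord_proj S) = cspan (g ` S)" by (rule E)+
  show "coord_proj S (g i) = (if i \<in> S then g i else 0)" if i: "i \<in> I"
  proof (cases "i \<in> S")
    case False
    then have "cinner (g i) (g j) = 0" if "j \<in> S" for j
      using g_orthonormal[OF i, of j] that S(2) by (auto simp: subset_iff)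
    then have "coord_proj S (g i) = 0" unfolding coord_proj_def by (intro sum.neutral) auto
    then show ?thesis using False by simp
  qed (simp add: E(4))
  show "onb (g ` S) (range (coord_proj S))"
    unfolding E(2) using on S(1) by (intro onb_cspan) auto
  show "card (g ` S) = card S" by (rule card_image[OF inj_on_subset[OF inj_on_g S(2)]])
  show "range (coord_proj S) \<subseteq> N"
    unfolding E(2) using eigenvector_in_N S(2) by (intro complex_vector.span_minimal csubspace_ortho_compl) auto
qed

lemma cut_coord_proj: "finite S \<Longrightarrow> S \<subseteq> I \<Longrightarrow> cut (card S) (coord_proj S)"
  unfolding cut_def using coord_proj[of S] has_rank_iff_onb[of "coord_proj S" "card S"] by blast

lemma cost_coord_proj:
  assumes S: "finite S" "S \<subseteq> I"
  shows "isum (\<lambda>i. s i * w (truncation (coord_proj S)) i) = ennreal (\<Sum>i\<in>S. s i)"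
proof -
  have "isum (\<lambda>i. s i * w (truncation (coord_proj S)) i) =
      (\<integral>\<^sup>+i. ennreal (if i \<in> S then s i else 0) \<partial>count_space I)"
    by (intro nn_integral_cong)
      (auto simp: w_truncation[OF coord_proj(1)[OF S]] coord_proj(3)[OF S] norm_g)
  also have "\<dots> = (\<Sum>i\<in>S. ennreal (if i \<in> S then s i else 0))"
    by (rule nn_integral_count_space'[OF S(1) _ S(2)]) simp
  also have "\<dots> = (\<Sum>i\<in>S. ennreal (s i))" by (intro sum.cong) auto
  also have "\<dots> = ennreal (\<Sum>i\<in>S. s i)"
    using s_pos S(2) by (intro sum_ennreal) (auto intro: less_imp_le)
  finally show ?thesis .
qed

definition minimizer :: "nat \<Rightarrow> (ell2 \<Rightarrow> 'h) \<Rightarrow> bool" where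
  "minimizer k X \<longleftrightarrow> admissible k X \<and>
     (\<forall>Y. admissible k Y \<longrightarrow> isum (\<lambda>i. s i * w X i) \<le> isum (\<lambda>i. s i * w Y i))"

lemma minimizer_le:
  assumes "minimizer k X" "finite S" "S \<subseteq> I" "card S = k"
  shows "isum (\<lambda>i. s i * w X i) \<le> ennreal (\<Sum>i\<in>S. s i)"
  using assms admissible_truncation[OF cut_coord_proj[OF assms(2,3)]]
  by (auto simp: minimizer_def cost_coord_proj)

lemma minimizer_iff:
  assumes S: "lowest S" "card S = k" and k: "1 \<le> k"
  shows "minimizer k X \<longleftrightarrow> (\<exists>E. cut k E \<and> X = truncation E \<and>
    isum (\<lambda>i. s i * (norm (E (g i)))\<^sup>2) = ennreal (\<Sum>i\<in>S. s i))"
proof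
  have fin: "finite S" "S \<subseteq> I" using S by (auto simp: lowest_def)
  have wE: "isum (\<lambda>i. s i * w (truncation E) i) = isum (\<lambda>i. s i * (norm (E (g i)))\<^sup>2)"
    if "cut k E" for E
    using that by (intro nn_integral_cong) (simp add: w_truncation cut_def)
  {
    assume X: "minimizer k X"
    then have adm: "admissible k X" by (simp add: minimizer_def)
    have le: "isum (\<lambda>i. s i * w X i) \<le> ennreal (\<Sum>i\<in>S. s i)"
      by (rule minimizer_le[OF X fin S(2)])
    obtain E where E: "cut k E" "X = truncation E"
      using minimal_is_truncation[OF adm S k le] by blast
    show "\<exists>E. cut k E \<and> X = truncation E \<and>
        isum (\<lambda>i. s i * (norm (E (g i)))\<^sup>2) = ennreal (\<Sum>i\<in>S. s i)"
      using E antisym[OF le cost_lower_bound[OF adm S]] wE[OF E(1)] by auto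
  }
  {
    assume "\<exists>E. cut k E \<and> X = truncation E \<and>
        isum (\<lambda>i. s i * (norm (E (g i)))\<^sup>2) = ennreal (\<Sum>i\<in>S. s i)"
    then obtain E where E: "cut k E" "X = truncation E"
      "isum (\<lambda>i. s i * (norm (E (g i)))\<^sup>2) = ennreal (\<Sum>i\<in>S. s i)" by blast
    then show "minimizer k X"
      unfolding minimizer_def using admissible_truncation[OF E(1)] cost_lower_bound[OF _ S]
      by (simp add: wE)
  }
qed


section \<open>Existence of a smallest family of singular values\<close>

lemma finite_away_from_1:
  assumes "\<epsilon> > 0" shows "finite {i \<in> I. \<epsilon> \<le> \<bar>s i - 1\<bar>}"
proof (rule ccontr)
  define Z where "Z = {i \<in> I. \<epsilon> \<le> \<bar>s i - 1\<bar>}"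
  assume "infinite {i \<in> I. \<epsilon> \<le> \<bar>s i - 1\<bar>}"
  then have "top = ennreal (\<epsilon>\<^sup>2) * emeasure (count_space Z) Z"
    using assms by (simp add: Z_def ennreal_mult_top)
  also have "\<dots> = (\<integral>\<^sup>+i. ennreal (\<epsilon>\<^sup>2) \<partial>count_space Z)" by simp
  also have "\<dots> \<le> (\<integral>\<^sup>+i. ennreal ((s i - 1)\<^sup>2) \<partial>count_space Z)"
  proof (intro nn_integral_mono ennreal_leI)
    fix i assume "i \<in> space (count_space Z)"
    then have "\<epsilon> \<le> \<bar>s i - 1\<bar>" by (simp add: Z_def)
    then have "\<epsilon>\<^sup>2 \<le> \<bar>s i - 1\<bar>\<^sup>2" using assms by (intro power_mono) auto
    then show "\<epsilon>\<^sup>2 \<le> (s i - 1)\<^sup>2" by simp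
  qed
  also have "\<dots> \<le> isum (\<lambda>i. (s i - 1)\<^sup>2)"
    by (rule nn_integral_count_space_mono_set) (auto simp: Z_def)
  finally show False using isum_singular_values_finite by (simp add: top_unique)
qed

text \<open>Elements of greatest weight are removed from \<open>L\<close> until \<open>k\<close> elements are left.\<close>

lemma lowest_of_larger:
  assumes "finite L" "L \<subseteq> I" "\<And>i j. i \<in> L \<Longrightarrow> j \<in> I - L \<Longrightarrow> s i \<le> s j" "k \<le> card L"
  shows "\<exists>S. lowest S \<and> card S = k"
  using assms
proof (induction "card L - k" arbitrary: L)
  case 0
  then show ?case by (intro exI[of _ L]) (auto simp: lowest_def)
next
  case (Suc m)
  have "L \<noteq> {}" using Suc.hyps(2) by auto
  have "Max (s ` L) \<in> s ` L" using Suc.prems(1) \<open>L \<noteq> {}\<close> by (intro Max_in) auto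
  then obtain a where a: "a \<in> L" "s a = Max (s ` L)" by auto
  have max: "s i \<le> s a" if "i \<in> L" for i using Suc.prems(1) that by (simp add: a(2))
  have card: "card (L - {a}) = card L - 1" using a(1) Suc.prems(1) by simp
  show ?case
  proof (rule Suc.hyps(1)[of "L - {a}"])
    show "s i \<le> s j" if "i \<in> L - {a}" "j \<in> I - (L - {a})" for i j
    proof (cases "j = a")
      case True
      then show ?thesis using max that(1) by simp
    next
      case False
      then show ?thesis using that by (intro Suc.prems(3)) auto
    qed
  qed (use Suc.hyps(2) Suc.prems(1,2) card in auto)
qed

text \<open>If no \<open>k\<close> singular values are smallest, then fewer than \<open>k\<close> of them are \<open>\<le> 1\<close> while
  infinitely many decrease to \<open>1\<close>. The lower bound for the weights \<open>min s\<^sub>i 1\<close> in place of \<open>s\<^sub>i\<close>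
  is then strict, but truncations at singular values closer and closer to \<open>1\<close> approach it.\<close>

lemma minimizer_imp_lowest:
  assumes X: "minimizer k X" and k: "1 \<le> k" "infinite I \<or> k \<le> card I"
  shows "\<exists>S. lowest S \<and> card S = k"
proof (rule ccontr)
  assume no: "\<nexists>S. lowest S \<and> card S = k"
  have nolow: "card L < k"
    if "finite L" "L \<subseteq> I" "\<And>i j. i \<in> L \<Longrightarrow> j \<in> I - L \<Longrightarrow> s i \<le> s j" for L
    using lowest_of_larger[OF that] no not_le by blast
  have adm: "admissible k X" using X by (simp add: minimizer_def)
  then have pX: "partial_isometry X" by (simp add: admissible_def)
  have sub: "\<exists>Z\<subseteq>Y. finite Z \<and> card Z = k" if "infinite Y \<or> k \<le> card Y" for Y :: "nat set"
  proof (cases "finite Y")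
    case True
    then show ?thesis using that obtain_subset_with_card_n[of k Y] by blast
  next
    case False
    then show ?thesis using infinite_arbitrarily_large[of Y k] by blast
  qed
  define T1 where "T1 = {i \<in> I. s i < 1}"
  have T1: "finite T1"
  proof (rule ccontr)
    assume "infinite T1"
    then obtain Z where Z: "Z \<subseteq> T1" "finite Z" "card Z = k" using sub by blast
    define c where "c = Max (s ` Z)"
    have "Z \<noteq> {}" using Z(3) k(1) by auto
    then have "c \<in> s ` Z" unfolding c_def using Z(2) by (intro Max_in) auto
    then have c1: "c < 1" using Z(1) by (auto simp: T1_def)
    have fin: "finite {i \<in> I. s i \<le> c}"
      by (rule finite_subset[OF _ finite_away_from_1[of "1 - c"]]) (use c1 in auto)
    have "card {i \<in> I. s i \<le> c} < k" by (rule nolow[OF fin]) auto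
    moreover have "Z \<subseteq> {i \<in> I. s i \<le> c}"
      using Z(1,2) by (auto simp: T1_def c_def)
    then have "k \<le> card {i \<in> I. s i \<le> c}" using card_mono[OF fin] Z(3) by blast
    ultimately show False by simp
  qed
  define T0 where "T0 = {i \<in> I. s i \<le> 1}"
  have "\<not> (infinite T0 \<or> k \<le> card T0)"
  proof
    assume "infinite T0 \<or> k \<le> card T0"
    then obtain Z where Z: "Z \<subseteq> T0" "finite Z" "card Z = k" using sub by blast
    have "card (T1 \<union> Z) < k"
    proof (rule nolow)
      show "s i \<le> s j" if "i \<in> T1 \<union> Z" "j \<in> I - (T1 \<union> Z)" for i j
      proof -
        have "s i \<le> 1" using that(1) Z(1) by (auto simp: T1_def T0_def)
        moreover have "1 \<le> s j" using that(2) by (auto simp: T1_def)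
        ultimately show ?thesis by simp
      qed
    qed (use T1 Z in \<open>auto simp: T1_def T0_def\<close>)
    moreover have "k \<le> card (T1 \<union> Z)" using card_mono[of "T1 \<union> Z" Z] T1 Z(2,3) by simp
    ultimately show False by simp
  qed
  then have T0: "finite T0" "card T0 < k" by auto
  have T0I: "T0 \<subseteq> I" by (auto simp: T0_def)
  have infI: "infinite I"
  proof
    assume "finite I"
    then have "card I < k" by (intro nolow) auto
    then show False using k(2) \<open>finite I\<close> by simp
  qed
  have choose: "\<exists>R. finite R \<and> R \<subseteq> I - T0 \<and> card R = k - card T0 \<and> (\<forall>i\<in>R. s i < 1 + \<epsilon>)"
    if "\<epsilon> > 0" for \<epsilon>
  proof -
    define D where "D = {i \<in> I - T0. s i < 1 + \<epsilon>}"
    have "I \<subseteq> T0 \<union> D \<union> {i \<in> I. \<epsilon> \<le> \<bar>s i - 1\<bar>}" by (auto simp: D_def T0_def)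
    then have "infinite D"
      using infI T0(1) finite_away_from_1[OF that] by (meson finite_Un finite_subset)
    then obtain R where "R \<subseteq> D" "finite R" "card R = k - card T0"
      using infinite_arbitrarily_large by blast
    then show ?thesis by (intro exI[of _ R]) (auto simp: D_def)
  qed
  have card_ext: "finite (T0 \<union> R)" "card (T0 \<union> R) = k" "T0 \<union> R \<subseteq> I" "T0 \<inter> R = {}"
    if "finite R" "R \<subseteq> I - T0" "card R = k - card T0" for R
  proof -
    show "T0 \<inter> R = {}" using that(2) by blast
    then show "card (T0 \<union> R) = k" using card_Un_disjoint[OF T0(1) that(1)] that(3) T0(2) by simp
    show "finite (T0 \<union> R)" "T0 \<union> R \<subseteq> I" using T0 T0I that by auto
  qed
  define s' where "s' i = min (s i) 1" for i
  define a where "a = (\<Sum>i\<in>T0. s i) + (k - card T0)"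
  have a0: "0 \<le> a" unfolding a_def using s_pos T0I by (intro add_nonneg_nonneg sum_nonneg) (auto intro: less_imp_le)
  have low: "ennreal a \<le> isum (\<lambda>i. s' i * w X i)"
  proof -
    obtain R where R: "finite R" "R \<subseteq> I - T0" "card R = k - card T0" using choose[of 1] by auto
    note S = card_ext[OF R]
    have "ennreal (\<Sum>i\<in>T0 \<union> R. s' i) \<le> isum (\<lambda>i. s' i * w X i)"
    proof (rule sum_smallest_le_weighted_sum[OF S(1,3)])
      show "0 \<le> s' i" if "i \<in> I" for i using s_pos[OF that] by (simp add: s'_def)
      show "0 \<le> w X i" if "i \<in> I" for i by (rule w_nonneg[OF pX that])
      show "s' i \<le> s' j" if "i \<in> T0 \<union> R" "j \<in> I - (T0 \<union> R)" for i j
        using that by (auto simp: s'_def T0_def)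
      show "of_nat (card (T0 \<union> R)) \<le>
          (\<integral>\<^sup>+i. ennreal (w X i) \<partial>count_space (I - J)) + of_nat (card J)" if "J \<subseteq> T0 \<union> R" for J
        unfolding S(2) using that S(1,3) by (intro mass_bound[OF adm]) (auto intro: finite_subset)
    qed
    also have "(\<Sum>i\<in>T0 \<union> R. s' i) = (\<Sum>i\<in>T0. s' i) + (\<Sum>i\<in>R. s' i)"
      by (rule sum.union_disjoint[OF T0(1) R(1) S(4)])
    also have "(\<Sum>i\<in>T0. s' i) = (\<Sum>i\<in>T0. s i)"
      by (rule sum.cong) (auto simp: s'_def T0_def)
    also have "(\<Sum>i\<in>R. s' i) = (\<Sum>i\<in>R. 1)"
      by (rule sum.cong) (use R(2) in \<open>auto simp: s'_def T0_def\<close>)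
    finally show ?thesis using R(3) by (simp add: a_def)
  qed
  obtain i where i: "i \<in> I - T0" "0 < w X i"
  proof -
    have "\<exists>i\<in>I - T0. 0 < w X i"
    proof (rule ccontr)
      assume "\<not> (\<exists>i\<in>I - T0. 0 < w X i)"
      then have "(\<integral>\<^sup>+i. ennreal (w X i) \<partial>count_space (I - T0)) = 0"
        by (subst nn_integral_0_iff_AE) (auto simp: AE_count_space ennreal_eq_0_iff not_less)
      then have "of_nat k \<le> (of_nat (card T0) :: ennreal)" using mass_bound[OF adm T0(1) T0I] by simp
      then show False using T0(2) by (simp add: not_le[symmetric])
    qed
    then show thesis using that by blast
  qed
  define \<delta> where "\<delta> = (s i - 1) * w X i"
  have \<delta>: "\<delta> > 0" using i by (auto simp: \<delta>_def T0_def)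
  have "ennreal a + ennreal \<delta> \<le> isum (\<lambda>i. s i * w X i)"
  proof -
    have "(\<integral>\<^sup>+j. ennreal (if j = i then \<delta> else 0) \<partial>count_space I) = (\<Sum>j\<in>{i}. ennreal (if j = i then \<delta> else 0))"
      by (rule nn_integral_count_space') (use i in auto)
    then have "ennreal a + ennreal \<delta> \<le>
        isum (\<lambda>i. s' i * w X i) + (\<integral>\<^sup>+j. ennreal (if j = i then \<delta> else 0) \<partial>count_space I)"
      using low by (simp add: add_right_mono)
    also have "\<dots> = (\<integral>\<^sup>+j. ennreal (s' j * w X j) + ennreal (if j = i then \<delta> else 0) \<partial>count_space I)"
      by (simp add: nn_integral_add)
    also have "\<dots> \<le> isum (\<lambda>i. s i * w X i)"
    proof (rule nn_integral_mono)
      fix j assume "j \<in> space (count_space I)"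
      then have j: "j \<in> I" by simp
      have w0: "0 \<le> w X j" by (rule w_nonneg[OF pX j])
      have "0 \<le> s' j * w X j" using w0 s_pos[OF j] by (simp add: s'_def)
      then have "ennreal (s' j * w X j) + ennreal (if j = i then \<delta> else 0) =
          ennreal (s' j * w X j + (if j = i then \<delta> else 0))"
        using \<delta> by (simp add: ennreal_plus)
      also have "\<dots> \<le> ennreal (s j * w X j)"
      proof (rule ennreal_leI, cases "j = i")
        case True
        then show "s' j * w X j + (if j = i then \<delta> else 0) \<le> s j * w X j"
          using i(1) by (auto simp: s'_def \<delta>_def T0_def algebra_simps)
      next
        case False
        have "s' j * w X j \<le> s j * w X j" by (rule mult_right_mono[OF _ w0]) (simp add: s'_def)
        then show "s' j * w X j + (if j = i then \<delta> else 0) \<le> s j * w X j" using False by simp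
      qed
      finally show "ennreal (s' j * w X j) + ennreal (if j = i then \<delta> else 0) \<le> ennreal (s j * w X j)" .
    qed
    finally show ?thesis .
  qed
  moreover
  (* At most k of the chosen singular values exceed 1, each by less than \<epsilon>, and so together by at
     most half of the gap \<delta>. *)
  define \<epsilon> where "\<epsilon> = \<delta> / (2 * real k)"
  have \<epsilon>: "\<epsilon> > 0" using \<delta> k(1) by (simp add: \<epsilon>_def)
  obtain R where R: "finite R" "R \<subseteq> I - T0" "card R = k - card T0" "\<forall>i\<in>R. s i < 1 + \<epsilon>"
    using choose[OF \<epsilon>] by blast
  note S = card_ext[OF R(1-3)]
  have "isum (\<lambda>i. s i * w X i) \<le> ennreal (\<Sum>i\<in>T0 \<union> R. s i)"
    by (rule minimizer_le[OF X S(1,3,2)])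
  moreover have "(\<Sum>i\<in>T0 \<union> R. s i) \<le> a + \<delta> / 2"
  proof -
    have "(\<Sum>i\<in>R. s i) \<le> (\<Sum>i\<in>R. 1 + \<epsilon>)" using R(4) by (intro sum_mono) (auto intro: less_imp_le)
    also have "\<dots> = real (card R) + real (card R) * \<epsilon>" by (simp add: algebra_simps)
    also have "real (card R) * \<epsilon> \<le> real k * \<epsilon>" using R(3) \<epsilon> by (intro mult_right_mono) auto
    also have "real k * \<epsilon> = \<delta> / 2" using k(1) by (simp add: \<epsilon>_def)
    finally show ?thesis
      unfolding sum.union_disjoint[OF T0(1) R(1) S(4)] a_def R(3) by simp
  qed
  then have "ennreal (\<Sum>i\<in>T0 \<union> R. s i) \<le> ennreal (a + \<delta> / 2)" by (rule ennreal_leI)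
  ultimately have "ennreal a + ennreal \<delta> \<le> ennreal (a + \<delta> / 2)" by (meson order_trans)
  then have "ennreal (a + \<delta>) \<le> ennreal (a + \<delta> / 2)" using a0 \<delta> by (simp add: ennreal_plus)
  then show False using a0 \<delta> by (simp add: ennreal_le_iff)
qed


section \<open>The minimizers\<close>

text \<open>An eigenvector \<open>x\<close> for \<open>r \<noteq> 0\<close> is the image of \<open>x / r\<close> under \<open>|F|\<close>, hence in \<open>N\<close>, and orthogonal
  to all eigenvectors for other eigenvalues.\<close>

lemma eigenspace_iff:
  assumes r: "r > 0"
  shows "x \<in> eigenspace (abs_op F) r \<longleftrightarrow> x \<in> N \<and> (\<forall>i\<in>I. s i \<noteq> r \<longrightarrow> cinner x (g i) = 0)"
proof -
  note A = abs_op_facts[OF F]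
  have range_N: "abs_op F y \<in> N" for y
    unfolding closure_range_abs_op[OF F, symmetric] by (rule subsetD[OF closure_subset rangeI])
  have cA: "cinner (abs_op F x) (g i) = s i * cinner x (g i)" if "i \<in> I" for i
    by (simp add: A(2) eigen[OF that] cinner_scaleR_right)
  show ?thesis
  proof (intro iffI conjI ballI impI)
    assume "x \<in> eigenspace (abs_op F) r"
    then have x: "abs_op F x = r *\<^sub>R x" by (simp add: eigenspace_def kernel_def)
    then have "x = abs_op F (inverse r *\<^sub>R x)" using r by (simp add: bounded_clinearD[OF A(1)])
    then show "x \<in> N" using range_N by metis
    fix i assume i: "i \<in> I" "s i \<noteq> r"
    have "s i * cinner x (g i) = r * cinner x (g i)"
      using cA[OF i(1)] by (auto simp: x cinner_scaleR_left)
    moreover have "complex_of_real (s i) \<noteq> complex_of_real r" using i(2) by simp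
    ultimately show "cinner x (g i) = 0" unfolding mult_cancel_right by blast
  next
    assume x: "x \<in> N \<and> (\<forall>i\<in>I. s i \<noteq> r \<longrightarrow> cinner x (g i) = 0)"
    have "abs_op F x - r *\<^sub>R x = 0"
    proof (rule onbD(5)[OF onb_g])
      show "abs_op F x - r *\<^sub>R x \<in> N"
        using x by (intro csubspaceD(3,6)[OF csubspace_ortho_compl] range_N) simp
      fix b assume "b \<in> g ` I"
      then obtain i where i: "i \<in> I" "b = g i" by blast
      then show "cinner (abs_op F x - r *\<^sub>R x) b = 0"
        using x cA[OF i(1)] by (cases "s i = r") (auto simp: cinner_diff_left cinner_scaleR_left)
    qed
    then show "x \<in> eigenspace (abs_op F) r" by (simp add: eigenspace_def kernel_def)
  qed
qed

lemma onb_eigenspace: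
  assumes r: "r > 0" shows "onb (g ` {i \<in> I. s i = r}) (eigenspace (abs_op F) r)"
  unfolding onb_def
proof (intro conjI ballI impI)
  have scale: "bounded_clinear (\<lambda>x::ell2. r *\<^sub>R x)"
  proof (rule bounded_clinearI)
    show "norm (r *\<^sub>R x) \<le> \<bar>r\<bar> * norm x" for x :: ell2 by simp
    show "r *\<^sub>R (a *\<^sub>C x) = a *\<^sub>C (r *\<^sub>R x)" for a and x :: ell2
      by (simp add: scaleR_scaleC scaleC_scaleC mult.commute)
  qed (rule scaleR_add_right)
  note lin = bounded_clinear_diff[OF abs_op_facts(1)[OF F] scale]
  show "csubspace (eigenspace (abs_op F) r)" "closed (eigenspace (abs_op F) r)"
    unfolding eigenspace_def by (intro csubspace_kernel closed_kernel lin)+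
  show "orthonormal (g ` {i \<in> I. s i = r})" by (rule orthonormal_g) auto
  show "g ` {i \<in> I. s i = r} \<subseteq> eigenspace (abs_op F) r"
    by (auto simp: eigenspace_def kernel_def eigen)
  fix x assume x: "x \<in> eigenspace (abs_op F) r" "\<forall>b\<in>g ` {i \<in> I. s i = r}. cinner x b = 0"
  then show "x = 0"
    using x(1)[unfolded eigenspace_iff[OF r]] by (intro onbD(5)[OF onb_g]) auto
qed

text \<open>Closure of \<open>A\<close> under equality of singular values guarantees that the \<open>g\<^sub>j\<close>, \<open>j \<in> A\<close>, span the
  eigenspaces in question.\<close>

lemma projection_onto_eigenspaces:
  assumes A: "finite A" "A \<subseteq> I" and full: "\<And>i j. i \<in> A \<Longrightarrow> j \<in> I \<Longrightarrow> s j = s i \<Longrightarrow> j \<in> A"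
  shows "projection_onto (closure (cspan (\<Union>j\<in>A. eigenspace (abs_op F) (s j)))) = coord_proj A"
proof (rule projection_onto_eqI)
  note E = coord_proj[OF A]
  show "orth_projection (coord_proj A)" by (rule E(1))
  have "closed (cspan (g ` A))" using closed_range_projection[OF E(1)] by (simp add: E(2))
  moreover have "eigenspace (abs_op F) (s j) \<subseteq> cspan (g ` A)" if j: "j \<in> A" for j
  proof -
    have sub: "{i \<in> I. s i = s j} \<subseteq> A" using full[OF j] by blast
    have "eigenspace (abs_op F) (s j) = cspan (g ` {i \<in> I. s i = s j})"
      using finite_onb_span[OF onb_eigenspace] s_pos j A finite_subset[OF sub A(1)] by auto
    also have "\<dots> \<subseteq> cspan (g ` A)" using sub by (intro complex_vector.span_mono image_mono)
    finally show ?thesis .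
  qed
  then have "cspan (\<Union>j\<in>A. eigenspace (abs_op F) (s j)) \<subseteq> cspan (g ` A)"
    by (intro complex_vector.span_minimal complex_vector.subspace_span) blast
  ultimately have "closure (cspan (\<Union>j\<in>A. eigenspace (abs_op F) (s j))) \<subseteq> cspan (g ` A)"
    by (intro closure_minimal)
  moreover have "g ` A \<subseteq> (\<Union>j\<in>A. eigenspace (abs_op F) (s j))"
    using A(2) by (auto simp: eigenspace_def kernel_def eigen subset_iff)
  then have "cspan (g ` A) \<subseteq> closure (cspan (\<Union>j\<in>A. eigenspace (abs_op F) (s j)))"
    by (meson closure_subset complex_vector.span_mono order_trans)
  ultimately show "range (coord_proj A) = closure (cspan (\<Union>j\<in>A. eigenspace (abs_op F) (s j)))"
    unfolding E(2) by (rule antisym[rotated])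
qed

definition eigen_projections :: "real \<Rightarrow> nat \<Rightarrow> (ell2 \<Rightarrow> ell2) set" where
  "eigen_projections t r =
     {E. orth_projection E \<and> range E \<subseteq> eigenspace (abs_op F) t \<and> has_rank E r}"

text \<open>An orthonormal set of full cardinality in the eigenspace is a basis, so both ranges are the whole
  eigenspace.\<close>

lemma eigen_projections_singleton:
  assumes t: "t > 0" and B: "finite {i \<in> I. s i = t}" and r: "card {i \<in> I. s i = t} = r"
    and E: "E \<in> eigen_projections t r" and E': "E' \<in> eigen_projections t r"
  shows "E = E'"
proof -
  let ?B = "{i \<in> I. s i = t}"
  have full: "range E = eigenspace (abs_op F) t" if E: "E \<in> eigen_projections t r" for E
  proof -
    have pE: "orth_projection E" and sub: "range E \<subseteq> eigenspace (abs_op F) t" and "has_rank E r"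
      using E by (auto simp: eigen_projections_def)
    then obtain V where V: "onb V (range E)" "finite V" "card V = r"
      unfolding has_rank_iff_onb[OF pE] by blast
    note eB = onb_eigenspace[OF t]
    obtain C where C: "V \<subseteq> C" "onb C (eigenspace (abs_op F) t)"
      using extend_to_onb[OF onbD(1,2)[OF eB] onbD(3)[OF V(1)]] onbD(4)[OF V(1)] sub by blast
    note finC = onb_card_le[OF eB finite_imageI[OF B] onbD(3,4)[OF C(2)]]
    have "card C \<le> card V" using finC(2) card_image_le[OF B, of g] r V(3) by linarith
    then have "V = C" using C(1) finC(1) by (intro card_seteq) auto
    then show ?thesis using finite_onb_span[OF V(1,2)] finite_onb_span[OF C(2) finC(1)] by simp
  qed
  show ?thesis
  proof (rule orth_projection_eqI)
    show "orth_projection E" "orth_projection E'" using E E' by (auto simp: eigen_projections_def)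
    show "range E = range E'" unfolding full[OF E] full[OF E'] ..
  qed
qed

text \<open>Rotating one direction of the range inside the plane of two basis vectors gives infinitely
  many projections of the same rank.\<close>

lemma infinite_eigen_projections:
  assumes t: "t > 0" and r: "1 \<le> r"
    and B: "infinite {i \<in> I. s i = t} \<or> r < card {i \<in> I. s i = t}"
  shows "infinite (eigen_projections t r)"
proof -
  obtain B0 where B0: "B0 \<subseteq> {i \<in> I. s i = t}" "finite B0" "card B0 = Suc r"
  proof (cases "finite {i \<in> I. s i = t}")
    case True
    then have "Suc r \<le> card {i \<in> I. s i = t}" using B by simp
    then obtain Z where "Z \<subseteq> {i \<in> I. s i = t}" "card Z = Suc r" "finite Z"
      by (rule obtain_subset_with_card_n)
    then show thesis by (intro that)
  next
    case False
    then obtain Z where "finite Z" "card Z = Suc r" "Z \<subseteq> {i \<in> I. s i = t}"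
      using infinite_arbitrarily_large by blast
    then show thesis by (intro that)
  qed
  obtain a B1 where a: "B0 = insert a B1" "a \<notin> B1" "card B1 = r"
    using B0(3) card_Suc_eq[of B0 r] by auto
  have "card B1 = Suc (r - 1)" using a(3) r by simp
  then obtain b R where b: "B1 = insert b R" "b \<notin> R" "card R = r - 1"
    using card_Suc_eq[of B1 "r - 1"] by auto
  have BI: "B0 \<subseteq> I" using B0(1) by auto
  have ab: "a \<in> I" "b \<in> I" "a \<noteq> b" "R \<subseteq> I" "a \<notin> R" "finite R"
    using a b BI B0(2) by auto
  have on: "cinner (g a) (g a) = 1" "cinner (g b) (g b) = 1" "cinner (g a) (g b) = 0"
    "cinner (g b) (g a) = 0"
    using g_orthonormal ab by auto
  have eig: "g j \<in> eigenspace (abs_op F) t" if "j \<in> B0" for j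
    using onbD(4)[OF onb_eigenspace[OF t]] B0(1) that by blast
  (* The parameter c is recovered from the projection onto the span of V c as the norm of the
     projection of g a. *)
  define v where "v c = c *\<^sub>R g a + sqrt (1 - c\<^sup>2) *\<^sub>R g b" for c :: real
  define V where "V c = insert (v c) (g ` R)" for c
  define E where "E c x = (\<Sum>b\<in>V c. cinner x b *\<^sub>C b)" for c x
  have vR: "cinner (v c) x = 0" if x: "x \<in> g ` R" for c x
  proof -
    obtain j where j: "j \<in> R" "x = g j" using x by blast
    then have "cinner (g a) x = 0" "cinner (g b) x = 0"
      using ab b(2) g_orthonormal[of a j] g_orthonormal[of b j] by (auto simp: subset_iff)
    then show ?thesis by (simp add: v_def cinner_algebra)
  qed
  have vv: "cinner (v c) (v c) = 1" if c: "0 \<le> c" "c \<le> 1" for c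
  proof -
    define q where "q = sqrt (1 - c\<^sup>2)"
    have "c\<^sup>2 \<le> 1" using c by (simp add: power_le_one)
    then have "q * q = 1 - c * c" by (simp add: q_def power2_eq_square)
    then have "c * c + q * q = 1" by simp
    moreover have "v c = c *\<^sub>R g a + q *\<^sub>R g b" by (simp add: v_def q_def)
    then have "cinner (v c) (v c) = complex_of_real (c * c + q * q)" by (simp add: cinner_algebra on)
    ultimately show ?thesis by simp
  qed
  have V: "orthonormal (V c)" "finite (V c)" "card (V c) = r" if c: "0 \<le> c" "c \<le> 1" for c
  proof -
    have o1: "orthonormal {v c}" using vv[OF c] by (simp add: orthonormal_def)
    have o2: "orthonormal (g ` R)" by (rule orthonormal_g[OF ab(4)])
    have orth: "cinner x y = 0" if "x \<in> {v c}" "y \<in> g ` R" for x y using that vR by blast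
    show "orthonormal (V c)" using orthonormal_Un(1)[OF o1 o2 orth] by (simp add: V_def)
    show "finite (V c)" using ab(6) by (simp add: V_def)
    have "v c \<notin> g ` R" using orthonormal_Un(2)[OF o1 o2 orth] by blast
    then show "card (V c) = r"
      using ab(6) b(3) r card_image[OF inj_on_subset[OF inj_on_g ab(4)]] by (simp add: V_def)
  qed
  have memE: "E c \<in> eigen_projections t r" if c: "0 \<le> c" "c \<le> 1" for c
  proof -
    note P = finite_orthonormal_projection[OF V(2,1)[OF c], folded E_def]
    note S = onbD(1)[OF onb_eigenspace[OF t]]
    have "v c \<in> eigenspace (abs_op F) t"
      unfolding v_def using eig a(1) b(1) by (intro csubspaceD(2,6)[OF S]) auto
    then have "V c \<subseteq> eigenspace (abs_op F) t" using eig a(1) b(1) by (auto simp: V_def)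
    then have "range (E c) \<subseteq> eigenspace (abs_op F) t"
      unfolding P(2) by (rule complex_vector.span_minimal[OF _ S])
    moreover have "has_rank (E c) r"
      unfolding has_rank_iff_onb[OF P(1)] P(2)
      using V[OF c] onb_cspan[OF V(2,1)[OF c]] by blast
    ultimately show ?thesis using P(1) by (simp add: eigen_projections_def)
  qed
  have val: "(norm (E c (g a)))\<^sup>2 = c\<^sup>2" if c: "0 \<le> c" "c \<le> 1" for c
  proof -
    note P = finite_orthonormal_projection[OF V(2,1)[OF c], folded E_def]
    have gR: "cinner (g a) x = 0" if x: "x \<in> g ` R" for x
    proof -
      obtain j where j: "j \<in> R" "x = g j" using x by blast
      then have "j \<in> I" "a \<noteq> j" using ab(4,5) by auto
      then show ?thesis using g_orthonormal[OF ab(1), of j] by (simp add: j(2))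
    qed
    have "(norm (E c (g a)))\<^sup>2 = (\<Sum>x\<in>V c. (cmod (cinner (g a) x))\<^sup>2)" by (rule P(3))
    also have "\<dots> = (\<Sum>x\<in>{v c}. (cmod (cinner (g a) x))\<^sup>2)"
    proof (rule sum.mono_neutral_right[OF V(2)[OF c]])
      show "\<forall>x\<in>V c - {v c}. (cmod (cinner (g a) x))\<^sup>2 = 0"
      proof
        fix x assume "x \<in> V c - {v c}"
        then have "cinner (g a) x = 0" by (intro gR) (simp add: V_def)
        then show "(cmod (cinner (g a) x))\<^sup>2 = 0" by simp
      qed
    qed (simp add: V_def)
    also have "\<dots> = c\<^sup>2" by (simp add: v_def cinner_algebra on)
    finally show ?thesis .
  qed
  have "inj_on E {0..1}"
  proof (rule inj_onI)
    fix c d :: real assume "c \<in> {0..1}" "d \<in> {0..1}" "E c = E d"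
    then have c: "0 \<le> c" "c \<le> 1" and d: "0 \<le> d" "d \<le> 1" and eq: "E c = E d" by simp_all
    have "c\<^sup>2 = d\<^sup>2" using val[OF c] val[OF d] unfolding eq by (rule trans[OF sym])
    then show "c = d" using c(1) d(1) by (simp only: power2_eq_iff_nonneg)
  qed
  then have "infinite (E ` {0..1})" by (simp add: finite_image_iff infinite_Icc)
  moreover have "E ` {0..1} \<subseteq> eigen_projections t r" using memE by auto
  ultimately show ?thesis using finite_subset by blast
qed


lemma below_max_subset:
  assumes S: "lowest S" and i0: "i0 \<in> S" "s i0 = t"
  shows "{i \<in> I. s i < t} \<subseteq> S" "finite {i \<in> I. s i < t}" "card {i \<in> I. s i < t} < card S"
proof -
  show sub: "{i \<in> I. s i < t} \<subseteq> S"
  proof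
    fix i assume i: "i \<in> {i \<in> I. s i < t}"
    show "i \<in> S"
    proof (rule ccontr)
      assume "i \<notin> S"
      then have "s i0 \<le> s i" using S i i0(1) by (simp add: lowest_def)
      then show False using i i0(2) by simp
    qed
  qed
  have fin: "finite S" using S by (simp add: lowest_def)
  then show "finite {i \<in> I. s i < t}" using sub finite_subset by blast
  have "{i \<in> I. s i < t} \<subset> S" using sub i0 by auto
  then show "card {i \<in> I. s i < t} < card S" by (rule psubset_card_mono[OF fin])
qed

text \<open>With \<open>v i = \<parallel>E g\<^sub>i\<parallel>\<^sup>2 \<in> [0, 1]\<close> of total mass \<open>k\<close>, the excess of \<open>\<Sum> s\<^sub>i v\<^sub>i\<close> over its minimum is
  the sum of the nonnegative terms \<open>(t - s\<^sub>i) (1 - v\<^sub>i)\<close> for \<open>s\<^sub>i < t\<close> and \<open>(s\<^sub>i - t) v\<^sub>i\<close> for the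
  others.\<close>

lemma optimal_cut_iff:
  assumes S: "lowest S" "card S = k" and i0: "i0 \<in> S" "s i0 = t"
    and max: "\<And>i. i \<in> S \<Longrightarrow> s i \<le> t" and E: "cut k E"
  shows "isum (\<lambda>i. s i * (norm (E (g i)))\<^sup>2) = ennreal (\<Sum>i\<in>S. s i) \<longleftrightarrow>
    (\<forall>i\<in>I. s i < t \<longrightarrow> E (g i) = g i) \<and> (\<forall>i\<in>I. t < s i \<longrightarrow> E (g i) = 0)"
proof -
  define A where "A = {i \<in> I. s i < t}"
  note A = below_max_subset[OF S(1) i0, folded A_def]
  have S': "finite S" "S \<subseteq> I" using S(1) by (auto simp: lowest_def)
  have AI: "A \<subseteq> I" by (auto simp: A_def)
  have t0: "0 < t" using s_pos[of i0] i0 S'(2) by auto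
  have pE: "orth_projection E" using E by (simp add: cut_def)
  define v where "v i = (norm (E (g i)))\<^sup>2" for i
  have v: "0 \<le> v i" "v i \<le> 1" if "i \<in> I" for i
    using orth_projectionD(6)[OF pE, of "g i"] norm_g[OF that] by (auto simp: v_def power_le_one)
  have v1: "v i = 1 \<longleftrightarrow> E (g i) = g i" if "i \<in> I" for i
    using orth_projectionD(5)[OF pE, of "g i"] norm_g[OF that] by (auto simp: v_def)
  have v0: "v i = 0 \<longleftrightarrow> E (g i) = 0" for i by (simp add: v_def)
  define h where "h i = (if i \<in> A then (t - s i) * (1 - v i) else (s i - t) * v i)" for i
  have h: "0 \<le> h i" if "i \<in> I" for i
    using v[OF that] that by (auto simp: h_def A_def)
  have sumA: "(\<Sum>i\<in>S. s i) + t * card A = (\<Sum>i\<in>A. s i) + t * k"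
  proof -
    have eq: "s i = t" if "i \<in> S - A" for i
      using that max[of i] S'(2) by (force simp: A_def)
    have "(\<Sum>i\<in>S. s i) = (\<Sum>i\<in>S - A. s i) + (\<Sum>i\<in>A. s i)"
      by (rule sum.subset_diff[OF A(1) S'(1)])
    also have "(\<Sum>i\<in>S - A. s i) = (\<Sum>i\<in>S - A. t)" by (rule sum.cong) (simp_all add: eq)
    also have "\<dots> = t * (real k - real (card A))"
      using A(3) S(2) by (simp add: card_Diff_subset[OF A(2,1)] of_nat_diff)
    finally show ?thesis by (simp add: algebra_simps)
  qed
  have indA: "(\<integral>\<^sup>+i. ennreal (if i \<in> A then c i else 0) \<partial>count_space I) = ennreal (\<Sum>i\<in>A. c i)"
    if "\<And>i. i \<in> A \<Longrightarrow> 0 \<le> c i" for c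
  proof -
    have "(\<integral>\<^sup>+i. ennreal (if i \<in> A then c i else 0) \<partial>count_space I) =
        (\<Sum>i\<in>A. ennreal (if i \<in> A then c i else 0))"
      by (rule nn_integral_count_space'[OF A(2) _ AI]) simp
    also have "\<dots> = (\<Sum>i\<in>A. ennreal (c i))" by (intro sum.cong) auto
    finally show ?thesis using that by (simp add: sum_ennreal)
  qed
  have sA: "0 \<le> s i" if "i \<in> A" for i using s_pos[of i] that AI by auto
  have "isum (\<lambda>i. s i * v i) + ennreal (t * card A) =
      isum (\<lambda>i. s i * v i) + (\<integral>\<^sup>+i. ennreal (if i \<in> A then t else 0) \<partial>count_space I)"
    using t0 by (subst indA) (auto simp: mult.commute)
  also have "\<dots> = (\<integral>\<^sup>+i. ennreal (s i * v i) + ennreal (if i \<in> A then t else 0) \<partial>count_space I)"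
    by (simp add: nn_integral_add)
  also have "\<dots> = (\<integral>\<^sup>+i. ennreal (h i) + (ennreal (if i \<in> A then s i else 0) + ennreal t * ennreal (v i))
      \<partial>count_space I)"
  proof (rule nn_integral_cong)
    fix i assume "i \<in> space (count_space I)"
    then have i: "i \<in> I" by simp
    have pos: "0 \<le> s i * v i" "0 \<le> t * v i" "0 \<le> (if i \<in> A then t else 0)" "0 \<le> (if i \<in> A then s i else 0)"
      using s_pos[OF i] v[OF i] t0 by auto
    have "s i * v i + (if i \<in> A then t else 0) = h i + ((if i \<in> A then s i else 0) + t * v i)"
      by (simp add: h_def algebra_simps)
    then have "ennreal (s i * v i + (if i \<in> A then t else 0)) =
        ennreal (h i + ((if i \<in> A then s i else 0) + t * v i))" by (simp only:)
    moreover have "ennreal (s i * v i + (if i \<in> A then t else 0)) =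
        ennreal (s i * v i) + ennreal (if i \<in> A then t else 0)"
      by (rule ennreal_plus[OF pos(1,3)])
    moreover have "ennreal (h i + ((if i \<in> A then s i else 0) + t * v i)) =
        ennreal (h i) + (ennreal (if i \<in> A then s i else 0) + ennreal (t * v i))"
      using ennreal_plus[OF h[OF i] add_nonneg_nonneg[OF pos(4,2)]] ennreal_plus[OF pos(4,2)]
      by (simp only:)
    moreover have "ennreal (t * v i) = ennreal t * ennreal (v i)"
      using t0 v(1)[OF i] by (simp add: ennreal_mult)
    ultimately show "ennreal (s i * v i) + ennreal (if i \<in> A then t else 0) =
        ennreal (h i) + (ennreal (if i \<in> A then s i else 0) + ennreal t * ennreal (v i))"
      by (simp only:)
  qed
  also have "\<dots> = isum h + ((\<integral>\<^sup>+i. ennreal (if i \<in> A then s i else 0) \<partial>count_space I) +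
      ennreal t * isum v)"
    by (simp add: nn_integral_add nn_integral_cmult)
  also have "(\<integral>\<^sup>+i. ennreal (if i \<in> A then s i else 0) \<partial>count_space I) = ennreal (\<Sum>i\<in>A. s i)"
    by (rule indA[OF sA])
  also have "isum v = of_nat k" unfolding v_def by (rule isum_norm_cut[OF E])
  also have "ennreal (\<Sum>i\<in>A. s i) + ennreal t * of_nat k = ennreal ((\<Sum>i\<in>S. s i) + t * card A)"
    unfolding sumA using t0 sA
    by (simp add: ennreal_plus sum_nonneg ennreal_mult ennreal_of_nat_eq_real_of_nat)
  also have "\<dots> = ennreal (\<Sum>i\<in>S. s i) + ennreal (t * card A)"
    using t0 s_pos S'(2) by (intro ennreal_plus sum_nonneg) (auto intro: less_imp_le)
  finally have "ennreal (t * card A) + isum (\<lambda>i. s i * v i) =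
      ennreal (t * card A) + (ennreal (\<Sum>i\<in>S. s i) + isum h)"
    by (simp add: add_ac)
  then have Z: "isum (\<lambda>i. s i * v i) = ennreal (\<Sum>i\<in>S. s i) + isum h"
    by (simp add: ennreal_add_left_cancel)
  have "isum (\<lambda>i. s i * v i) = ennreal (\<Sum>i\<in>S. s i) \<longleftrightarrow>
      ennreal (\<Sum>i\<in>S. s i) + isum h = ennreal (\<Sum>i\<in>S. s i) + 0"
    unfolding Z by simp
  also have "\<dots> \<longleftrightarrow> isum h = 0" unfolding ennreal_add_left_cancel by simp
  also have "\<dots> \<longleftrightarrow> (\<forall>i\<in>I. h i = 0)"
    using h by (subst nn_integral_0_iff_AE) (auto simp: AE_count_space ennreal_eq_0_iff antisym)
  also have "\<dots> \<longleftrightarrow> (\<forall>i\<in>I. (s i < t \<longrightarrow> E (g i) = g i) \<and> (t < s i \<longrightarrow> E (g i) = 0))"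
  proof (rule ball_cong[OF refl])
    fix i assume i: "i \<in> I"
    show "h i = 0 \<longleftrightarrow> (s i < t \<longrightarrow> E (g i) = g i) \<and> (t < s i \<longrightarrow> E (g i) = 0)"
      unfolding v1[OF i, symmetric] v0[symmetric] using i by (auto simp: h_def A_def)
  qed
  finally show ?thesis unfolding v_def by blast
qed

text \<open>The conditions on the left make \<open>E\<close> commute with \<open>E\<^sub>0\<close> and the range of \<open>E - E\<^sub>0\<close> orthogonal to all
  \<open>g\<^sub>i\<close> with \<open>s\<^sub>i \<noteq> t\<close>; so this difference is a projection into the eigenspace of \<open>t\<close>. Conversely such
  a projection is orthogonal to \<open>E\<^sub>0\<close>. The ranks add up because a basis of the range of \<open>E\<close> consists of
  the \<open>g\<^sub>i\<close> with \<open>s\<^sub>i < t\<close> and a basis of the range of the difference.\<close>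

lemma optimal_cut_decomposition:
  assumes t: "t > 0" and A_def: "A = {i \<in> I. s i < t}" and A: "finite A" "card A \<le> k"
  shows "cut k E \<and> (\<forall>i\<in>I. s i < t \<longrightarrow> E (g i) = g i) \<and> (\<forall>i\<in>I. t < s i \<longrightarrow> E (g i) = 0) \<longleftrightarrow>
    (\<exists>E1\<in>eigen_projections t (k - card A). E = (\<lambda>x. coord_proj A x + E1 x))"
proof
  have AI: "A \<subseteq> I" by (auto simp: A_def)
  note E0 = coord_proj[OF A(1) AI]
  have lin0: "bounded_clinear (coord_proj A)" by (rule orth_projectionD(1)[OF E0(1)])
  have cardA: "card (g ` A) = card A" by (rule E0(5))
  {
    assume "cut k E \<and> (\<forall>i\<in>I. s i < t \<longrightarrow> E (g i) = g i) \<and> (\<forall>i\<in>I. t < s i \<longrightarrow> E (g i) = 0)"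
    then have pE: "orth_projection E" and sub: "range E \<subseteq> N" and rank: "has_rank E k"
      and EA: "\<And>i. i \<in> A \<Longrightarrow> E (g i) = g i" and Eup: "\<And>i. i \<in> I \<Longrightarrow> t < s i \<Longrightarrow> E (g i) = 0"
      by (auto simp: cut_def A_def)
    note linE = orth_projectionD(1)[OF pE]
    have EE0: "E (coord_proj A x) = coord_proj A x" for x
    proof -
      have "E (coord_proj A x) = (\<Sum>b\<in>g ` A. cinner x b *\<^sub>C E b)"
        unfolding coord_proj_def by (simp add: bounded_clinearD[OF linE])
      also have "\<dots> = coord_proj A x"
        unfolding coord_proj_def by (intro sum.cong) (auto simp: EA)
      finally show ?thesis .
    qed
    have E0E: "coord_proj A (E x) = coord_proj A x" for x
      by (rule cinner_left_unique)
        (simp only: orth_projectionD(3)[OF pE] orth_projectionD(3)[OF E0(1)] EE0)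
    define E1 where "E1 x = E x - coord_proj A x" for x
    have pE1: "orth_projection E1"
      unfolding orth_projection_def
    proof (intro conjI allI)
      show "bounded_clinear E1" unfolding E1_def by (rule bounded_clinear_diff[OF linE lin0])
      show "E1 \<circ> E1 = E1"
        by (auto simp: fun_eq_iff E1_def bounded_clinearD(2)[OF linE] bounded_clinearD(2)[OF lin0]
            EE0 E0E orth_projectionD(2)[OF pE] orth_projectionD(2)[OF E0(1)])
      show "cinner (E1 x) y = cinner x (E1 y)" for x y
        by (simp add: E1_def cinner_diff_left cinner_diff_right orth_projectionD(3)[OF pE]
            orth_projectionD(3)[OF E0(1)])
    qed
    have E1g: "E1 (g i) = 0" if "i \<in> I" "s i \<noteq> t" for i
    proof (cases "i \<in> A")
      case True
      then show ?thesis using EA[OF True] E0(3)[OF that(1)] by (simp add: E1_def)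
    next
      case False
      then have "t < s i" using that by (auto simp: A_def)
      then show ?thesis using False Eup[OF that(1)] E0(3)[OF that(1)] by (simp add: E1_def)
    qed
    have ran: "range E1 \<subseteq> eigenspace (abs_op F) t"
    proof
      fix y assume "y \<in> range E1"
      then obtain x where y: "y = E1 x" by blast
      have "E x \<in> N" "coord_proj A x \<in> N" using sub E0(6) by blast+
      then have "y \<in> N" unfolding y E1_def by (rule csubspaceD(3)[OF csubspace_ortho_compl])
      moreover have "cinner y (g i) = 0" if "i \<in> I" "s i \<noteq> t" for i
        unfolding y orth_projectionD(3)[OF pE1] by (simp add: E1g that)
      ultimately show "y \<in> eigenspace (abs_op F) t" unfolding eigenspace_iff[OF t] by blast
    qed
    have gA: "g ` A \<subseteq> range E"
    proof
      fix b assume "b \<in> g ` A"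
      then have "b = E b" using EA by auto
      then show "b \<in> range E" by (rule range_eqI)
    qed
    obtain V where V: "g ` A \<subseteq> V" "onb V (range E)"
      by (rule extend_to_onb[OF csubspace_range_projection[OF pE] closed_range_projection[OF pE]
            orthonormal_g[OF AI] gA])
    have finV: "finite V" using rank finite_onb_iff[OF V(2)] by (simp add: has_rank_def)
    have cardV: "card V = k" using rank finite_onb_dim(2)[OF V(2) finV] by (simp add: has_rank_def)
    have "onb (V - g ` A) (range E1)"
      unfolding onb_def
    proof (intro conjI ballI impI csubspace_range_projection closed_range_projection pE1)
      show "orthonormal (V - g ` A)" by (rule orthonormal_subset[OF onbD(3)[OF V(2)] Diff_subset])
      show "V - g ` A \<subseteq> range E1"
      proof
        fix x assume x: "x \<in> V - g ` A"
        have "cinner x b = 0" if "b \<in> g ` A" for b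
          using x that V(1) orthonormalD(3)[OF onbD(3)[OF V(2)]] by blast
        then have "coord_proj A x = 0" unfolding coord_proj_def by (intro sum.neutral) simp
        moreover have "E x = x"
          using x onbD(4)[OF V(2)] range_orth_projection[OF pE] by blast
        ultimately have "x = E1 x" by (simp add: E1_def)
        then show "x \<in> range E1" by (rule range_eqI)
      qed
      fix x assume x: "x \<in> range E1" "\<forall>b\<in>V - g ` A. cinner x b = 0"
      have fix1: "E1 x = x" using x(1) range_orth_projection[OF pE1] by blast
      have "E (E1 x) = E1 x"
        by (simp add: E1_def bounded_clinearD(2)[OF linE] EE0 orth_projectionD(2)[OF pE])
      then have "x = E x" unfolding fix1 by simp
      then have xE: "x \<in> range E" by (rule range_eqI)
      show "x = 0"
      proof (rule onbD(5)[OF V(2) xE])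
        fix b assume b: "b \<in> V"
        show "cinner x b = 0"
        proof (cases "b \<in> g ` A")
          case True
          then obtain i where i: "i \<in> A" "b = g i" by blast
          then have "E1 b = 0" using E1g[of i] by (simp add: A_def)
          then have "cinner (E1 x) b = 0" by (simp add: orth_projectionD(3)[OF pE1])
          then show ?thesis by (simp only: fix1)
        next
          case False
          then show ?thesis using x(2) b by blast
        qed
      qed
    qed
    moreover have "card (V - g ` A) = k - card A"
      using card_Diff_subset[OF finite_imageI[OF A(1)] V(1)] by (simp add: cardA cardV)
    ultimately have "has_rank E1 (k - card A)"
      unfolding has_rank_iff_onb[OF pE1] using finV by blast
    then have "E1 \<in> eigen_projections t (k - card A)"
      using pE1 ran by (simp add: eigen_projections_def)
    then show "\<exists>E1\<in>eigen_projections t (k - card A). E = (\<lambda>x. coord_proj A x + E1 x)"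
      by (rule rev_bexI) (simp add: E1_def)
  }
  {
    assume "\<exists>E1\<in>eigen_projections t (k - card A). E = (\<lambda>x. coord_proj A x + E1 x)"
    then obtain E1 where pE1: "orth_projection E1" and ran: "range E1 \<subseteq> eigenspace (abs_op F) t"
      and rank: "has_rank E1 (k - card A)" and E: "E = (\<lambda>x. coord_proj A x + E1 x)"
      by (auto simp: eigen_projections_def)
    note lin1 = orth_projectionD(1)[OF pE1]
    have E1_eig: "E1 x \<in> N" "\<And>i. i \<in> I \<Longrightarrow> s i \<noteq> t \<Longrightarrow> cinner (E1 x) (g i) = 0" for x
      using subsetD[OF ran rangeI[of E1 x]] unfolding eigenspace_iff[OF t] by blast+
    have E1g: "E1 (g i) = 0" if "i \<in> I" "s i \<noteq> t" for i
      by (rule cinner_right_unique) (simp add: E1_eig(2)[OF that] flip: orth_projectionD(3)[OF pE1])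
    have sA: "i \<in> I" "s i \<noteq> t" if "i \<in> A" for i using that by (auto simp: A_def)
    have E0E1: "coord_proj A (E1 x) = 0" for x
      unfolding coord_proj_def by (intro sum.neutral) (auto simp: E1_eig(2) sA)
    have E1E0: "E1 (coord_proj A x) = 0" for x
      unfolding coord_proj_def bounded_clinearD(7)[OF lin1] bounded_clinearD(3)[OF lin1]
      by (intro sum.neutral) (auto simp: E1g sA)
    have pE: "orth_projection E"
      unfolding orth_projection_def E
    proof (intro conjI allI)
      show "bounded_clinear (\<lambda>x. coord_proj A x + E1 x)" by (rule bounded_clinear_add[OF lin0 lin1])
      show "(\<lambda>x. coord_proj A x + E1 x) \<circ> (\<lambda>x. coord_proj A x + E1 x) = (\<lambda>x. coord_proj A x + E1 x)"
        by (auto simp: fun_eq_iff bounded_clinearD(1)[OF lin0] bounded_clinearD(1)[OF lin1]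
            E0E1 E1E0 orth_projectionD(2)[OF pE1] orth_projectionD(2)[OF E0(1)])
      show "cinner (coord_proj A x + E1 x) y = cinner x (coord_proj A y + E1 y)" for x y
        by (simp add: cinner_add_left cinner_add_right orth_projectionD(3)[OF pE1]
            orth_projectionD(3)[OF E0(1)])
    qed
    have sub: "range E \<subseteq> N"
      using E0(6) E1_eig(1) by (auto simp: E intro!: csubspaceD(2)[OF csubspace_ortho_compl])
    obtain V where V: "onb V (range E1)" "finite V" "card V = k - card A"
      using rank unfolding has_rank_iff_onb[OF pE1] by blast
    have V_fix: "E1 v = v" if "v \<in> V" for v
      using that onbD(4)[OF V(1)] range_orth_projection[OF pE1] by blast
    have orth: "cinner b v = 0" if bv: "b \<in> g ` A" "v \<in> V" for b v
    proof -
      have "E1 b = 0" using bv(1) by (auto simp: E1g sA)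
      then have "cinner b (E1 v) = 0" by (simp flip: orth_projectionD(3)[OF pE1])
      then show ?thesis by (simp only: V_fix[OF bv(2)])
    qed
    note on = orthonormal_Un[OF orthonormal_g[OF AI] onbD(3)[OF V(1)] orth]
    have "onb (g ` A \<union> V) (range E)"
      unfolding onb_def
    proof (intro conjI ballI impI csubspace_range_projection closed_range_projection pE on(1))
      show "g ` A \<union> V \<subseteq> range E"
      proof
        fix x assume x: "x \<in> g ` A \<union> V"
        have "x = E x"
        proof (cases "x \<in> V")
          case True
          have "coord_proj A x = 0" using E0E1[of x] by (simp only: V_fix[OF True])
          then show ?thesis by (simp add: E V_fix[OF True])
        next
          case False
          then obtain i where i: "i \<in> A" "x = g i" using x by blast
          then show ?thesis by (simp add: E E0(3) sA E1g)
        qed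
        then show "x \<in> range E" by (rule range_eqI)
      qed
      fix x assume x: "x \<in> range E" "\<forall>b\<in>g ` A \<union> V. cinner x b = 0"
      have "coord_proj A x = 0" unfolding coord_proj_def by (intro sum.neutral) (use x(2) in simp)
      moreover have "E x = x" using x(1) range_orth_projection[OF pE] by blast
      ultimately have "x = E1 x" by (simp add: E)
      then have "x \<in> range E1" by (rule range_eqI)
      then show "x = 0" by (rule onbD(5)[OF V(1)]) (use x(2) in blast)
    qed
    moreover have "card (g ` A \<union> V) = k"
      using card_Un_disjoint[OF finite_imageI[OF A(1)] V(2) on(2)] V(3) A(2) by (simp add: cardA)
    ultimately have "has_rank E k" unfolding has_rank_iff_onb[OF pE] using A(1) V(2) by blast
    then have "cut k E" using pE sub by (simp add: cut_def)
    moreover have "E (g i) = g i" if "i \<in> I" "s i < t" for i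
      using that E1g[of i] E0(3)[of i] by (simp add: E A_def)
    moreover have "E (g i) = 0" if "i \<in> I" "t < s i" for i
      using that E1g[of i] E0(3)[of i] by (simp add: E A_def)
    ultimately show "cut k E \<and> (\<forall>i\<in>I. s i < t \<longrightarrow> E (g i) = g i) \<and> (\<forall>i\<in>I. t < s i \<longrightarrow> E (g i) = 0)"
      by blast
  }
qed

lemma close_parseval_frames_index_iff:
  assumes f: "F = synthesis f" "\<And>i. F (std_basis i) = f i"
  shows "x \<in> close_parseval_frames_index f (int k) \<longleftrightarrow>
    (\<exists>X. admissible k X \<and> x = (\<lambda>i. X (std_basis i)))"
proof -
  have syn: "synthesis (\<lambda>i. X (std_basis i)) = X" if "partial_isometry X" for X :: "ell2 \<Rightarrow> 'h"
    by (rule synthesis_eqI[OF partial_isometry_linear[OF that]]) simp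
  note iff = close_parseval_frames_iff[of F, OF f(2)]
  show ?thesis
  proof
    assume x: "x \<in> close_parseval_frames_index f (int k)"
    then have "x \<in> close_parseval_frames f" by (simp add: close_parseval_frames_index_def)
    then obtain X where X: "partial_isometry X" "synthesis x = X" "x = (\<lambda>i. X (std_basis i))"
      "std_hs (\<lambda>v. F v - X v) < top" unfolding iff by blast
    then have "admissible k X"
      using x unfolding close_parseval_frames_index_def admissible_def Let_def f(1)[symmetric] by simp
    then show "\<exists>X. admissible k X \<and> x = (\<lambda>i. X (std_basis i))" using X(3) by blast
  next
    assume "\<exists>X. admissible k X \<and> x = (\<lambda>i. X (std_basis i))"
    then obtain X where X: "admissible k X" "x = (\<lambda>i. X (std_basis i))" by blast
    have syn_x: "synthesis x = X" unfolding X(2) using X(1) by (intro syn) (simp add: admissible_def)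
    then have "x \<in> close_parseval_frames f"
      unfolding iff using X by (intro exI[of _ X]) (simp add: admissible_def)
    then show "x \<in> close_parseval_frames_index f (int k)"
      unfolding close_parseval_frames_index_def Let_def f(1)[symmetric] syn_x mem_Collect_eq
      using X(1) by (simp add: admissible_def)
  qed
qed

text \<open>The distance to be minimized is the Hilbert--Schmidt distance from \<open>F\<close>, and on \<open>Q\<^sub>F\<^sup>k\<close> it is ordered
  like the weighted sum of defects.\<close>

lemma symmetric_approximation_iff:
  assumes f: "F = synthesis f" "\<And>i. F (std_basis i) = f i"
  shows "symmetric_approximation f (close_parseval_frames_index f (int k)) y \<longleftrightarrow>
    (\<exists>X. minimizer k X \<and> y = (\<lambda>i. X (std_basis i)))"
proof -
  have dist: "summable (\<lambda>i. (norm (f i - X (std_basis i)))\<^sup>2)"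
    "std_hs (\<lambda>x. F x - X x) = ennreal (\<Sum>i. (norm (f i - X (std_basis i)))\<^sup>2)"
    if "admissible k X" for X
    using that std_hs_summable[of "\<lambda>x. F x - X x"] by (auto simp: admissible_def f(2))
  have le: "(\<Sum>i. (norm (f i - X (std_basis i)))\<^sup>2) \<le> (\<Sum>i. (norm (f i - Y (std_basis i)))\<^sup>2) \<longleftrightarrow>
      isum (\<lambda>i. s i * w X i) \<le> isum (\<lambda>i. s i * w Y i)"
    if "admissible k X" "admissible k Y" for X Y
    unfolding cost_le_iff[OF that, symmetric] dist(2)[OF that(1)] dist(2)[OF that(2)]
    by (rule ennreal_le_iff[symmetric]) (intro suminf_nonneg dist(1)[OF that(2)], simp)
  show ?thesis
  proof
    assume y: "symmetric_approximation f (close_parseval_frames_index f (int k)) y"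
    then have "y \<in> close_parseval_frames_index f (int k)"
      by (simp add: symmetric_approximation_def)
    then obtain X where X: "admissible k X" "y = (\<lambda>i. X (std_basis i))"
      unfolding close_parseval_frames_index_iff[OF f] by blast
    have "isum (\<lambda>i. s i * w X i) \<le> isum (\<lambda>i. s i * w Y i)" if Y: "admissible k Y" for Y
    proof -
      have mem: "(\<lambda>i. Y (std_basis i)) \<in> close_parseval_frames_index f (int k)"
        unfolding close_parseval_frames_index_iff[OF f] using Y by blast
      have "\<forall>x\<in>close_parseval_frames_index f (int k).
          summable (\<lambda>i. (norm (f i - x i))\<^sup>2) \<longrightarrow>
          (\<Sum>i. (norm (f i - X (std_basis i)))\<^sup>2) \<le> (\<Sum>i. (norm (f i - x i))\<^sup>2)"
        using y unfolding symmetric_approximation_def X(2) by (elim conjE)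
      from mp[OF bspec[OF this mem] dist(1)[OF Y]]
      have "(\<Sum>i. (norm (f i - X (std_basis i)))\<^sup>2) \<le> (\<Sum>i. (norm (f i - Y (std_basis i)))\<^sup>2)" .
      then show ?thesis unfolding le[OF X(1) Y] .
    qed
    then show "\<exists>X. minimizer k X \<and> y = (\<lambda>i. X (std_basis i))"
      using X unfolding minimizer_def by blast
  next
    assume "\<exists>X. minimizer k X \<and> y = (\<lambda>i. X (std_basis i))"
    then obtain X where X: "admissible k X" "y = (\<lambda>i. X (std_basis i))"
      and min: "\<And>Y. admissible k Y \<Longrightarrow> isum (\<lambda>i. s i * w X i) \<le> isum (\<lambda>i. s i * w Y i)"
      unfolding minimizer_def by blast
    show "symmetric_approximation f (close_parseval_frames_index f (int k)) y"
      unfolding symmetric_approximation_def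
    proof (intro conjI ballI impI)
      show "y \<in> close_parseval_frames_index f (int k)"
        unfolding close_parseval_frames_index_iff[OF f] using X by blast
      show "summable (\<lambda>i. (norm (f i - y i))\<^sup>2)" unfolding X(2) by (rule dist(1)[OF X(1)])
      fix x assume "x \<in> close_parseval_frames_index f (int k)"
      then obtain Y where Y: "admissible k Y" "x = (\<lambda>i. Y (std_basis i))"
        unfolding close_parseval_frames_index_iff[OF f] by blast
      show "(\<Sum>i. (norm (f i - y i))\<^sup>2) \<le> (\<Sum>i. (norm (f i - x i))\<^sup>2)"
        unfolding X(2) Y(2) le[OF X(1) Y(1)] by (rule min[OF Y(1)])
    qed
  qed
qed

lemma lowest_imp_minimizer:
  assumes S: "lowest S" "card S = k" shows "minimizer k (truncation (coord_proj S))"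
proof -
  have fin: "finite S" "S \<subseteq> I" using S by (auto simp: lowest_def)
  show ?thesis
    unfolding minimizer_def cost_coord_proj[OF fin]
    using admissible_truncation[OF cut_coord_proj[OF fin]] cost_lower_bound[OF _ S] S(2) by simp
qed

text \<open>The polar part \<open>U\<close> is injective on \<open>N\<close>, which contains the ranges of these projections.\<close>

lemma inj_on_approximations:
  assumes t: "t > 0" and lin: "bounded_clinear E0"
  shows "inj_on (\<lambda>E1 i. U (std_basis i) - U (E0 (std_basis i) + E1 (std_basis i)))
    (eigen_projections t r)"
proof (rule inj_onI)
  fix E E' assume E: "E \<in> eigen_projections t r" and E': "E' \<in> eigen_projections t r"
    and eq: "(\<lambda>i. U (std_basis i) - U (E0 (std_basis i) + E (std_basis i))) =
      (\<lambda>i. U (std_basis i) - U (E0 (std_basis i) + E' (std_basis i)))"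
  have lE: "bounded_clinear E" "bounded_clinear E'"
    using E E' orth_projectionD(1) by (auto simp: eigen_projections_def)
  have "U \<circ> E = U \<circ> E'"
  proof (rule ell2_operator_eqI[OF bounded_clinear_compose[OF bounded_clinear_U lE(1)]
        bounded_clinear_compose[OF bounded_clinear_U lE(2)]])
    fix i
    show "(U \<circ> E) (std_basis i) = (U \<circ> E') (std_basis i)"
      using fun_cong[OF eq, of i] by (simp add: bounded_clinearD(1)[OF bounded_clinear_U])
  qed
  then have UE: "U (E x) = U (E' x)" for x by (metis comp_apply)
  have in_N: "G x \<in> N" if "G \<in> eigen_projections t r" for G x
  proof -
    have "G x \<in> eigenspace (abs_op F) t" using that by (auto simp: eigen_projections_def)
    then show ?thesis unfolding eigenspace_iff[OF t] by blast
  qed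
  have "E x \<in> N" "E' x \<in> N" for x by (rule in_N[OF E], rule in_N[OF E'])
  then show "E = E'" using UE polar_part_on_N(1) by (metis ext)
qed

end


text \<open>By monotonicity, the condition on the last index \<open>k\<close> extends to all of them.\<close>

lemma smallest_terms_iff:
  assumes k: "1 \<le> k"
  shows "smallest_terms \<alpha> s k n \<longleftrightarrow> n ` {1..k} \<subseteq> index_set \<alpha> \<and> inj_on n {1..k} \<and>
    (\<forall>i\<in>{1..k}. \<forall>j\<in>{1..k}. i \<le> j \<longrightarrow> s (n i) \<le> s (n j)) \<and>
    (\<forall>i\<in>n ` {1..k}. \<forall>j\<in>index_set \<alpha> - n ` {1..k}. s i \<le> s j)"
proof
  assume n: "smallest_terms \<alpha> s k n"
  have "s i \<le> s j" if ij: "i \<in> n ` {1..k}" "j \<in> index_set \<alpha> - n ` {1..k}" for i j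
  proof -
    obtain m where m: "m \<in> {1..k}" "i = n m" using ij(1) by blast
    have "s (n m) \<le> s (n k)" using n m(1) k unfolding smallest_terms_def by auto
    also have "\<dots> \<le> s j" using n ij(2) unfolding smallest_terms_def by blast
    finally show ?thesis by (simp add: m(2))
  qed
  then show "n ` {1..k} \<subseteq> index_set \<alpha> \<and> inj_on n {1..k} \<and>
    (\<forall>i\<in>{1..k}. \<forall>j\<in>{1..k}. i \<le> j \<longrightarrow> s (n i) \<le> s (n j)) \<and>
    (\<forall>i\<in>n ` {1..k}. \<forall>j\<in>index_set \<alpha> - n ` {1..k}. s i \<le> s j)"
    using n unfolding smallest_terms_def by blast
next
  assume "n ` {1..k} \<subseteq> index_set \<alpha> \<and> inj_on n {1..k} \<and>
    (\<forall>i\<in>{1..k}. \<forall>j\<in>{1..k}. i \<le> j \<longrightarrow> s (n i) \<le> s (n j)) \<and>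
    (\<forall>i\<in>n ` {1..k}. \<forall>j\<in>index_set \<alpha> - n ` {1..k}. s i \<le> s j)"
  moreover have "n k \<in> n ` {1..k}" using k by simp
  ultimately show "smallest_terms \<alpha> s k n" unfolding smallest_terms_def by blast
qed

lemma smallest_terms_exist:
  assumes S: "finite S" "S \<subseteq> index_set \<alpha>" "card S = k" "1 \<le> k"
    and low: "\<forall>i\<in>S. \<forall>j\<in>index_set \<alpha> - S. s i \<le> s j"
  shows "\<exists>n. smallest_terms \<alpha> s k n"
proof -
  define xs where "xs = sort_key s (sorted_list_of_set S)"
  have xs: "length xs = k" "set xs = S" "distinct xs" "sorted (map s xs)"
    using S by (simp_all add: xs_def)
  (* Positions in lists start at 0, the indices in smallest_terms at 1. *)
  define n where "n i = xs ! (i - 1)" for i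
  have "n ` {1..k} = S"
  proof -
    have "n ` {1..k} = (\<lambda>i. xs ! i) ` ((\<lambda>i. i - 1) ` {1..k})" by (simp add: n_def image_image)
    also have "(\<lambda>i. i - 1) ` {1..k} = {..<k}"
    proof (intro equalityI subsetI)
      fix i assume "i \<in> {..<k}"
      then show "i \<in> (\<lambda>i. i - 1) ` {1..k}" by (intro image_eqI[of _ _ "Suc i"]) auto
    qed auto
    also have "(\<lambda>i. xs ! i) ` {..<k} = S"
      using xs(1,2) by (auto simp: set_conv_nth)
    finally show ?thesis .
  qed
  moreover have "inj_on n {1..k}"
    using xs(1,3) by (auto simp: inj_on_def n_def nth_eq_iff_index_eq)
  moreover have "s (n i) \<le> s (n j)" if "i \<in> {1..k}" "j \<in> {1..k}" "i \<le> j" for i j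
    using sorted_nth_mono[OF xs(4), of "i - 1" "j - 1"] that xs(1) by (auto simp: n_def)
  ultimately show ?thesis unfolding smallest_terms_iff[OF S(4)] using S(2) low by blast
qed

theorem theorem4p9:
  fixes f u :: "nat \<Rightarrow> 'h::complex_hilbert" and K :: "'h set"
    and F U :: "ell2 \<Rightarrow> 'h" and absF :: "ell2 \<Rightarrow> ell2"
    and \<alpha> :: enat and s :: "nat \<Rightarrow> real" and k :: nat
  defines "F \<equiv> synthesis f" and "absF \<equiv> abs_op F" and "U \<equiv> polar_part F"
    and "u \<equiv> (\<lambda>i. U (std_basis i))"
  assumes "separable_space (euclidean :: 'h topology)" and "\<not> finite_cdim (UNIV :: 'h set)"
    and "frame_in K f"
    and "close_parseval_frames f \<noteq> {}"
    and "nonzero_singular_values F \<alpha> s"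
    and "1 \<le> k" and "enat k \<le> \<alpha>"
  shows "((\<exists>y. symmetric_approximation f (close_parseval_frames_index f (int k)) y) \<longleftrightarrow>
            (\<exists>n. smallest_terms \<alpha> s k n)) \<and>
    (\<forall>n. smallest_terms \<alpha> s k n \<longrightarrow>
      (let A = {j \<in> index_set \<alpha>. 0 < s j \<and> s j < s (n k)};
           B = {j \<in> index_set \<alpha>. s j = s (n k)};
           E\<^sub>0 = projection_onto (closure (cspan (\<Union>j\<in>A. eigenspace absF (s j))));
           S = {y. symmetric_approximation f (close_parseval_frames_index f (int k)) y}
       in S = {(\<lambda>i. u i - U (E\<^sub>0 (std_basis i) + E\<^sub>1 (std_basis i))) | E\<^sub>1.
                 orth_projection E\<^sub>1 \<and> range E\<^sub>1 \<subseteq> eigenspace absF (s (n k)) \<and>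
                 has_rank E\<^sub>1 (k - card A)} \<and>
          ((\<exists>!y. y \<in> S) \<longleftrightarrow> finite A \<and> finite B \<and> card A + card B = k) \<and>
          (\<not> (finite A \<and> finite B \<and> card A + card B = k) \<longrightarrow> infinite S)))"
proof -
  note synF = frame_synthesis[OF \<open>frame_in K f\<close>, folded F_def]
  let ?I = "index_set \<alpha>"
  obtain g where g: "\<And>i j. i \<in> ?I \<Longrightarrow> j \<in> ?I \<Longrightarrow> cinner (g i) (g j) = (if i = j then 1 else 0)"
    "closure (cspan (g ` ?I)) = ortho_compl (kernel F)"
    "\<And>i. i \<in> ?I \<Longrightarrow> 0 < s i" "\<And>i. i \<in> ?I \<Longrightarrow> abs_op F (g i) = s i *\<^sub>R g i"
    using \<open>nonzero_singular_values F \<alpha> s\<close> unfolding nonzero_singular_values_def by blast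
  have close: "\<exists>X. partial_isometry X \<and> std_hs (\<lambda>x. F x - X x) < top"
    using \<open>close_parseval_frames f \<noteq> {}\<close> close_parseval_frames_iff[of F, OF synF(2)] by blast
  interpret singular_system F ?I s g
    by unfold_locales (use synF(1,3) close g in \<open>simp_all only:\<close>)
  note sym = symmetric_approximation_iff[OF meta_eq_to_obj_eq[OF F_def] synF(2)]
  have k1: "1 \<le> k" by fact
  have sizeI: "infinite ?I \<or> k \<le> card ?I"
  proof -
    have "{1..k} \<subseteq> ?I"
      using \<open>enat k \<le> \<alpha>\<close> order_trans[of "enat _" "enat k" \<alpha>] by (auto simp: index_set_def)
    then show ?thesis using card_mono[of ?I "{1..k}"] by auto
  qed
  have exists: "(\<exists>y. symmetric_approximation f (close_parseval_frames_index f (int k)) y) \<longleftrightarrow>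
      (\<exists>n. smallest_terms \<alpha> s k n)"
  proof
    assume "\<exists>y. symmetric_approximation f (close_parseval_frames_index f (int k)) y"
    then obtain X where "minimizer k X" unfolding sym by blast
    then obtain S where "lowest S" "card S = k" using minimizer_imp_lowest[OF _ k1 sizeI] by blast
    then show "\<exists>n. smallest_terms \<alpha> s k n"
      by (intro smallest_terms_exist[of S] k1) (auto simp: lowest_def)
  next
    assume "\<exists>n. smallest_terms \<alpha> s k n"
    then obtain n where n: "smallest_terms \<alpha> s k n" by blast
    then have "lowest (n ` {1..k})" "card (n ` {1..k}) = k"
      unfolding smallest_terms_iff[OF k1] lowest_def by (auto simp: card_image)
    from lowest_imp_minimizer[OF this]
    show "\<exists>y. symmetric_approximation f (close_parseval_frames_index f (int k)) y"
      unfolding sym by blast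
  qed
  have all: "let A = {j \<in> index_set \<alpha>. 0 < s j \<and> s j < s (n k)};
           B = {j \<in> index_set \<alpha>. s j = s (n k)};
           E\<^sub>0 = projection_onto (closure (cspan (\<Union>j\<in>A. eigenspace absF (s j))));
           S = {y. symmetric_approximation f (close_parseval_frames_index f (int k)) y}
       in S = {(\<lambda>i. u i - U (E\<^sub>0 (std_basis i) + E\<^sub>1 (std_basis i))) | E\<^sub>1.
                 orth_projection E\<^sub>1 \<and> range E\<^sub>1 \<subseteq> eigenspace absF (s (n k)) \<and>
                 has_rank E\<^sub>1 (k - card A)} \<and>
          ((\<exists>!y. y \<in> S) \<longleftrightarrow> finite A \<and> finite B \<and> card A + card B = k) \<and>
          (\<not> (finite A \<and> finite B \<and> card A + card B = k) \<longrightarrow> infinite S)"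
    if n: "smallest_terms \<alpha> s k n" for n
  proof -
    define L where "L = n ` {1..k}"
    have L: "lowest L" "card L = k"
      using n unfolding smallest_terms_iff[OF k1] lowest_def L_def by (auto simp: card_image)
    define t where "t = s (n k)"
    have nk: "n k \<in> L" "s (n k) = t" using k1 by (auto simp: L_def t_def)
    have max: "s i \<le> t" if "i \<in> L" for i
      using n that k1 unfolding smallest_terms_iff[OF k1] L_def t_def by auto
    have t0: "t > 0" using nk g(3)[of "n k"] L(1) by (auto simp: lowest_def)
    define A where "A = {j \<in> ?I. 0 < s j \<and> s j < t}"
    define B where "B = {j \<in> ?I. s j = t}"
    have A_eq: "A = {j \<in> ?I. s j < t}" using g(3) by (auto simp: A_def)
    note A = below_max_subset[OF L(1) nk, folded A_eq]
    have AI: "A \<subseteq> ?I" by (auto simp: A_def)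
    have cardA: "card A < k" using A(3) L(2) by simp
    define E0 where "E0 = projection_onto (closure (cspan (\<Union>j\<in>A. eigenspace absF (s j))))"
    have E0: "E0 = coord_proj A"
      unfolding E0_def absF_def by (rule projection_onto_eigenspaces[OF A(2) AI]) (auto simp: A_eq)
    define r where "r = k - card A"
    define Y where "Y E1 i = u i - U (E0 (std_basis i) + E1 (std_basis i))" for E1 and i :: nat
    define S where "S = {y. symmetric_approximation f (close_parseval_frames_index f (int k)) y}"
    have truncY: "(\<lambda>i. truncation (\<lambda>x. coord_proj A x + E1 x) (std_basis i)) = Y E1" for E1
      by (simp add: fun_eq_iff truncation_def Y_def u_def U_def E0 bounded_clinearD(2)[OF bounded_clinear_U])
    have S_eq: "S = Y ` eigen_projections t r"
    proof -
      note opt = optimal_cut_iff[OF L nk max]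
      note split = optimal_cut_decomposition[OF t0 A_eq A(2) less_imp_le[OF cardA], folded r_def]
      have "y \<in> S \<longleftrightarrow> (\<exists>E1\<in>eigen_projections t r. y = Y E1)" for y
      proof
        assume "y \<in> S"
        then obtain X where X: "minimizer k X" "y = (\<lambda>i. X (std_basis i))"
          unfolding S_def mem_Collect_eq sym by blast
        obtain E where E: "cut k E" "X = truncation E"
          "isum (\<lambda>i. s i * (norm (E (g i)))\<^sup>2) = ennreal (\<Sum>i\<in>L. s i)"
          using X(1) unfolding minimizer_iff[OF L k1] by blast
        then obtain E1 where E1: "E1 \<in> eigen_projections t r" "E = (\<lambda>x. coord_proj A x + E1 x)"
          using split[of E] opt[OF _ E(1)] by blast
        have "y = Y E1" unfolding X(2) E(2) E1(2) truncY ..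
        then show "\<exists>E1\<in>eigen_projections t r. y = Y E1" using E1(1) by blast
      next
        assume "\<exists>E1\<in>eigen_projections t r. y = Y E1"
        then obtain E1 where E1: "E1 \<in> eigen_projections t r" "y = Y E1" by blast
        define E where "E = (\<lambda>x. coord_proj A x + E1 x)"
        have "cut k E \<and> isum (\<lambda>i. s i * (norm (E (g i)))\<^sup>2) = ennreal (\<Sum>i\<in>L. s i)"
          using split[of E] opt[of E] E1(1) E_def by blast
        then have "minimizer k (truncation E)" unfolding minimizer_iff[OF L k1] by blast
        moreover have "y = (\<lambda>i. truncation E (std_basis i))" unfolding E1(2) E_def truncY ..
        ultimately show "y \<in> S" unfolding S_def mem_Collect_eq sym by blast
      qed
      then show ?thesis by blast
    qed
    have injY: "inj_on Y (eigen_projections t r)"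
      using inj_on_approximations[OF t0 orth_projectionD(1)[OF coord_proj(1)[OF A(2) AI]], of r]
      unfolding Y_def u_def U_def E0 .
    have set_eq: "S = {(\<lambda>i. u i - U (E0 (std_basis i) + E\<^sub>1 (std_basis i))) | E\<^sub>1.
        orth_projection E\<^sub>1 \<and> range E\<^sub>1 \<subseteq> eigenspace absF t \<and> has_rank E\<^sub>1 (k - card A)}"
      unfolding S_eq eigen_projections_def Y_def r_def absF_def by blast
    have nonempty: "S \<noteq> {}" using exists n unfolding S_def by blast
    have r1: "1 \<le> r" using cardA by (simp add: r_def)
    have inf: "infinite S" if not: "\<not> (finite A \<and> finite B \<and> card A + card B = k)"
    proof -
      have "infinite B \<or> r < card B"
      proof (cases "finite B")
        case True
        have "L \<subseteq> A \<union> B" using max L(1) by (force simp: A_eq B_def lowest_def)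
        then have "k \<le> card A + card B"
          using card_mono[of "A \<union> B" L] card_Un_le[of A B] True A(2) L(2) by simp
        then show ?thesis using not True A(2) cardA by (auto simp: r_def)
      qed simp
      then have "infinite (eigen_projections t r)"
        unfolding B_def by (rule infinite_eigen_projections[OF t0 r1])
      then show ?thesis unfolding S_eq using injY finite_image_iff by blast
    qed
    have unique: "\<exists>!y. y \<in> S" if fin: "finite A \<and> finite B \<and> card A + card B = k"
    proof -
      have "card B = r" using fin cardA unfolding r_def by linarith
      then have "E = E'" if "E \<in> eigen_projections t r" "E' \<in> eigen_projections t r" for E E'
        using eigen_projections_singleton[OF t0 _ _ that] fin unfolding B_def by blast
      then show ?thesis using nonempty unfolding S_eq by blast
    qed
    have "(\<exists>!y. y \<in> S) \<longleftrightarrow> finite A \<and> finite B \<and> card A + card B = k"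
    proof
      assume "\<exists>!y. y \<in> S"
      then obtain y where "S = {y}" by blast
      then have "finite S" by simp
      then show "finite A \<and> finite B \<and> card A + card B = k" using inf by blast
    qed (rule unique)
    then show ?thesis
      unfolding Let_def t_def[symmetric] A_def[symmetric] B_def[symmetric] E0_def[symmetric]
        S_def[symmetric]
      using set_eq inf by blast
  qed
  show ?thesis using exists all by blast
qed

end
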